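(* Let Assumption B1 hold and let the closed-loop system $$y_{t+1}=f(\theta,\varphi_t)+u_t+w_{t+1},\qquad t\ge1-m,$$ in an experiment $(\chi_0,\{u_t\})\in\mathcal E$, be stable, i.e. $\sup_{t\ge1}\frac1t\sum_{i=1}^ty_i^2<\infty$ a.s. Suppose that either $C_w<\infty$ and $\underline d^{\,2^{n-1}m}(\mathcal P'|\mathcal S^{2^{n-1}m})>1/C_w$, or $C_w=\infty$ and $\mathcal P'\neq\emptyset$. Then, by choosing the parameter $\gamma$ sufficiently large and the parameter $\lambda\in(0,\frac14-\frac1{2\kappa})$, the grid searching estimator $\hat\theta_t$ satisfies, with $\tilde\theta_t=\hat\theta_t-\theta$, $$\|\tilde\theta_t\|=O\left(\frac1{t^{\frac14-\frac1{2\kappa}-\lambda}}\right)\to0,\qquad\text{a.s.}$$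
   Context: **System.** $u_t,y_t,w_t$ are scalars, $\varphi_t=(y_t,\dots,y_{t-m+1})^T\in\mathbb R^m$, and $\theta$ is an unknown non-random parameter in a known nondegenerate compact hyperrectangle $\Theta\subset\mathbb R^n$. $f(x,z):\mathbb R^n\times\mathbb R^m\to\mathbb R$ is known, $\partial f/\partial x$ exists, and $f$ and $\partial f/\partial x$ are continuous. $\mathcal E$ is the set of experiments $(\chi_0,\{u_t\})$ ($\chi_0$ the initial regressor from which the recursion is started) with $|u_t|\le C_u$, $t\ge1$, for a given $C_u>0$. $B(z,d)$ denotes the open ball. **Assumption B1.** $\{w_t\}$ is i.i.d. with $Ew_1=0$ and $E|w_1|^\kappa<\infty$ for some $\kappa>4$; $C_w\in(0,\infty]$ and: (i) if $C_w<\infty$, then $|w_1|\le C_w$ and $\inf_{z\in[-C_w,C_w]}P(w_1\in B(z,\delta))>0$ for all $\delta>0$; (ii) if $C_w=\infty$, then for every $C'>0$, $\inf_{|z|\le C'}P(w_1\in B(z,\delta))>0$ for all $\delta>0$. Moreover, for each $t\ge 1$, $w_t$ is independent of $\chi_0$ and $\{u_i\}_{0\le i\le t-1}$. Write $\sigma_w^2=Ew_1^2$. **The set $\mathcal P'$.** For $1\le k\le n$ and $k\le j\le n$ define functions $g^k_j(x,y)$ of $x\in(\mathbb R^n)^{2^{k-1}}$, $y\in(\mathbb R^m)^{2^{k-1}}$ recursively: $g^1_j(x,y)=\partial f(x,y)/\partial x_j$ for $1\le j\le n$, and, for $1\le k<j\le n$, with $z=(x,y)$, $\bar z=(\bar x,\bar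 y)$, $$g^{k+1}_j(z,\bar z)=g^k_k(z)g^k_j(\bar z)-g^k_k(\bar z)g^k_j(z),$$ where $(z,\bar z)$ is regarded as the pair $((x,\bar x),(y,\bar y))$. Then $\mathcal P'=\{\beta\in\mathbb R^{2^{n-1}m}:g^n_n(x,\beta)\neq0\ \ \forall x\in\Theta^{2^{n-1}}\}$. **Densities and $\mathcal S$.** For $Z,Z'\subset\mathbb R$, $\underline d(Z'|Z)=1/\sup_{z\in Z}\inf\{d>0:B(z,d)\cap Z'\ne\emptyset\}$ (with $\inf\emptyset=\infty$, $1/0=\infty$, $1/\infty=0$). For $N\ge1$, $Z=\prod_{j=1}^NZ_j$, $Z_j\subset\mathbb R$, $Z'\subset\mathbb R^N$: $\underline d^N(Z'|Z)=\sup\{\min_{j\le N}\underline d(E_j|Z_j):E_j\subset\mathbb R,\ \prod_jE_j\subset Z'\}$. $\mathcal S=[-C_0,C_0]\subset\mathbb R$, where $C_0>0$ is a constant (depending on the parameter $C$ below) such that whenever $\|\varphi_t\|\le C$ one has $|f(\theta,\varphi_i)+u_i|\le C_0$ for $i=t,\dots,t+m-1$. **Grid searching estimator.** Adjustable parameters: $\lambda,\gamma,C>0$; $C>0$ is given ($C$ may be taken $\infty$). Let $\Omega_i=\{\|\varphi_i\|\le C\}$; $\Omega_i(\gamma,C)=\Omega_{i-m}$ if $C_w<\infty$ and $\Omega_i(\gamma,C)=\Omega_{i-m}\cap\{\|\varphi_i\|\le\gamma\}$ if $C_w=\infty$; $\eta_t(\gamma)=\sum_{i=1}^tI_{\Omega_i(\gamma,C)}$.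 For $x\in\mathbb R^n$, $x'\in\mathbb R$, $t\ge2$ let $$\hat G_t(x,x')=\sum_{i=1}^{t-1}(f(x,\varphi_i)+u_i-y_{i+1})^2I_{\Omega_i(\gamma,C)}-\eta_t(\gamma)x'.$$ Put $C_\phi=\frac n4\max_{x\in\Theta,\|z\|\le\gamma}\|\partial f(x,z)/\partial x\|^2+1$. The set $\Sigma^0_t$ is: $\{\sigma_w^2\}$ if $\sigma_w^2$ is known; $[0,t]$ if nothing is known about $\sigma_w^2$; $[0,\sigma]$ if $\sigma^2_w\le\sigma$ for a known constant $\sigma>0$. Step 1 ($t=0$): $\hat\theta_0$, $\hat\sigma_0^2$ are the centers of $\Theta$ and $\Sigma^0_0$. Step 2 ($t\ge1$): divide $\Theta$ and $\Sigma_t^0$ equally into finitely many small boxes $\{\Theta_{ti}\}$, $\{\Sigma_{tj}\}$, $\Theta=\bigcup_i\Theta_{ti}$, $\Sigma^0_t=\bigcup_j\Sigma_{tj}$, with side lengths less than $1/t^{\frac14-\frac1{2\kappa}-\lambda}$ and $1/t^{\frac12-\frac1\kappa-\lambda}$ respectively; let $o_{ti}$, $\sigma^2_{tj}$ be the centers of $\Theta_{ti}$, $\Sigma_{tj}$. Let $\mathcal J_t=\{(i,j):|\hat G_t(o_{ti},\sigma^2_{tj})|\le C_\phi t^{\frac12+\frac1\kappa+2\lambda}\}$. If $\mathcal J_t=\emptyset$, set $\hat\theta_t=\hat\theta_{t-1}$, $\hat\sigma^2_t=\hat\sigma^2_{t-1}$. Otherwise take an arbitrary $(i^*,j^* )\in\mathcal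 J_t$ with $\sigma^2_{tj^*}=\min_{(i,j)\in\mathcal J_t}\sigma^2_{tj}$ and set $\hat\theta_t=o_{ti^*}$, $\hat\sigma^2_t=\sigma^2_{tj^*}$.
   Formalization: If C_w and C are both finite, it is also assumed that a.s. ‖φ_t‖≤C holds for a set of times of positive lower frequency; and each w_t, t≥1, is assumed independent of χ_0, all inputs u_i with 1-m≤i≤t-1 and the earlier noises jointly. *)

theory Defs
  imports "HOL-Probability.Probability" "HOL-Library.Landau_Symbols"
begin

text \<open>
  Conventions. The dimensions are \<open>n = CARD('n)\<close> and \<open>m = CARD('m)\<close>. The order of the coordinates
  matters and an abstract finite index type has none, so it is given by a numbering
  \<open>coord\<close> of \<open>'n\<close> by \<open>{1..n}\<close> and a numbering \<open>lag\<close> of \<open>'m\<close> by \<open>{0..<m}\<close>: component \<open>l\<close> of the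
  regressor at time \<open>t\<close> is the output at time \<open>t - lag l\<close>. Time is an \<open>int\<close>, because the recursion
  starts at \<open>1 - m\<close>. Bounds that may be infinite (\<open>Cw\<close>, \<open>C\<close>) are of type \<open>ennreal\<close>.
\<close>

definition regressor :: "('m::finite \<Rightarrow> nat) \<Rightarrow> (int \<Rightarrow> real) \<Rightarrow> int \<Rightarrow> real ^ 'm" where
  "regressor lag y t = (\<chi> l. y (t - int (lag l)))"

subsection \<open>Noise, inputs and stability\<close>

text \<open>
  The last clause of the noise assumption makes \<open>w t\<close> independent of the whole past
  (\<open>\<chi>0\<close>, the earlier inputs, the earlier noises) jointly. Independence of \<open>w t\<close> from the pair
  (\<open>\<chi>0\<close>, earlier inputs) and from the earlier noises separately would not make \<open>w t\<close>
  independent of the regressor at time \<open>t - 1\<close>.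
\<close>

definition assumption_B1 ::
  "'a measure \<Rightarrow> int \<Rightarrow> ennreal \<Rightarrow> real \<Rightarrow> ('a \<Rightarrow> real ^ 'm::finite) \<Rightarrow> (int \<Rightarrow> 'a \<Rightarrow> real)
    \<Rightarrow> (int \<Rightarrow> 'a \<Rightarrow> real) \<Rightarrow> bool" where
  "assumption_B1 M m Cw \<kappa> \<chi>0 u w \<longleftrightarrow>
     prob_space.indep_vars M (\<lambda>_. borel) w {2 - m..} \<and>
     (\<forall>t\<ge>2 - m. distr M borel (w t) = distr M borel (w 1)) \<and>
     integral\<^sup>L M (w 1) = 0 \<and>
     4 < \<kappa> \<and> integrable M (\<lambda>\<omega>. \<bar>w 1 \<omega>\<bar> powr \<kappa>) \<and>
     0 < Cw \<and>
     (Cw < \<infinity> \<longrightarrow>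
        (AE \<omega> in M. ennreal \<bar>w 1 \<omega>\<bar> \<le> Cw) \<and>
        (\<forall>\<delta>>0. 0 < (INF z\<in>{z. ennreal \<bar>z\<bar> \<le> Cw}. measure M {\<omega>\<in>space M. w 1 \<omega> \<in> ball z \<delta>}))) \<and>
     (Cw = \<infinity> \<longrightarrow>
        (\<forall>C'>0. \<forall>\<delta>>0. 0 < (INF z\<in>{- C'..C'}. measure M {\<omega>\<in>space M. w 1 \<omega> \<in> ball z \<delta>}))) \<and>
     (\<forall>t\<ge>1. prob_space.indep_set M
        (sets (vimage_algebra (space M) (w t) borel))
        (sets (vimage_algebra (space M)
          (\<lambda>\<omega>. (\<chi>0 \<omega>, (\<lambda>i\<in>{1 - m..t - 1}. u i \<omega>), (\<lambda>i\<in>{2 - m..t - 1}. w i \<omega>)))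
          (borel \<Otimes>\<^sub>M (Pi\<^sub>M {1 - m..t - 1} (\<lambda>_. borel) \<Otimes>\<^sub>M Pi\<^sub>M {2 - m..t - 1} (\<lambda>_. borel))))))"

definition admissible_experiment ::
  "'a measure \<Rightarrow> int \<Rightarrow> real \<Rightarrow> ('a \<Rightarrow> real ^ 'm::finite) \<Rightarrow> (int \<Rightarrow> 'a \<Rightarrow> real) \<Rightarrow> bool" where
  "admissible_experiment M m Cu \<chi>0 u \<longleftrightarrow>
     \<chi>0 \<in> borel_measurable M \<and> (\<forall>t\<ge>1 - m. u t \<in> borel_measurable M) \<and>
     (AE \<omega> in M. \<forall>t\<ge>1. \<bar>u t \<omega>\<bar> \<le> Cu)"

definition stable_path :: "(int \<Rightarrow> real) \<Rightarrow> bool" where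
  "stable_path y \<longleftrightarrow> bdd_above ((\<lambda>t::nat. (\<Sum>i=1..t. (y (int i))\<^sup>2) / real t) ` {1..})"

text \<open>
  A trajectory spends a positive fraction of time in \<open>{z. norm z \<le> C}\<close>. A path that is stable
  has this property for every large enough \<open>C\<close>, with a threshold depending on the path. For
  bounded noise a finite \<open>C\<close> has to be chosen this way: on a path that never enters the ball, the
  criterion of the estimator vanishes identically.
\<close>

definition visits_ball :: "('m::finite \<Rightarrow> nat) \<Rightarrow> ennreal \<Rightarrow> (int \<Rightarrow> real) \<Rightarrow> bool" where
  "visits_ball lag C y \<longleftrightarrow>
     0 < liminf (\<lambda>t. ereal (real (card {i\<in>{1..t}. ennreal (norm (regressor lag y (int i))) \<le> C}) / real t))"

subsection \<open>The set \<open>P'\<close>\<close>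

text \<open>
  A point of the \<open>2 ^ (k - 1)\<close>-fold power is a sequence of which only the first \<open>2 ^ (k - 1)\<close>
  entries are read; in the step from \<open>Suc k\<close> to \<open>Suc (Suc k)\<close> the first \<open>2 ^ k\<close> entries form \<open>z\<close> and
  the next \<open>2 ^ k\<close> form the second argument. \<open>D j x z\<close> is the partial derivative with respect to
  the \<open>j\<close>-th coordinate of \<open>x\<close>, and the value at level \<open>0\<close> is unused.
\<close>

fun g_fun :: "(nat \<Rightarrow> 'x \<Rightarrow> 'z \<Rightarrow> real) \<Rightarrow> nat \<Rightarrow> nat \<Rightarrow> (nat \<Rightarrow> 'x) \<Rightarrow> (nat \<Rightarrow> 'z) \<Rightarrow> real" where
  "g_fun D 0 j X Y = 0"
| "g_fun D (Suc 0) j X Y = D j (X 0) (Y 0)"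
| "g_fun D (Suc (Suc k)) j X Y =
     g_fun D (Suc k) (Suc k) X Y * g_fun D (Suc k) j (\<lambda>i. X (i + 2 ^ k)) (\<lambda>i. Y (i + 2 ^ k))
     - g_fun D (Suc k) (Suc k) (\<lambda>i. X (i + 2 ^ k)) (\<lambda>i. Y (i + 2 ^ k)) * g_fun D (Suc k) j X Y"

definition P_set ::
  "(real ^ 'n \<Rightarrow> real ^ 'm \<Rightarrow> real ^ 'n) \<Rightarrow> (nat \<Rightarrow> 'n::finite) \<Rightarrow> ('m::finite \<Rightarrow> nat)
    \<Rightarrow> (real ^ 'n) set \<Rightarrow> (nat \<Rightarrow> real) set" where
  "P_set Df coord lag \<Theta> =
     {\<beta> \<in> {..<2 ^ (CARD('n) - 1) * CARD('m)} \<rightarrow>\<^sub>E UNIV.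
        \<forall>X. (\<forall>i<2 ^ (CARD('n) - 1). X i \<in> \<Theta>) \<longrightarrow>
          g_fun (\<lambda>j x z. Df x z $ coord j) CARD('n) CARD('n) X
            (\<lambda>i. \<chi> l. \<beta> (i * CARD('m) + lag l)) \<noteq> 0}"

subsection \<open>Densities\<close>

definition lower_density :: "real set \<Rightarrow> real set \<Rightarrow> ennreal" where
  "lower_density Z' Z = 1 / (SUP z\<in>Z. Inf (ennreal ` {d. 0 < d \<and> ball z d \<inter> Z' \<noteq> {}}))"

definition lower_density_prod :: "nat \<Rightarrow> (nat \<Rightarrow> real) set \<Rightarrow> (nat \<Rightarrow> real set) \<Rightarrow> ennreal" where
  "lower_density_prod N Z' Z =
     Sup {Min ((\<lambda>j. lower_density (E j) (Z j)) ` {..<N}) | E. (\<Pi>\<^sub>E j\<in>{..<N}. E j) \<subseteq> Z'}"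

subsection \<open>The grid searching estimator, along one trajectory\<close>

definition active ::
  "('m::finite \<Rightarrow> nat) \<Rightarrow> ennreal \<Rightarrow> ennreal \<Rightarrow> real \<Rightarrow> (int \<Rightarrow> real) \<Rightarrow> int \<Rightarrow> bool" where
  "active lag Cw C \<gamma> y i \<longleftrightarrow>
     ennreal (norm (regressor lag y (i - int CARD('m)))) \<le> C \<and>
     (Cw = \<infinity> \<longrightarrow> norm (regressor lag y i) \<le> \<gamma>)"

definition eta ::
  "('m::finite \<Rightarrow> nat) \<Rightarrow> ennreal \<Rightarrow> ennreal \<Rightarrow> real \<Rightarrow> (int \<Rightarrow> real) \<Rightarrow> nat \<Rightarrow> real" where
  "eta lag Cw C \<gamma> y t = (\<Sum>i=1..t. of_bool (active lag Cw C \<gamma> y (int i)))"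

definition G_hat ::
  "(real ^ 'n \<Rightarrow> real ^ 'm \<Rightarrow> real) \<Rightarrow> ('m::finite \<Rightarrow> nat) \<Rightarrow> ennreal \<Rightarrow> ennreal \<Rightarrow> real
    \<Rightarrow> (int \<Rightarrow> real) \<Rightarrow> (int \<Rightarrow> real) \<Rightarrow> nat \<Rightarrow> real ^ 'n \<Rightarrow> real \<Rightarrow> real" where
  "G_hat f lag Cw C \<gamma> u y t x x' =
     (\<Sum>i=1..<t. (f x (regressor lag y (int i)) + u (int i) - y (int i + 1))\<^sup>2
        * of_bool (active lag Cw C \<gamma> y (int i)))
     - eta lag Cw C \<gamma> y t * x'"

definition C_phi ::
  "(real ^ 'n \<Rightarrow> real ^ 'm::finite \<Rightarrow> real ^ 'n::finite) \<Rightarrow> (real ^ 'n) set \<Rightarrow> real \<Rightarrow> real" where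
  "C_phi Df \<Theta> \<gamma> =
     real CARD('n) / 4 * (SUP (x, z)\<in>\<Theta> \<times> cball 0 \<gamma>. (norm (Df x z))\<^sup>2) + 1"

datatype variance_prior = Known | Unknown | Bounded real

text \<open>Lower and upper end of the variance search interval at time \<open>t\<close>; \<open>s\<close> is the true variance.\<close>

fun prior_lo :: "variance_prior \<Rightarrow> real \<Rightarrow> nat \<Rightarrow> real" where
  "prior_lo Known s t = s"
| "prior_lo Unknown s t = 0"
| "prior_lo (Bounded b) s t = 0"

fun prior_hi :: "variance_prior \<Rightarrow> real \<Rightarrow> nat \<Rightarrow> real" where
  "prior_hi Known s t = s"
| "prior_hi Unknown s t = real t"
| "prior_hi (Bounded b) s t = b"

definition valid_prior :: "variance_prior \<Rightarrow> real \<Rightarrow> bool" where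
  "valid_prior V s \<longleftrightarrow> (\<forall>b. V = Bounded b \<longrightarrow> 0 < b \<and> s \<le> b)"

text \<open>
  At time \<open>t\<close> the \<open>k\<close>-th side of \<open>cbox a b\<close> is cut into \<open>p t k\<close> equal parts and the variance
  interval into \<open>q t\<close> equal parts; a box is named by its position in each direction.
\<close>

definition fine_grid ::
  "real ^ 'n \<Rightarrow> real ^ 'n \<Rightarrow> (nat \<Rightarrow> real) \<Rightarrow> (nat \<Rightarrow> real) \<Rightarrow> real \<Rightarrow> real
    \<Rightarrow> (nat \<Rightarrow> 'n::finite \<Rightarrow> nat) \<Rightarrow> (nat \<Rightarrow> nat) \<Rightarrow> bool" where
  "fine_grid a b lo hi \<kappa> lam p q \<longleftrightarrow>
     (\<forall>t\<ge>1. (\<forall>k. 0 < p t k \<and>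
               (b $ k - a $ k) / real (p t k) < 1 / real t powr (1 / 4 - 1 / (2 * \<kappa>) - lam)) \<and>
             0 < q t \<and> (hi t - lo t) / real (q t) < 1 / real t powr (1 / 2 - 1 / \<kappa> - lam))"

definition box_center :: "real ^ 'n \<Rightarrow> real ^ 'n \<Rightarrow> ('n::finite \<Rightarrow> nat) \<Rightarrow> ('n \<Rightarrow> nat) \<Rightarrow> real ^ 'n" where
  "box_center a b p i = (\<chi> k. a $ k + (real (i k) + 1 / 2) * ((b $ k - a $ k) / real (p k)))"

definition interval_center :: "real \<Rightarrow> real \<Rightarrow> nat \<Rightarrow> nat \<Rightarrow> real" where
  "interval_center lo hi q j = lo + (real j + 1 / 2) * ((hi - lo) / real q)"

definition J_set ::
  "(real ^ 'n \<Rightarrow> real ^ 'm \<Rightarrow> real) \<Rightarrow> (real ^ 'n \<Rightarrow> real ^ 'm \<Rightarrow> real ^ 'n)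
    \<Rightarrow> real ^ 'n \<Rightarrow> real ^ 'n \<Rightarrow> (nat \<Rightarrow> real) \<Rightarrow> (nat \<Rightarrow> real)
    \<Rightarrow> ('m::finite \<Rightarrow> nat) \<Rightarrow> ennreal \<Rightarrow> ennreal \<Rightarrow> real \<Rightarrow> real \<Rightarrow> real
    \<Rightarrow> (nat \<Rightarrow> 'n::finite \<Rightarrow> nat) \<Rightarrow> (nat \<Rightarrow> nat)
    \<Rightarrow> (int \<Rightarrow> real) \<Rightarrow> (int \<Rightarrow> real) \<Rightarrow> nat \<Rightarrow> (('n \<Rightarrow> nat) \<times> nat) set" where
  "J_set f Df a b lo hi lag Cw C \<gamma> \<kappa> lam p q u y t =
     {(i, j). (\<forall>k. i k < p t k) \<and> j < q t \<and>
        \<bar>G_hat f lag Cw C \<gamma> u y t (box_center a b (p t) i) (interval_center (lo t) (hi t) (q t) j)\<bar>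
          \<le> C_phi Df (cbox a b) \<gamma> * real t powr (1 / 2 + 1 / \<kappa> + 2 * lam)}"

text \<open>
  The choice of a minimizer is arbitrary, so this is a relation between the data \<open>(u, y)\<close> and the
  sequences of estimates.
\<close>

definition grid_searching_estimates ::
  "(real ^ 'n \<Rightarrow> real ^ 'm \<Rightarrow> real) \<Rightarrow> (real ^ 'n \<Rightarrow> real ^ 'm \<Rightarrow> real ^ 'n)
    \<Rightarrow> real ^ 'n \<Rightarrow> real ^ 'n \<Rightarrow> (nat \<Rightarrow> real) \<Rightarrow> (nat \<Rightarrow> real)
    \<Rightarrow> ('m::finite \<Rightarrow> nat) \<Rightarrow> ennreal \<Rightarrow> ennreal \<Rightarrow> real \<Rightarrow> real \<Rightarrow> real
    \<Rightarrow> (nat \<Rightarrow> 'n::finite \<Rightarrow> nat) \<Rightarrow> (nat \<Rightarrow> nat)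
    \<Rightarrow> (int \<Rightarrow> real) \<Rightarrow> (int \<Rightarrow> real) \<Rightarrow> (nat \<Rightarrow> real ^ 'n) \<Rightarrow> (nat \<Rightarrow> real) \<Rightarrow> bool" where
  "grid_searching_estimates f Df a b lo hi lag Cw C \<gamma> \<kappa> lam p q u y \<theta>h sh \<longleftrightarrow>
     \<theta>h 0 = (1 / 2) *\<^sub>R (a + b) \<and> sh 0 = (lo 0 + hi 0) / 2 \<and>
     (\<forall>t\<ge>1. let J = J_set f Df a b lo hi lag Cw C \<gamma> \<kappa> lam p q u y t;
                ctr = interval_center (lo t) (hi t) (q t) in
        if J = {} then \<theta>h t = \<theta>h (t - 1) \<and> sh t = sh (t - 1)
        else \<exists>(i, j)\<in>J. ctr j = Min ((\<lambda>(i', j'). ctr j') ` J) \<and>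
               \<theta>h t = box_center a b (p t) i \<and> sh t = ctr j)"

end

theory Submission
  imports Defs "HOL-Real_Asymp.Real_Asymp"
begin

text \<open>
  Write \<open>\<Delta>\<^sub>i(x) = f(x, \<phi>\<^sub>i) - f(\<theta>, \<phi>\<^sub>i)\<close> and let \<open>A\<^sub>i\<close> be the indicator that time \<open>i\<close> enters the
  criterion. Since \<open>f(x, \<phi>\<^sub>i) + u\<^sub>i - y\<^sub>i\<^sub>+\<^sub>1 = \<Delta>\<^sub>i(x) - w\<^sub>i\<^sub>+\<^sub>1\<close>, expanding the square gives
  (\<open>criterion_expansion\<close>)

    \<open>G\<^sub>t(x, x') = \<Sum> \<Delta>\<^sub>i(x)\<^sup>2 A\<^sub>i - 2 \<Sum> \<Delta>\<^sub>i(x) w\<^sub>i\<^sub>+\<^sub>1 A\<^sub>i + \<Sum> (w\<^sub>i\<^sub>+\<^sub>1\<^sup>2 - \<sigma>\<^sup>2) A\<^sub>i - \<eta>\<^sub>t (x' - \<sigma>\<^sup>2) + O(1)\<close>.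

  The weights \<open>\<Delta>\<^sub>i(x) A\<^sub>i\<close> and \<open>A\<^sub>i\<close> depend on the past of \<open>w\<^sub>i\<^sub>+\<^sub>1\<close> only, so both noise sums are almost
  surely of order \<open>t powr (1/2 + \<epsilon>)\<close> for every \<open>\<epsilon> > 0\<close>, the first one uniformly in \<open>x\<close>
  (\<open>uniform_noise_bound\<close>, \<open>cross_sum_bound\<close>, \<open>variance_sum_bound\<close>). With \<open>\<epsilon> = 1/\<kappa> + \<lambda>\<close> this is
  below the acceptance level \<open>t powr (1/2 + 1/\<kappa> + 2\<lambda>)\<close>. Hence the grid point nearest to \<open>(\<theta>, \<sigma>\<^sup>2)\<close> is
  eventually accepted: there \<open>\<Sum> \<Delta>\<^sub>i\<^sup>2 A\<^sub>i\<close> is at most \<open>t\<close> times the squared mesh times the constant that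
  the acceptance level provides for. The estimator takes an accepted point with minimal variance
  coordinate, so this coordinate exceeds \<open>\<sigma>\<^sup>2\<close> by at most one mesh, the term \<open>-\<eta>\<^sub>t (x' - \<sigma>\<^sup>2)\<close> cannot
  hide a large value of \<open>\<Sum> \<Delta>\<^sub>i(x)\<^sup>2 A\<^sub>i\<close>, and at the estimate this sum is of order
  \<open>t powr (1/2 + 1/\<kappa> + 2\<lambda>)\<close>.

  It remains to bound the sum from below by \<open>c t \<parallel>x - \<theta>\<parallel>\<^sup>2\<close>, uniformly in \<open>x\<close> (\<open>exciting\<close>). Two
  facts give this. First, the functions \<open>g\<close> perform Gaussian elimination on the gradients of \<open>f\<close>
  at several regressors: if the final pivot never vanishes, no nonzero direction is
  orthogonal to all the gradients (\<open>P_set_spanning\<close>), and by compactness this is quantitative and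
  stable under small changes of the regressors (\<open>uniform_excitation\<close>). Secondly, whatever the past is, the noise
  moves the next output close to any prescribed value in its range, with a probability bounded
  below. Repeating this \<open>m\<close> times brings the regressor close to any prescribed block of a point of
  \<open>P'\<close> with positive frequency (\<open>steering_step\<close>, \<open>steered_frequency\<close>). For bounded noise the density
  hypothesis says that some admissible target is always in range; unbounded noise reaches
  everything, and stability supplies the bounded region from which to start.

  Together, \<open>c t \<parallel>\<theta>\<^sub>t - \<theta>\<parallel>\<^sup>2\<close> is of order \<open>t powr (1/2 + 1/\<kappa> + 2\<lambda>)\<close> for the estimate \<open>\<theta>\<^sub>t\<close>, which is
  the assertion (\<open>estimation_error_rate\<close>).
\<close>

section \<open>Weighted sums of noise with weights from the past\<close>

lemma exp_le_quadratic:
  fixes x :: real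
  assumes "\<bar>x\<bar> \<le> 1"
  shows "exp x \<le> 1 + x + x\<^sup>2"
proof (cases "0 \<le> x")
  case True
  then show ?thesis using exp_bound[of x] assms by simp
next
  case False
  define z where "z = - x"
  have z: "0 < z" "z \<le> 1" using False assms by (auto simp: z_def)
  have "1 \<le> 1 + z ^ 3" using z by simp
  also have "\<dots> = (1 - z + z\<^sup>2) * (1 + z)" by (simp add: algebra_simps power2_eq_square power3_eq_cube)
  also have "\<dots> \<le> (1 - z + z\<^sup>2) * exp z"
  proof (rule mult_left_mono)
    show "0 \<le> 1 - z + z\<^sup>2" using z zero_le_power2[of z] by linarith
  qed simp
  finally have "exp (- z) \<le> 1 - z + z\<^sup>2" by (simp add: exp_minus field_simps)
  then show ?thesis by (simp add: z_def)
qed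

text \<open>
  The noise is observed along an increasing family of \<sigma>-algebras \<open>F i\<close>, where \<open>F i\<close> may
  contain more than the noise up to time \<open>i\<close>, such as an initial state and control inputs.
\<close>

locale driven_noise = prob_space M for M :: "'a measure" +
  fixes F :: "nat \<Rightarrow> 'a measure" and w :: "nat \<Rightarrow> 'a \<Rightarrow> real"
  assumes subalg: "subalgebra M (F i)"
    and mono: "i \<le> j \<Longrightarrow> sets (F i) \<subseteq> sets (F j)"
    and adapted: "w (Suc i) \<in> borel_measurable (F (Suc i))"
    and indep_past: "indep_set (sets (vimage_algebra (space M) (w (Suc i)) borel)) (sets (F i))"
    and ident: "distr M borel (w (Suc i)) = distr M borel (w 1)"
begin

lemma space_F [simp]: "space (F i) = space M"
  using subalg by (simp add: subalgebra_def)

lemma measurable_from_past: "X \<in> measurable (F i) N \<Longrightarrow> X \<in> measurable M N"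
  using measurable_from_subalg[OF subalg] by blast

lemma measurable_later:
  assumes "i \<le> j" "X \<in> measurable (F i) N" shows "X \<in> measurable (F j) N"
  using assms mono[OF assms(1)] by (auto simp: measurable_def)

lemma measurable_w [measurable]: "w (Suc i) \<in> borel_measurable M"
  using measurable_from_past[OF adapted] .

lemma measurable_w1 [measurable]: "w 1 \<in> borel_measurable M"
  using measurable_w[of 0] by simp

lemma indep_var_past:
  fixes X :: "'a \<Rightarrow> real" and \<psi> :: "real \<Rightarrow> real"
  assumes "X \<in> borel_measurable (F i)" and [measurable]: "\<psi> \<in> borel_measurable borel"
  shows "indep_var borel X borel (\<lambda>\<omega>. \<psi> (w (Suc i) \<omega>))"
proof -
  let ?V = "vimage_algebra (space M) (w (Suc i)) borel"
  have X: "X \<in> borel_measurable M" using measurable_from_past[OF assms(1)] .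
  have 1: "sigma_sets (space M) {X -` A \<inter> space M |A. A \<in> sets borel} \<subseteq> sets (F i)"
  proof -
    have "{X -` A \<inter> space M |A. A \<in> sets borel} \<subseteq> sets (F i)"
      using measurable_sets[OF assms(1)] by auto
    then show ?thesis using sets.sigma_sets_subset[of _ "F i"] by simp
  qed
  have 2: "sigma_sets (space M) {(\<lambda>\<omega>. \<psi> (w (Suc i) \<omega>)) -` A \<inter> space M |A. A \<in> sets borel}
     \<subseteq> sets ?V"
  proof -
    have [measurable]: "w (Suc i) \<in> measurable ?V borel"
      by (rule measurable_vimage_algebra1) auto
    have "(\<lambda>\<omega>. \<psi> (w (Suc i) \<omega>)) \<in> borel_measurable ?V" by measurable
    from measurable_sets[OF this]
    have "{(\<lambda>\<omega>. \<psi> (w (Suc i) \<omega>)) -` A \<inter> space M |A. A \<in> sets borel} \<subseteq> sets ?V"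
      by auto
    then show ?thesis using sets.sigma_sets_subset[of _ "?V"] by simp
  qed
  have ind: "indep_sets (case_bool (sets ?V) (sets (F i))) UNIV"
    using indep_past[of i] unfolding indep_set_def .
  have ev: "sets ?V \<subseteq> events" "sets (F i) \<subseteq> events"
    using ind unfolding indep_sets_def by (auto simp: UNIV_bool)
  have "indep_set (sigma_sets (space M) {X -` A \<inter> space M |A. A \<in> sets borel})
     (sigma_sets (space M) {(\<lambda>\<omega>. \<psi> (w (Suc i) \<omega>)) -` A \<inter> space M |A. A \<in> sets borel})"
  proof (rule indep_setI)
    fix A B
    assume "A \<in> sigma_sets (space M) {X -` A \<inter> space M |A. A \<in> sets borel}"
      and "B \<in> sigma_sets (space M) {(\<lambda>\<omega>. \<psi> (w (Suc i) \<omega>)) -` A \<inter> space M |A. A \<in> sets borel}"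
    then have "A \<in> sets (F i)" "B \<in> sets ?V" using 1 2 by auto
    then have "prob (B \<inter> A) = prob B * prob A" using indep_setD[OF indep_past] by blast
    then show "prob (A \<inter> B) = prob A * prob B" by (simp add: Int_commute mult.commute)
  qed (use 1 2 ev in auto)
  then show ?thesis unfolding indep_var_eq using X by simp
qed

lemma expectation_w:
  fixes \<psi> :: "real \<Rightarrow> real"
  assumes [measurable]: "\<psi> \<in> borel_measurable borel"
  shows "expectation (\<lambda>\<omega>. \<psi> (w (Suc i) \<omega>)) = expectation (\<lambda>\<omega>. \<psi> (w 1 \<omega>))"
proof -
  have "expectation (\<lambda>\<omega>. \<psi> (w (Suc i) \<omega>)) = integral\<^sup>L (distr M borel (w (Suc i))) \<psi>"
    by (simp add: integral_distr)
  also have "\<dots> = expectation (\<lambda>\<omega>. \<psi> (w 1 \<omega>))" unfolding ident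
    by (simp add: integral_distr)
  finally show ?thesis .
qed

lemma expectation_past_times_w:
  fixes \<psi> :: "real \<Rightarrow> real" and X :: "'a \<Rightarrow> real"
  assumes X: "X \<in> borel_measurable (F i)" and XB: "\<And>\<omega>. \<omega> \<in> space M \<Longrightarrow> \<bar>X \<omega>\<bar> \<le> B"
    and \<psi> [measurable]: "\<psi> \<in> borel_measurable borel" and b: "\<And>z. \<bar>\<psi> z\<bar> \<le> b"
  shows "integrable M (\<lambda>\<omega>. X \<omega> * \<psi> (w (Suc i) \<omega>))"
    and "expectation (\<lambda>\<omega>. X \<omega> * \<psi> (w (Suc i) \<omega>)) = expectation X * expectation (\<lambda>\<omega>. \<psi> (w 1 \<omega>))"
proof -
  have [measurable]: "X \<in> borel_measurable M" using measurable_from_past[OF X] .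
  have iX: "integrable M X"
    by (rule integrable_const_bound[where B=B]) (use XB in auto)
  have iw: "integrable M (\<lambda>\<omega>. \<psi> (w (Suc i) \<omega>))"
    by (rule integrable_const_bound[where B=b]) (use b in auto)
  note ind = indep_var_past[OF X \<psi>]
  show "integrable M (\<lambda>\<omega>. X \<omega> * \<psi> (w (Suc i) \<omega>))"
    by (rule indep_var_integrable[OF ind iX iw])
  show "expectation (\<lambda>\<omega>. X \<omega> * \<psi> (w (Suc i) \<omega>)) = expectation X * expectation (\<lambda>\<omega>. \<psi> (w 1 \<omega>))"
    using indep_var_lebesgue_integral[OF ind iX iw] expectation_w[OF \<psi>, of i] by simp
qed

text \<open>
  One step of an exponential supermartingale. Because the exponent is at most 1 in absolute value,
  the exponential may be replaced by a quadratic polynomial; its noise moments factor out by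
  independence. The mean of \<open>\<psi>\<close> appears because \<open>\<psi>\<close> will be a truncation of a centered function and
  is centered only approximately.
\<close>

lemma exponential_step:
  fixes \<psi> :: "real \<Rightarrow> real" and Z H :: "'a \<Rightarrow> real"
  assumes Z: "Z \<in> borel_measurable (F i)" and ZB: "\<And>\<omega>. \<omega> \<in> space M \<Longrightarrow> 0 \<le> Z \<omega> \<and> Z \<omega> \<le> B"
    and H: "H \<in> borel_measurable (F i)" and HD: "\<And>\<omega>. \<omega> \<in> space M \<Longrightarrow> \<bar>H \<omega>\<bar> \<le> D"
    and \<psi>: "\<psi> \<in> borel_measurable borel" and b: "\<And>z. \<bar>\<psi> z\<bar> \<le> b"
    and s: "0 \<le> s" "s * D * b \<le> 1"
  shows "expectation (\<lambda>\<omega>. Z \<omega> * exp (s * H \<omega> * \<psi> (w (Suc i) \<omega>)))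
      \<le> (1 + s * D * \<bar>expectation (\<lambda>\<omega>. \<psi> (w 1 \<omega>))\<bar> + (s * D)\<^sup>2 * expectation (\<lambda>\<omega>. (\<psi> (w 1 \<omega>))\<^sup>2))
        * expectation Z"
    (is "_ \<le> (1 + s * D * \<bar>?e\<bar> + _ * ?v) * _")
proof -
  obtain \<omega>0 where "\<omega>0 \<in> space M" using not_empty by blast
  have D0: "0 \<le> D" using HD[OF \<open>\<omega>0 \<in> space M\<close>] by linarith
  have B0: "0 \<le> B" using ZB[OF \<open>\<omega>0 \<in> space M\<close>] by linarith
  have b0: "0 \<le> b" using b[of 0] by linarith
  note [measurable] = Z H \<psi>
  have [measurable]: "Z \<in> borel_measurable M" "H \<in> borel_measurable M"
    by (rule measurable_from_past[OF Z], rule measurable_from_past[OF H])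
  have ZH: "(\<lambda>\<omega>. Z \<omega> * H \<omega>) \<in> borel_measurable (F i)" "(\<lambda>\<omega>. Z \<omega> * (H \<omega>)\<^sup>2) \<in> borel_measurable (F i)"
    by measurable
  have ZHB: "\<bar>Z \<omega> * H \<omega>\<bar> \<le> B * D" "\<bar>Z \<omega> * (H \<omega>)\<^sup>2\<bar> \<le> B * D\<^sup>2"
      "\<bar>Z \<omega> * H \<omega>\<bar> \<le> D * Z \<omega>" "Z \<omega> * (H \<omega>)\<^sup>2 \<le> D\<^sup>2 * Z \<omega>" if "\<omega> \<in> space M" for \<omega>
  proof -
    have h2: "(H \<omega>)\<^sup>2 \<le> D\<^sup>2" using power_mono[OF HD[OF that], of 2] by simp
    show "\<bar>Z \<omega> * H \<omega>\<bar> \<le> B * D" unfolding abs_mult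
      by (rule mult_mono) (use ZB[OF that] HD[OF that] B0 in auto)
    show "\<bar>Z \<omega> * (H \<omega>)\<^sup>2\<bar> \<le> B * D\<^sup>2" unfolding abs_mult
      by (rule mult_mono) (use ZB[OF that] h2 B0 in auto)
    show "\<bar>Z \<omega> * H \<omega>\<bar> \<le> D * Z \<omega>" unfolding abs_mult
      using mult_left_mono[OF HD[OF that], of "Z \<omega>"] ZB[OF that] by (simp add: mult.commute)
    show "Z \<omega> * (H \<omega>)\<^sup>2 \<le> D\<^sup>2 * Z \<omega>"
      using mult_left_mono[OF h2, of "Z \<omega>"] ZB[OF that] by (simp add: mult.commute)
  qed
  have iZ: "integrable M Z"
    by (rule integrable_const_bound[where B=B]) (use ZB in auto)
  have iZH: "integrable M (\<lambda>\<omega>. Z \<omega> * H \<omega>)"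
    by (rule integrable_const_bound[where B="B*D"]) (use ZHB(1) in auto)
  have iZH2: "integrable M (\<lambda>\<omega>. Z \<omega> * (H \<omega>)\<^sup>2)"
    by (rule integrable_const_bound[where B="B*D\<^sup>2"]) (use ZHB(2) in auto)
  have b2: "\<bar>(\<psi> z)\<^sup>2\<bar> \<le> b\<^sup>2" for z using power_mono[OF b[of z], of 2] by simp
  have \<psi>2[measurable]: "(\<lambda>z. (\<psi> z)\<^sup>2) \<in> borel_measurable borel" by measurable
  have p1: "integrable M (\<lambda>\<omega>. Z \<omega> * H \<omega> * \<psi> (w (Suc i) \<omega>))"
     "expectation (\<lambda>\<omega>. Z \<omega> * H \<omega> * \<psi> (w (Suc i) \<omega>)) = expectation (\<lambda>\<omega>. Z \<omega> * H \<omega>) * ?e"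
    using expectation_past_times_w[of "\<lambda>\<omega>. Z \<omega> * H \<omega>" i "B * D" \<psi> b] ZH(1) ZHB(1) \<psi> b by blast+
  have p2: "integrable M (\<lambda>\<omega>. Z \<omega> * (H \<omega>)\<^sup>2 * (\<psi> (w (Suc i) \<omega>))\<^sup>2)"
     "expectation (\<lambda>\<omega>. Z \<omega> * (H \<omega>)\<^sup>2 * (\<psi> (w (Suc i) \<omega>))\<^sup>2) = expectation (\<lambda>\<omega>. Z \<omega> * (H \<omega>)\<^sup>2) * ?v"
    using expectation_past_times_w[of "\<lambda>\<omega>. Z \<omega> * (H \<omega>)\<^sup>2" i "B * D\<^sup>2" "\<lambda>z. (\<psi> z)\<^sup>2" "b\<^sup>2"]
      ZH(2) ZHB(2) \<psi>2 b2 by blast+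
  have sb: "\<bar>s * H \<omega> * \<psi> z\<bar> \<le> 1" if "\<omega> \<in> space M" for \<omega> z
  proof -
    have "\<bar>s * H \<omega> * \<psi> z\<bar> = s * \<bar>H \<omega>\<bar> * \<bar>\<psi> z\<bar>" using s by (simp add: abs_mult)
    also have "\<dots> \<le> s * D * b"
      by (intro mult_mono) (use HD[OF that] b s D0 in auto)
    finally show ?thesis using s by simp
  qed
  have "expectation (\<lambda>\<omega>. Z \<omega> * exp (s * H \<omega> * \<psi> (w (Suc i) \<omega>)))
     \<le> expectation (\<lambda>\<omega>. Z \<omega> + s * (Z \<omega> * H \<omega> * \<psi> (w (Suc i) \<omega>))
            + s\<^sup>2 * (Z \<omega> * (H \<omega>)\<^sup>2 * (\<psi> (w (Suc i) \<omega>))\<^sup>2))"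
  proof (rule integral_mono)
    show "integrable M (\<lambda>\<omega>. Z \<omega> * exp (s * H \<omega> * \<psi> (w (Suc i) \<omega>)))"
    proof (rule integrable_const_bound[where B="B * exp 1"])
      show "AE \<omega> in M. norm (Z \<omega> * exp (s * H \<omega> * \<psi> (w (Suc i) \<omega>))) \<le> B * exp 1"
      proof (rule AE_I2)
        fix \<omega> assume o: "\<omega> \<in> space M"
        have "s * H \<omega> * \<psi> (w (Suc i) \<omega>) \<le> 1" using sb[OF o, of "w (Suc i) \<omega>"] by linarith
        then show "norm (Z \<omega> * exp (s * H \<omega> * \<psi> (w (Suc i) \<omega>))) \<le> B * exp 1"
          unfolding norm_mult by (intro mult_mono) (use ZB[OF o] B0 in auto)
      qed
    qed measurable
    show "integrable M (\<lambda>\<omega>. Z \<omega> + s * (Z \<omega> * H \<omega> * \<psi> (w (Suc i) \<omega>))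
            + s\<^sup>2 * (Z \<omega> * (H \<omega>)\<^sup>2 * (\<psi> (w (Suc i) \<omega>))\<^sup>2))"
      by (intro Bochner_Integration.integrable_add integrable_mult_right iZ p1 p2)
    fix \<omega> assume o: "\<omega> \<in> space M"
    have "Z \<omega> * exp (s * H \<omega> * \<psi> (w (Suc i) \<omega>)) \<le> Z \<omega> * (1 + s * H \<omega> * \<psi> (w (Suc i) \<omega>) + (s * H \<omega> * \<psi> (w (Suc i) \<omega>))\<^sup>2)"
      by (rule mult_left_mono[OF exp_le_quadratic[OF sb[OF o]]]) (use ZB[OF o] in auto)
    then show "Z \<omega> * exp (s * H \<omega> * \<psi> (w (Suc i) \<omega>)) \<le> Z \<omega> + s * (Z \<omega> * H \<omega> * \<psi> (w (Suc i) \<omega>))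
            + s\<^sup>2 * (Z \<omega> * (H \<omega>)\<^sup>2 * (\<psi> (w (Suc i) \<omega>))\<^sup>2)"
      by (simp add: algebra_simps power_mult_distrib)
  qed
  also have "\<dots> = expectation Z + s * (expectation (\<lambda>\<omega>. Z \<omega> * H \<omega>) * ?e)
       + s\<^sup>2 * (expectation (\<lambda>\<omega>. Z \<omega> * (H \<omega>)\<^sup>2) * ?v)"
    by (simp add: iZ p1 p2 Bochner_Integration.integral_add)
  also have "\<dots> \<le> expectation Z + s * (D * expectation Z * \<bar>?e\<bar>) + s\<^sup>2 * (D\<^sup>2 * expectation Z * ?v)"
  proof (intro add_mono mult_left_mono order.refl)
    have "\<bar>expectation (\<lambda>\<omega>. Z \<omega> * H \<omega>)\<bar> \<le> expectation (\<lambda>\<omega>. \<bar>Z \<omega> * H \<omega>\<bar>)" by (rule integral_abs_bound)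
    also have "\<dots> \<le> expectation (\<lambda>\<omega>. D * Z \<omega>)"
      by (rule integral_mono[OF integrable_abs[OF iZH] integrable_mult_right[OF iZ] ZHB(3)])
    finally have "\<bar>expectation (\<lambda>\<omega>. Z \<omega> * H \<omega>)\<bar> \<le> D * expectation Z" by simp
    then have "\<bar>expectation (\<lambda>\<omega>. Z \<omega> * H \<omega>) * ?e\<bar> \<le> D * expectation Z * \<bar>?e\<bar>"
      unfolding abs_mult by (rule mult_right_mono) simp
    then show "expectation (\<lambda>\<omega>. Z \<omega> * H \<omega>) * ?e \<le> D * expectation Z * \<bar>?e\<bar>" by linarith
    have "expectation (\<lambda>\<omega>. Z \<omega> * (H \<omega>)\<^sup>2) \<le> expectation (\<lambda>\<omega>. D\<^sup>2 * Z \<omega>)"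
      by (rule integral_mono[OF iZH2 integrable_mult_right[OF iZ] ZHB(4)])
    then show "expectation (\<lambda>\<omega>. Z \<omega> * (H \<omega>)\<^sup>2) * ?v \<le> D\<^sup>2 * expectation Z * ?v"
      by (intro mult_right_mono) (auto intro: integral_nonneg)
  qed (use s in auto)
  also have "\<dots> = (1 + s * D * \<bar>?e\<bar> + (s * D)\<^sup>2 * ?v) * expectation Z"
    by (simp add: algebra_simps power_mult_distrib)
  finally show ?thesis .
qed

lemma exponential_moment:
  fixes \<psi> :: "real \<Rightarrow> real" and H :: "nat \<Rightarrow> 'a \<Rightarrow> real"
  assumes H: "\<And>i. H i \<in> borel_measurable (F i)"
    and HD: "\<And>i \<omega>. \<omega> \<in> space M \<Longrightarrow> \<bar>H i \<omega>\<bar> \<le> D"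
    and \<psi>: "\<psi> \<in> borel_measurable borel" and b: "\<And>z. \<bar>\<psi> z\<bar> \<le> b"
    and s: "0 \<le> s" "s * D * b \<le> 1"
  defines "\<rho> \<equiv> 1 + s * D * \<bar>expectation (\<lambda>\<omega>. \<psi> (w 1 \<omega>))\<bar> + (s * D)\<^sup>2 * expectation (\<lambda>\<omega>. (\<psi> (w 1 \<omega>))\<^sup>2)"
  shows "(\<lambda>\<omega>. exp (s * (\<Sum>i=1..<t. H i \<omega> * \<psi> (w (Suc i) \<omega>)))) \<in> borel_measurable (F t)"
    and "\<omega> \<in> space M \<Longrightarrow> exp (s * (\<Sum>i=1..<t. H i \<omega> * \<psi> (w (Suc i) \<omega>))) \<le> exp (real t)"
    and "expectation (\<lambda>\<omega>. exp (s * (\<Sum>i=1..<t. H i \<omega> * \<psi> (w (Suc i) \<omega>)))) \<le> \<rho> ^ t"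
proof -
  obtain \<omega>0 where "\<omega>0 \<in> space M" using not_empty by blast
  have D0: "0 \<le> D" using HD[OF \<open>\<omega>0 \<in> space M\<close>, of 0] by linarith
  have b0: "0 \<le> b" using b[of 0] by linarith
  have \<rho>1: "1 \<le> \<rho>" unfolding \<rho>_def using s D0 by (auto intro!: add_increasing2 mult_nonneg_nonneg)
  show meas: "(\<lambda>\<omega>. exp (s * (\<Sum>i=1..<t. H i \<omega> * \<psi> (w (Suc i) \<omega>)))) \<in> borel_measurable (F t)" for t
  proof -
    have "(\<lambda>\<omega>. H i \<omega> * \<psi> (w (Suc i) \<omega>)) \<in> borel_measurable (F t)" if "i \<in> {1..<t}" for i
    proof -
      have [measurable]: "H i \<in> borel_measurable (F t)" "w (Suc i) \<in> borel_measurable (F t)"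
        using that measurable_later[OF _ H[of i], of t] measurable_later[OF _ adapted[of i], of t] by auto
      note [measurable] = \<psi>
      show ?thesis by measurable
    qed
    then have [measurable]: "(\<lambda>\<omega>. \<Sum>i=1..<t. H i \<omega> * \<psi> (w (Suc i) \<omega>)) \<in> borel_measurable (F t)"
      by (rule borel_measurable_sum)
    show ?thesis by measurable
  qed
  have sb: "s * (H i \<omega> * \<psi> z) \<le> 1" if "\<omega> \<in> space M" for i \<omega> z
  proof -
    have "s * (H i \<omega> * \<psi> z) \<le> s * \<bar>H i \<omega>\<bar> * \<bar>\<psi> z\<bar>"
      using s abs_ge_self[of "H i \<omega> * \<psi> z"] by (simp add: abs_mult mult.assoc mult_left_mono)
    also have "\<dots> \<le> s * D * b"
      by (intro mult_mono) (use HD[OF that] b s D0 in auto)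
    finally show ?thesis using s by simp
  qed
  show bnd: "exp (s * (\<Sum>i=1..<t. H i \<omega> * \<psi> (w (Suc i) \<omega>))) \<le> exp (real t)" if "\<omega> \<in> space M" for t \<omega>
  proof -
    have "s * (\<Sum>i=1..<t. H i \<omega> * \<psi> (w (Suc i) \<omega>)) = (\<Sum>i=1..<t. s * (H i \<omega> * \<psi> (w (Suc i) \<omega>)))"
      by (simp add: sum_distrib_left)
    also have "\<dots> \<le> (\<Sum>i=1..<t. 1)" by (rule sum_mono) (rule sb[OF that])
    also have "\<dots> \<le> real t" by simp
    finally show ?thesis by simp
  qed
  show "expectation (\<lambda>\<omega>. exp (s * (\<Sum>i=1..<t. H i \<omega> * \<psi> (w (Suc i) \<omega>)))) \<le> \<rho> ^ t"
  proof (induction t)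
    case 0
    then show ?case by (simp add: prob_space)
  next
    case (Suc t)
    show ?case
    proof (cases "t = 0")
      case True
      then show ?thesis using \<rho>1 by (simp add: prob_space)
    next
      case False
      define Z where "Z = (\<lambda>\<omega>. exp (s * (\<Sum>i=1..<t. H i \<omega> * \<psi> (w (Suc i) \<omega>))))"
      have "expectation (\<lambda>\<omega>. exp (s * (\<Sum>i=1..<Suc t. H i \<omega> * \<psi> (w (Suc i) \<omega>))))
          = expectation (\<lambda>\<omega>. Z \<omega> * exp (s * H t \<omega> * \<psi> (w (Suc t) \<omega>)))"
        using False by (simp add: Z_def exp_add[symmetric] algebra_simps atLeastLessThanSuc)
      also have "\<dots> \<le> \<rho> * expectation Z" unfolding \<rho>_def
        by (rule exponential_step[OF _ _ H HD \<psi> b s, where B="exp (real t)"])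
          (use meas bnd in \<open>auto simp: Z_def\<close>)
      also have "\<dots> \<le> \<rho> * \<rho> ^ t"
        by (rule mult_left_mono) (use Suc \<rho>1 in \<open>auto simp: Z_def\<close>)
      finally show ?thesis by simp
    qed
  qed
qed

text \<open>
  For a truncation at \<open>sqrt t\<close> the exponent \<open>s = 1 / (D * sqrt t)\<close> is the largest one that
  \<open>exponential_step\<close> permits, and it makes each of the \<open>t\<close> factors at most \<open>1 + 2 * v / t\<close>. The whole
  product is therefore bounded, and Markov's inequality leaves the stretched exponential.
\<close>

lemma truncated_deviation:
  fixes \<psi> :: "real \<Rightarrow> real" and H :: "nat \<Rightarrow> 'a \<Rightarrow> real"
  assumes H: "\<And>i. H i \<in> borel_measurable (F i)"
    and HD: "\<And>i \<omega>. \<omega> \<in> space M \<Longrightarrow> \<bar>H i \<omega>\<bar> \<le> D"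
    and D: "0 < D" and t: "1 \<le> t"
    and \<psi>: "\<psi> \<in> borel_measurable borel" and b: "\<And>z. \<bar>\<psi> z\<bar> \<le> sqrt (real t)"
    and e: "\<bar>expectation (\<lambda>\<omega>. \<psi> (w 1 \<omega>))\<bar> \<le> v / sqrt (real t)"
    and v: "expectation (\<lambda>\<omega>. (\<psi> (w 1 \<omega>))\<^sup>2) \<le> v"
  shows "prob {\<omega>\<in>space M. D * real t powr (1/2 + \<epsilon>) \<le> (\<Sum>i=1..<t. H i \<omega> * \<psi> (w (Suc i) \<omega>))}
     \<le> exp (2 * v) * exp (- (real t powr \<epsilon>))"
proof -
  define s where "s = 1 / (D * sqrt (real t))"
  have s: "0 \<le> s" "s * D * sqrt (real t) \<le> 1" "s * D = 1 / sqrt (real t)" "0 < s"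
    using D t by (auto simp: s_def)
  define S where "S \<omega> = (\<Sum>i=1..<t. H i \<omega> * \<psi> (w (Suc i) \<omega>))" for \<omega>
  note em = exponential_moment[where t=t, OF H HD \<psi> b s(1,2), folded S_def]
  define \<rho> where "\<rho> = 1 + s * D * \<bar>expectation (\<lambda>\<omega>. \<psi> (w 1 \<omega>))\<bar> + (s * D)\<^sup>2 * expectation (\<lambda>\<omega>. (\<psi> (w 1 \<omega>))\<^sup>2)"
  have [measurable]: "(\<lambda>\<omega>. exp (s * S \<omega>)) \<in> borel_measurable M"
    using measurable_from_past[OF em(1)] by simp
  have "\<rho> \<le> 1 + (1 / sqrt (real t)) * (v / sqrt (real t)) + (1 / sqrt (real t))\<^sup>2 * v"
    unfolding \<rho>_def s(3) by (intro add_mono mult_left_mono e v order.refl) auto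
  also have "\<dots> = 1 + 2 * v / real t" using t by (simp add: power_divide)
  also have "\<dots> \<le> exp (2 * v / real t)" by (rule exp_ge_add_one_self)
  finally have \<rho>: "\<rho> \<le> exp (2 * v / real t)" .
  have \<rho>0: "0 \<le> \<rho>" unfolding \<rho>_def using s D by (auto intro!: add_nonneg_nonneg mult_nonneg_nonneg)
  have "\<rho> ^ t \<le> exp (2 * v / real t) ^ t" using \<rho> \<rho>0 by (rule power_mono)
  also have "\<dots> = exp (2 * v)" using t by (simp add: exp_of_nat_mult[symmetric])
  finally have E: "expectation (\<lambda>\<omega>. exp (s * S \<omega>)) \<le> exp (2 * v)" using em(3) unfolding \<rho>_def by simp
  have sx: "s * (D * real t powr (1/2 + \<epsilon>)) = real t powr \<epsilon>"
    unfolding powr_add powr_half_sqrt[OF of_nat_0_le_iff] s_def using D t by simp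
  have "{\<omega>\<in>space M. D * real t powr (1/2 + \<epsilon>) \<le> S \<omega>}
      = {\<omega>\<in>space M. exp (real t powr \<epsilon>) \<le> exp (s * S \<omega>)}"
    unfolding sx[symmetric] using s(4) by (auto simp: mult_le_cancel_left_pos)
  then have "prob {\<omega>\<in>space M. D * real t powr (1/2 + \<epsilon>) \<le> S \<omega>}
      = prob {\<omega>\<in>space M. exp (real t powr \<epsilon>) \<le> exp (s * S \<omega>)}" by simp
  also have "\<dots> \<le> expectation (\<lambda>\<omega>. exp (s * S \<omega>)) / exp (real t powr \<epsilon>)"
  proof (rule integral_Markov_inequality_measure[where A="{}"])
    show "integrable M (\<lambda>\<omega>. exp (s * S \<omega>))"
      by (rule integrable_const_bound[where B="exp (real t)"], rule AE_I2) (use em(2) in simp_all)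
  qed simp_all
  also have "\<dots> \<le> exp (2 * v) / exp (real t powr \<epsilon>)" using E by (rule divide_right_mono) simp
  finally show ?thesis by (simp only: S_def exp_minus divide_inverse)
qed

text \<open>
  Square integrability means that the probabilities of \<open>{i < (\<psi> (w 1))\<^sup>2}\<close> are summable in \<open>i\<close>, so by
  Borel and Cantelli only finitely many terms violate the bound at their own index; a large \<open>t\<close>
  absorbs those.
\<close>

lemma noise_growth:
  fixes \<psi> :: "real \<Rightarrow> real"
  assumes [measurable]: "\<psi> \<in> borel_measurable borel"
    and sq: "integrable M (\<lambda>\<omega>. (\<psi> (w 1 \<omega>))\<^sup>2)"
  shows "AE \<omega> in M. \<forall>\<^sub>F t in sequentially. \<forall>i\<in>{1..<t}. \<bar>\<psi> (w (Suc i) \<omega>)\<bar> \<le> sqrt (real t)"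
proof -
  define A where "A = (\<lambda>i. {\<omega>\<in>space M. real i < (\<psi> (w (Suc i) \<omega>))\<^sup>2})"
  have [measurable]: "A i \<in> sets M" for i unfolding A_def by measurable
  have pA: "prob (A i) = expectation (\<lambda>\<omega>. of_bool (real i < (\<psi> (w 1 \<omega>))\<^sup>2))" for i
  proof -
    have "prob (A i) = expectation (indicator (A i))" by simp
    also have "\<dots> = expectation (\<lambda>\<omega>. of_bool (real i < (\<psi> (w (Suc i) \<omega>))\<^sup>2))"
      by (rule Bochner_Integration.integral_cong) (auto simp: A_def indicator_def)
    also have "\<dots> = expectation (\<lambda>\<omega>. of_bool (real i < (\<psi> (w 1 \<omega>))\<^sup>2))"
      by (rule expectation_w[where \<psi>="\<lambda>z. of_bool (real i < (\<psi> z)\<^sup>2)"]) measurable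
    finally show ?thesis .
  qed
  have "summable (\<lambda>i. prob (A i))"
  proof (rule bounded_imp_summable)
    fix n
    have "(\<Sum>i\<le>n. prob (A i)) = expectation (\<lambda>\<omega>. \<Sum>i\<le>n. of_bool (real i < (\<psi> (w 1 \<omega>))\<^sup>2))"
      unfolding pA by (rule Bochner_Integration.integral_sum[symmetric])
        (auto intro!: integrable_const_bound[where B=1])
    also have "\<dots> \<le> expectation (\<lambda>\<omega>. (\<psi> (w 1 \<omega>))\<^sup>2 + 1)"
    proof (rule integral_mono)
      show "integrable M (\<lambda>\<omega>. \<Sum>i\<le>n. of_bool (real i < (\<psi> (w 1 \<omega>))\<^sup>2) :: real)"
        by (intro Bochner_Integration.integrable_sum) (auto intro!: integrable_const_bound[where B=1])
      show "integrable M (\<lambda>\<omega>. (\<psi> (w 1 \<omega>))\<^sup>2 + 1)" using sq by simp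
      fix \<omega>
      define X where "X = (\<psi> (w 1 \<omega>))\<^sup>2"
      have X0: "0 \<le> X" by (simp add: X_def)
      have "(\<Sum>i\<le>n. of_bool (real i < X)) = real (card {i\<in>{..n}. real i < X})"
        by (simp add: of_bool_def sum.If_cases Int_def)
      also have "\<dots> \<le> real (card {..<nat \<lceil>X\<rceil>})"
        by (intro of_nat_mono card_mono) (auto simp: less_ceiling_iff zless_nat_eq_int_zless)
      also have "\<dots> \<le> X + 1" using X0 by simp
      finally show "(\<Sum>i\<le>n. of_bool (real i < (\<psi> (w 1 \<omega>))\<^sup>2)) \<le> (\<psi> (w 1 \<omega>))\<^sup>2 + 1"
        by (simp add: X_def)
    qed
    finally show "(\<Sum>i\<le>n. prob (A i)) \<le> expectation (\<lambda>\<omega>. (\<psi> (w 1 \<omega>))\<^sup>2 + 1)" .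
  qed (rule measure_nonneg)
  then have "AE \<omega> in M. \<forall>\<^sub>F i in sequentially. \<omega> \<in> space M - A i"
    by (intro borel_cantelli_AE1) (auto simp: emeasure_eq_measure)
  then show ?thesis
  proof eventually_elim
    case (elim \<omega>)
    then obtain k where k: "\<And>i. k \<le> i \<Longrightarrow> (\<psi> (w (Suc i) \<omega>))\<^sup>2 \<le> real i"
      unfolding eventually_sequentially A_def by (auto simp: not_less)
    obtain T :: nat where T: "(\<Sum>i<k. (\<psi> (w (Suc i) \<omega>))\<^sup>2) \<le> real T" using real_arch_simple by blast
    show ?case unfolding eventually_sequentially
    proof (intro exI[of _ T] allI impI ballI)
      fix t i assume ti: "T \<le> t" "i \<in> {1..<t}"
      have "(\<psi> (w (Suc i) \<omega>))\<^sup>2 \<le> real t"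
      proof (cases "k \<le> i")
        case True
        then show ?thesis using k[OF True] ti by auto
      next
        case False
        then have "(\<psi> (w (Suc i) \<omega>))\<^sup>2 \<le> (\<Sum>i<k. (\<psi> (w (Suc i) \<omega>))\<^sup>2)"
          by (intro member_le_sum) auto
        then show ?thesis using T ti by linarith
      qed
      then have "sqrt ((\<psi> (w (Suc i) \<omega>))\<^sup>2) \<le> sqrt (real t)" by (rule real_sqrt_le_mono)
      then show "\<bar>\<psi> (w (Suc i) \<omega>)\<bar> \<le> sqrt (real t)" by simp
    qed
  qed
qed

text \<open>
  The deviation probabilities decay faster than any power of \<open>t\<close>. A union bound therefore permits a
  number of weight sequences that grows polynomially in \<open>t\<close>, which is what makes the
  bound uniform over a net of parameters later on. Two moments of \<open>\<psi>\<close> suffice: eventually the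
  truncation at \<open>sqrt t\<close> changes none of the first \<open>t\<close> terms, and the bias it causes is at most
  \<open>v / sqrt t\<close>.
\<close>

lemma uniform_noise_bound:
  fixes \<psi> :: "real \<Rightarrow> real" and H :: "nat \<Rightarrow> 'k \<Rightarrow> nat \<Rightarrow> 'a \<Rightarrow> real"
  assumes H: "\<And>t k i. k \<in> K t \<Longrightarrow> H t k i \<in> borel_measurable (F i)"
    and HD: "\<And>t k i \<omega>. k \<in> K t \<Longrightarrow> \<omega> \<in> space M \<Longrightarrow> \<bar>H t k i \<omega>\<bar> \<le> D" and D: "0 < D"
    and fin: "\<And>t. finite (K t)"
    and K: "summable (\<lambda>t. real (card (K t)) * exp (- (real t powr \<epsilon>)))"
    and \<psi>: "\<psi> \<in> borel_measurable borel"
    and mean: "expectation (\<lambda>\<omega>. \<psi> (w 1 \<omega>)) = 0"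
    and sq: "integrable M (\<lambda>\<omega>. (\<psi> (w 1 \<omega>))\<^sup>2)"
  shows "AE \<omega> in M. \<forall>\<^sub>F t in sequentially. \<forall>k\<in>K t.
     \<bar>\<Sum>i=1..<t. H t k i \<omega> * \<psi> (w (Suc i) \<omega>)\<bar> \<le> D * real t powr (1/2 + \<epsilon>)"
proof -
  note [measurable] = \<psi>
  define v where "v = expectation (\<lambda>\<omega>. (\<psi> (w 1 \<omega>))\<^sup>2)"
  define \<phi> where "\<phi> = (\<lambda>t z. if \<bar>\<psi> z\<bar> \<le> sqrt (real t) then \<psi> z else 0)" for t :: nat
  have \<phi>m[measurable]: "\<phi> t \<in> borel_measurable borel" for t unfolding \<phi>_def by measurable
  have \<phi>b: "\<bar>\<phi> t z\<bar> \<le> sqrt (real t)" for t z by (simp add: \<phi>_def)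
  have \<phi>2: "(\<phi> t z)\<^sup>2 \<le> (\<psi> z)\<^sup>2" for t z by (simp add: \<phi>_def)
  have i\<psi>: "integrable M (\<lambda>\<omega>. \<psi> (w 1 \<omega>))"
    by (rule square_integrable_imp_integrable[OF _ sq]) measurable
  have i\<phi>: "integrable M (\<lambda>\<omega>. \<phi> t (w 1 \<omega>))" for t
    by (rule integrable_const_bound[where B="sqrt (real t)"]) (use \<phi>b in auto)
  have \<phi>v: "expectation (\<lambda>\<omega>. (\<phi> t (w 1 \<omega>))\<^sup>2) \<le> v" for t unfolding v_def
  proof (rule integral_mono[OF _ sq \<phi>2])
    show "integrable M (\<lambda>\<omega>. (\<phi> t (w 1 \<omega>))\<^sup>2)"
      by (rule Bochner_Integration.integrable_bound[OF sq]) (use \<phi>2 in auto)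
  qed
  have \<phi>e: "\<bar>expectation (\<lambda>\<omega>. \<phi> t (w 1 \<omega>))\<bar> \<le> v / sqrt (real t)" if t: "1 \<le> t" for t
  proof -
    have "expectation (\<lambda>\<omega>. \<phi> t (w 1 \<omega>)) = expectation (\<lambda>\<omega>. \<phi> t (w 1 \<omega>) - \<psi> (w 1 \<omega>))"
      using mean i\<psi> i\<phi> by simp
    then have "\<bar>expectation (\<lambda>\<omega>. \<phi> t (w 1 \<omega>))\<bar> \<le> expectation (\<lambda>\<omega>. \<bar>\<phi> t (w 1 \<omega>) - \<psi> (w 1 \<omega>)\<bar>)"
      using integral_abs_bound[of M "\<lambda>\<omega>. \<phi> t (w 1 \<omega>) - \<psi> (w 1 \<omega>)"] by simp
    also have "\<dots> \<le> expectation (\<lambda>\<omega>. (\<psi> (w 1 \<omega>))\<^sup>2 / sqrt (real t))"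
    proof (rule integral_mono)
      show "integrable M (\<lambda>\<omega>. \<bar>\<phi> t (w 1 \<omega>) - \<psi> (w 1 \<omega>)\<bar>)" using i\<psi> i\<phi> by simp
      show "integrable M (\<lambda>\<omega>. (\<psi> (w 1 \<omega>))\<^sup>2 / sqrt (real t))" using sq by simp
      fix \<omega>
      show "\<bar>\<phi> t (w 1 \<omega>) - \<psi> (w 1 \<omega>)\<bar> \<le> (\<psi> (w 1 \<omega>))\<^sup>2 / sqrt (real t)"
      proof (cases "\<bar>\<psi> (w 1 \<omega>)\<bar> \<le> sqrt (real t)")
        case False
        then have "\<bar>\<psi> (w 1 \<omega>)\<bar> * sqrt (real t) \<le> \<bar>\<psi> (w 1 \<omega>)\<bar> * \<bar>\<psi> (w 1 \<omega>)\<bar>"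
          by (intro mult_left_mono) auto
        also have "\<dots> = (\<psi> (w 1 \<omega>))\<^sup>2" by (simp add: power2_eq_square)
        finally show ?thesis using False t by (simp add: \<phi>_def pos_le_divide_eq)
      qed (simp add: \<phi>_def)
    qed
    finally show ?thesis by (simp add: v_def)
  qed
  define S where "S = (\<lambda>t k \<omega>. \<Sum>i=1..<t. H t k i \<omega> * \<phi> t (w (Suc i) \<omega>))"
  have Sm [measurable]: "S t k \<in> borel_measurable M" if "k \<in> K t" for t k
    unfolding S_def
  proof (rule borel_measurable_sum)
    fix i
    have [measurable]: "H t k i \<in> borel_measurable M" by (rule measurable_from_past[OF H[OF that]])
    show "(\<lambda>\<omega>. H t k i \<omega> * \<phi> t (w (Suc i) \<omega>)) \<in> borel_measurable M" by measurable
  qed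
  define x where "x = (\<lambda>t. D * real t powr (1/2 + \<epsilon>))"
  define A where "A = (\<lambda>t. \<Union>k\<in>K t. {\<omega>\<in>space M. x t \<le> S t k \<omega>} \<union> {\<omega>\<in>space M. x t \<le> - S t k \<omega>})"
  have set1: "{\<omega>\<in>space M. x t \<le> S t k \<omega>} \<in> sets M" "{\<omega>\<in>space M. x t \<le> - S t k \<omega>} \<in> sets M"
    if "k \<in> K t" for t k
  proof -
    note [measurable] = Sm[OF that]
    show "{\<omega>\<in>space M. x t \<le> S t k \<omega>} \<in> sets M" "{\<omega>\<in>space M. x t \<le> - S t k \<omega>} \<in> sets M"
      by measurable
  qed
  have setA: "A t \<in> sets M" for t unfolding A_def
    using set1 by (intro sets.finite_UN fin) auto
  have pA: "prob (A t) \<le> (2 * exp (2 * v)) * (real (card (K t)) * exp (- (real t powr \<epsilon>)))" if t: "1 \<le> t" for t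
  proof -
    have "prob (A t) \<le> (\<Sum>k\<in>K t. prob ({\<omega>\<in>space M. x t \<le> S t k \<omega>} \<union> {\<omega>\<in>space M. x t \<le> - S t k \<omega>}))"
      unfolding A_def using set1 by (intro finite_measure_subadditive_finite fin) auto
    also have "\<dots> \<le> (\<Sum>k\<in>K t. 2 * (exp (2 * v) * exp (- (real t powr \<epsilon>))))"
    proof (rule sum_mono)
      fix k assume k: "k \<in> K t"
      have 1: "prob {\<omega>\<in>space M. x t \<le> S t k \<omega>} \<le> exp (2 * v) * exp (- (real t powr \<epsilon>))"
        unfolding S_def x_def
        by (rule truncated_deviation[where H="H t k" and v=v, OF H[OF k] HD[OF k] D t \<phi>m \<phi>b \<phi>e[OF t] \<phi>v])
      have "prob {\<omega>\<in>space M. x t \<le> (\<Sum>i=1..<t. - H t k i \<omega> * \<phi> t (w (Suc i) \<omega>))} \<le> exp (2 * v) * exp (- (real t powr \<epsilon>))"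
        unfolding x_def
        by (rule truncated_deviation[where H="\<lambda>i \<omega>. - H t k i \<omega>" and v=v, OF _ _ D t \<phi>m \<phi>b \<phi>e[OF t] \<phi>v])
          (use H[OF k] HD[OF k] in auto)
      then have 2: "prob {\<omega>\<in>space M. x t \<le> - S t k \<omega>} \<le> exp (2 * v) * exp (- (real t powr \<epsilon>))"
        by (simp add: S_def sum_negf)
      show "prob ({\<omega>\<in>space M. x t \<le> S t k \<omega>} \<union> {\<omega>\<in>space M. x t \<le> - S t k \<omega>})
           \<le> 2 * (exp (2 * v) * exp (- (real t powr \<epsilon>)))"
        using measure_Un_le[OF set1[OF k]] 1 2 by linarith
    qed
    finally show ?thesis by (simp add: mult_ac)
  qed
  have "summable (\<lambda>t. prob (A t))"
  proof (rule summable_comparison_test_ev)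
    show "\<forall>\<^sub>F t in sequentially. norm (prob (A t)) \<le> (2 * exp (2 * v)) * (real (card (K t)) * exp (- (real t powr \<epsilon>)))"
      using eventually_ge_at_top[of 1] by eventually_elim (use pA in auto)
    show "summable (\<lambda>t. (2 * exp (2 * v)) * (real (card (K t)) * exp (- (real t powr \<epsilon>))))"
      using K by (rule summable_mult)
  qed
  then have "AE \<omega> in M. \<forall>\<^sub>F t in sequentially. \<omega> \<in> space M - A t"
    by (intro borel_cantelli_AE1 setA) (auto simp: emeasure_eq_measure)
  moreover have "AE \<omega> in M. \<forall>\<^sub>F t in sequentially. \<forall>i\<in>{1..<t}. \<bar>\<psi> (w (Suc i) \<omega>)\<bar> \<le> sqrt (real t)"
    by (rule noise_growth[OF \<psi> sq])
  ultimately show ?thesis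
  proof eventually_elim
    case (elim \<omega>)
    from elim(1) elim(2) show ?case
    proof eventually_elim
      case (elim t)
      show ?case
      proof
        fix k assume k: "k \<in> K t"
        have "\<not> x t \<le> S t k \<omega>" "\<not> x t \<le> - S t k \<omega>" using elim(1) k by (auto simp: A_def)
        moreover have "S t k \<omega> = (\<Sum>i=1..<t. H t k i \<omega> * \<psi> (w (Suc i) \<omega>))"
          unfolding S_def by (rule sum.cong) (use elim(2) in \<open>auto simp: \<phi>_def\<close>)
        ultimately show "\<bar>\<Sum>i=1..<t. H t k i \<omega> * \<psi> (w (Suc i) \<omega>)\<bar> \<le> D * real t powr (1/2 + \<epsilon>)"
          by (auto simp: x_def)
      qed
    qed
  qed
qed

end

section \<open>Positive frequency and steering by one noise step\<close>

text \<open>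
  Positive lower density of a set of times. Sums run over \<open>1 \<le> i < t\<close>, the range of the criterion
  of the estimator at time \<open>t\<close>.
\<close>

definition positive_frequency :: "(nat \<Rightarrow> bool) \<Rightarrow> bool" where
  "positive_frequency P \<longleftrightarrow> (\<exists>c>0. \<forall>\<^sub>F t in sequentially. c * real t \<le> (\<Sum>i=1..<t. of_bool (P i)))"

lemma positive_frequency_mono:
  assumes "positive_frequency P" and "\<And>i. 1 \<le> i \<Longrightarrow> P i \<Longrightarrow> Q i"
  shows "positive_frequency Q"
proof -
  from assms(1) obtain c where c: "c > 0" and
    ev: "\<forall>\<^sub>F t in sequentially. c * real t \<le> (\<Sum>i=1..<t. of_bool (P i))"
    unfolding positive_frequency_def by blast
  from ev have "\<forall>\<^sub>F t in sequentially. c * real t \<le> (\<Sum>i=1..<t. of_bool (Q i))"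
  proof eventually_elim
    case (elim t)
    have "(\<Sum>i=1..<t. of_bool (P i)) \<le> (\<Sum>i=1..<t. of_bool (Q i) :: real)"
      using assms(2) by (intro sum_mono) auto
    with elim show ?case by linarith
  qed
  with c show ?thesis unfolding positive_frequency_def by blast
qed

lemma positive_frequency_always: "positive_frequency (\<lambda>_. True)"
proof -
  have "\<forall>\<^sub>F t in sequentially. 1/2 * real t \<le> (\<Sum>i=1..<t. of_bool True)"
    using eventually_ge_at_top[of 2] by eventually_elim auto
  then show ?thesis unfolding positive_frequency_def by (intro exI[of _ "1/2"]) simp
qed

lemma positive_frequency_shift:
  assumes "positive_frequency P"
  shows "positive_frequency (\<lambda>i. P (i - 1))"
proof -
  from assms(1) obtain c where c: "c > 0" and
    ev: "\<forall>\<^sub>F t in sequentially. c * real t \<le> (\<Sum>i=1..<t. of_bool (P i))"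
    unfolding positive_frequency_def by blast
  obtain T :: nat where T: "2 / c \<le> real T" using real_arch_simple by blast
  from ev eventually_ge_at_top[of T]
  have "\<forall>\<^sub>F t in sequentially. c / 2 * real t \<le> (\<Sum>i=1..<t. of_bool (P (i - 1)))"
  proof eventually_elim
    case (elim t)
    have "2 / c \<le> real t" using elim T by linarith
    then have ct: "1 \<le> c / 2 * real t" using c by (simp add: field_simps)
    then have t0: "0 < t" by (cases t) auto
    have "(\<Sum>i=1..<t. of_bool (P i)) \<le> (\<Sum>i=1..<Suc t. of_bool (P (i - 1))) + (0::real)"
    proof -
      have "(\<Sum>i=1..<Suc t. of_bool (P (i - 1))) = (\<Sum>i=0..<t. of_bool (P i) :: real)"
        using sum.shift_bounds_Suc_ivl[of "\<lambda>i. of_bool (P (i - 1)) :: real" 0 t] by simp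
      also have "\<dots> \<ge> (\<Sum>i=1..<t. of_bool (P i))" by (rule sum_mono2) auto
      finally show ?thesis by simp
    qed
    also have "\<dots> \<le> (\<Sum>i=1..<t. of_bool (P (i - 1))) + 1"
      using t0 by simp
    finally show ?case using elim ct by linarith
  qed
  moreover have "c / 2 > 0" using c by simp
  ultimately show ?thesis unfolding positive_frequency_def by blast
qed

lemma summable_power_times_exp:
  fixes \<epsilon> :: real assumes "0 < \<epsilon>"
  shows "summable (\<lambda>t. real t ^ n * exp (- (real t powr \<epsilon>)))"
proof (rule summable_comparison_test_ev)
  have "(\<lambda>t. real t powr real n * exp (- (real t powr \<epsilon>))) \<in> o(\<lambda>t. 1 / real t ^ 2)"
    using assms by real_asymp
  from landau_o.smallD[OF this, of 1]
  have "\<forall>\<^sub>F t in sequentially. norm (real t powr real n * exp (- (real t powr \<epsilon>))) \<le> 1 * norm (1 / real t ^ 2)"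
    by simp
  then show "\<forall>\<^sub>F t in sequentially. norm (real t ^ n * exp (- (real t powr \<epsilon>))) \<le> 1 / real t ^ 2"
    using eventually_gt_at_top[of 0]
    by eventually_elim (auto simp: powr_realpow)
  show "summable (\<lambda>t. 1 / real t ^ 2)"
    using inverse_power_summable[of 2, where 'a=real] by (simp add: divide_inverse)
qed

context driven_noise begin

text \<open>
  Here \<open>s i\<close> is the predictable part of the next output and \<open>E\<close> a set of targets. If from every
  possible value of \<open>s i\<close> some target is reachable by the noise, then a positive proportion of
  the times at which \<open>A\<close> holds is followed by an output near a target. The interval of values is
  covered by finitely many cells of radius \<open>\<delta> / 2\<close>; within a cell one target and one noise event of
  positive probability serve for all values. The number of successes in a cell differs from its
  expected number by a weighted noise sum, which \<open>uniform_noise_bound\<close> makes \<open>o(t)\<close>.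
\<close>

theorem steering_step:
  fixes s :: "nat \<Rightarrow> 'a \<Rightarrow> real" and A :: "nat \<Rightarrow> 'a \<Rightarrow> bool"
  assumes s: "\<And>i. s i \<in> borel_measurable (F i)"
    and A: "\<And>i. Measurable.pred (F i) (A i)"
    and bnd: "AE \<omega> in M. \<forall>i\<ge>1. A i \<omega> \<longrightarrow> \<bar>s i \<omega>\<bar> \<le> S"
    and reach: "\<And>z. \<bar>z\<bar> \<le> S \<Longrightarrow> \<exists>e\<in>E. \<forall>\<delta>>0. 0 < prob {\<omega>\<in>space M. w 1 \<omega> \<in> ball (e - z) \<delta>}"
    and \<delta>: "0 < \<delta>"
  shows "AE \<omega> in M. positive_frequency (\<lambda>i. A i \<omega>) \<longrightarrow>
     positive_frequency (\<lambda>i. A i \<omega> \<and> (\<exists>e\<in>E. \<bar>s i \<omega> + w (Suc i) \<omega> - e\<bar> < \<delta>))"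
proof -
  have "compact {-S..S}" by simp
  then obtain Q where Q: "finite Q" "Q \<subseteq> {-S..S}" "{-S..S} \<subseteq> (\<Union>q\<in>Q. ball q (\<delta>/2))"
    by (rule compactE_image[of _ "{-S..S}" "\<lambda>q. ball q (\<delta>/2)"]) (use \<delta> in auto)
  have "\<forall>q\<in>Q. \<exists>e\<in>E. \<forall>\<delta>>0. 0 < prob {\<omega>\<in>space M. w 1 \<omega> \<in> ball (e - q) \<delta>}"
    using reach Q(2) by (force simp: abs_le_iff)
  then obtain e where e: "\<And>q. q \<in> Q \<Longrightarrow> e q \<in> E"
      "\<And>q \<delta>. q \<in> Q \<Longrightarrow> \<delta> > 0 \<Longrightarrow> 0 < prob {\<omega>\<in>space M. w 1 \<omega> \<in> ball (e q - q) \<delta>}"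
    by metis
  \<comment> \<open>If \<open>s i\<close> is within \<open>\<delta>/2\<close> of \<open>q\<close> and the noise within \<open>\<delta>/2\<close> of \<open>e q - q\<close>, then the output is
    within \<open>\<delta>\<close> of \<open>e q\<close>.\<close>
  define p where "p q = prob {\<omega>\<in>space M. w 1 \<omega> \<in> ball (e q - q) (\<delta>/2)}" for q
  have p: "0 < p q" if "q \<in> Q" for q unfolding p_def using e(2)[OF that, of "\<delta>/2"] \<delta> by linarith
  define H where "H q i \<omega> = (of_bool (A i \<omega> \<and> s i \<omega> \<in> ball q (\<delta>/2)) :: real)" for q i \<omega>
  define \<psi> where "\<psi> q z = (of_bool (z \<in> ball (e q - q) (\<delta>/2)) - p q :: real)" for q z
  have noise: "AE \<omega> in M. \<forall>\<^sub>F t in sequentially.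
      \<bar>\<Sum>i=1..<t. H q i \<omega> * \<psi> q (w (Suc i) \<omega>)\<bar> \<le> 1 * real t powr (1/2 + 1/4)" if q: "q \<in> Q" for q
  proof -
    have [measurable]: "ball (e q - q) (\<delta>/2) \<in> sets borel" "ball q (\<delta>/2) \<in> sets borel" by simp_all
    have [measurable]: "\<psi> q \<in> borel_measurable borel" unfolding \<psi>_def by measurable
    have bound: "\<bar>(\<psi> q z)\<^sup>2\<bar> \<le> 4" for z
    proof -
      have "0 \<le> p q" "p q \<le> 1" by (simp_all add: p_def)
      then have "\<bar>\<psi> q z\<bar> \<le> 2" by (auto simp: \<psi>_def abs_le_iff of_bool_def)
      from power_mono[OF this, of 2] show ?thesis by simp
    qed
    have "AE \<omega> in M. \<forall>\<^sub>F t in sequentially. \<forall>k\<in>{()}.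
       \<bar>\<Sum>i=1..<t. H q i \<omega> * \<psi> q (w (Suc i) \<omega>)\<bar> \<le> 1 * real t powr (1/2 + 1/4)"
    proof (rule uniform_noise_bound[where K="\<lambda>_. {()}" and H="\<lambda>_ _. H q"])
      show "H q i \<in> borel_measurable (F i)" for i
        unfolding H_def using s[of i] A[of i] by measurable
      show "summable (\<lambda>t. real (card {()}) * exp (- (real t powr (1/4))))"
        using summable_power_times_exp[of "1/4" 0] by simp
      have "expectation (\<lambda>\<omega>. of_bool (w 1 \<omega> \<in> ball (e q - q) (\<delta>/2))) = p q"
      proof -
        have "expectation (\<lambda>\<omega>. of_bool (w 1 \<omega> \<in> ball (e q - q) (\<delta>/2))) =
          expectation (indicator {\<omega>\<in>space M. w 1 \<omega> \<in> ball (e q - q) (\<delta>/2)})"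
          by (rule Bochner_Integration.integral_cong) (auto simp: indicator_def)
        also have "\<dots> = p q" unfolding p_def Bochner_Integration.integral_indicator
          by (rule arg_cong[where f=prob]) auto
        finally show ?thesis .
      qed
      moreover have "integrable M (\<lambda>\<omega>. of_bool (w 1 \<omega> \<in> ball (e q - q) (\<delta>/2)) :: real)"
        by (rule integrable_const_bound[where B=1]) auto
      ultimately show "expectation (\<lambda>\<omega>. \<psi> q (w 1 \<omega>)) = 0"
        unfolding \<psi>_def by (simp add: prob_space)
      show "integrable M (\<lambda>\<omega>. (\<psi> q (w 1 \<omega>))\<^sup>2)"
        by (rule integrable_const_bound[where B=4]) (use bound in auto)
    qed (auto simp: H_def)
    then show ?thesis by simp
  qed
  have "AE \<omega> in M. \<forall>q\<in>Q. \<forall>\<^sub>F t in sequentially.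
      \<bar>\<Sum>i=1..<t. H q i \<omega> * \<psi> q (w (Suc i) \<omega>)\<bar> \<le> 1 * real t powr (1/2 + 1/4)"
    using noise Q(1) by (simp add: AE_finite_all)
  with bnd show ?thesis
  proof eventually_elim
    case (elim \<omega>)
    define B where "B i \<longleftrightarrow> A i \<omega> \<and> (\<exists>e\<in>E. \<bar>s i \<omega> + w (Suc i) \<omega> - e\<bar> < \<delta>)" for i
    show ?case unfolding B_def[symmetric]
    proof
      assume "positive_frequency (\<lambda>i. A i \<omega>)"
      then obtain c where c: "c > 0" and
        ev: "\<forall>\<^sub>F t in sequentially. c * real t \<le> (\<Sum>i=1..<t. of_bool (A i \<omega>))"
        unfolding positive_frequency_def by blast
      \<comment> \<open>The set of times is not empty, hence \<open>S\<close> is nonnegative and there is at least one cell.\<close>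
      obtain t0 where "c * real t0 \<le> (\<Sum>i=1..<t0. of_bool (A i \<omega>))" "t0 > 0"
        using eventually_happens[OF eventually_conj[OF ev eventually_gt_at_top[of 0]]] by auto
      moreover have "0 < c * real t0" using c \<open>0 < t0\<close> by simp
      ultimately have "(\<Sum>i=1..<t0. of_bool (A i \<omega>)) \<noteq> (0::real)" by linarith
      then have "\<exists>i\<in>{1..<t0}. A i \<omega>"
        by (metis (mono_tags, lifting) of_bool_eq(1) sum.neutral)
      then obtain i0 where "1 \<le> i0" "A i0 \<omega>" by auto
      then have "0 \<le> S" using elim(1) by force
      then have Q0: "Q \<noteq> {}" using Q(3) by auto
      define p0 where "p0 = Min (p ` Q)"
      have p0: "0 < p0" "\<And>q. q \<in> Q \<Longrightarrow> p0 \<le> p q"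
        using Q0 Q(1) p by (auto simp: p0_def)
      define n where "n = real (card Q)"
      have n: "0 < n" using Q0 Q(1) by (auto simp: n_def card_gt_0_iff)
      have BH: "H q i \<omega> * of_bool (w (Suc i) \<omega> \<in> ball (e q - q) (\<delta>/2)) \<le> of_bool (B i)" if "q \<in> Q" for q i
      proof (cases "A i \<omega> \<and> s i \<omega> \<in> ball q (\<delta>/2) \<and> w (Suc i) \<omega> \<in> ball (e q - q) (\<delta>/2)")
        case True
        then have "\<bar>q - s i \<omega>\<bar> < \<delta>/2" "\<bar>e q - q - w (Suc i) \<omega>\<bar> < \<delta>/2" by (auto simp: dist_real_def)
        then have "\<bar>s i \<omega> + w (Suc i) \<omega> - e q\<bar> < \<delta>" by linarith
        then have "B i" using True e(1)[OF that] by (auto simp: B_def)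
        then show ?thesis by (simp add: H_def)
      qed (auto simp: H_def)
      have AH: "of_bool (A i \<omega>) \<le> (\<Sum>q\<in>Q. H q i \<omega>)" if "1 \<le> i" for i
      proof (cases "A i \<omega>")
        case True
        then have "s i \<omega> \<in> {-S..S}" using elim(1) that by (auto simp: abs_le_iff)
        then obtain q where q: "q \<in> Q" "s i \<omega> \<in> ball q (\<delta>/2)" using Q(3) by blast
        then have "(1::real) = H q i \<omega>" using True by (simp add: H_def)
        also have "\<dots> \<le> (\<Sum>q\<in>Q. H q i \<omega>)"
          by (rule member_le_sum) (use q Q(1) in \<open>auto simp: H_def\<close>)
        finally show ?thesis using True by simp
      qed (auto simp: H_def intro!: sum_nonneg)
      have small: "\<forall>\<^sub>F t in sequentially. real t powr (1/2 + 1/4) \<le> (p0 * c / (2 * n)) * real t"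
      proof -
        have "(\<lambda>t. real t powr (1/2+1/4)) \<in> o(\<lambda>t. real t)" by real_asymp
        from landau_o.smallD[OF this, of "p0 * c / (2 * n)"] p0 c n show ?thesis by simp
      qed
      have "\<forall>\<^sub>F t in sequentially. \<forall>q\<in>Q.
         \<bar>\<Sum>i=1..<t. H q i \<omega> * \<psi> q (w (Suc i) \<omega>)\<bar> \<le> 1 * real t powr (1/2 + 1/4)"
        using elim(2) Q(1) by (simp add: eventually_ball_finite)
      with ev small
      have "\<forall>\<^sub>F t in sequentially. p0 * c / (2 * n) * real t \<le> (\<Sum>i=1..<t. of_bool (B i))"
      proof eventually_elim
        case (elim t)
        define N where "N = (\<Sum>i=1..<t. of_bool (B i) :: real)"
        have each: "p q * (\<Sum>i=1..<t. H q i \<omega>) - real t powr (1/2+1/4) \<le> N" if q: "q \<in> Q" for q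
        proof -
          have "(\<Sum>i=1..<t. H q i \<omega> * \<psi> q (w (Suc i) \<omega>))
             = (\<Sum>i=1..<t. H q i \<omega> * of_bool (w (Suc i) \<omega> \<in> ball (e q - q) (\<delta>/2))) - p q * (\<Sum>i=1..<t. H q i \<omega>)"
            unfolding \<psi>_def by (simp add: algebra_simps sum_subtractf sum_distrib_left)
          moreover have "(\<Sum>i=1..<t. H q i \<omega> * of_bool (w (Suc i) \<omega> \<in> ball (e q - q) (\<delta>/2))) \<le> N"
            unfolding N_def by (rule sum_mono) (rule BH[OF q])
          moreover have "\<bar>\<Sum>i=1..<t. H q i \<omega> * \<psi> q (w (Suc i) \<omega>)\<bar> \<le> real t powr (1/2+1/4)"
            using elim(3) q by simp
          ultimately show ?thesis by linarith
        qed
        have "p0 * (c * real t) \<le> p0 * (\<Sum>i=1..<t. of_bool (A i \<omega>))"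
          using elim(1) p0 by (intro mult_left_mono) auto
        also have "\<dots> \<le> p0 * (\<Sum>i=1..<t. \<Sum>q\<in>Q. H q i \<omega>)"
          using AH p0 by (intro mult_left_mono sum_mono) auto
        also have "\<dots> = (\<Sum>q\<in>Q. p0 * (\<Sum>i=1..<t. H q i \<omega>))"
          by (subst sum.swap) (simp add: sum_distrib_left)
        also have "\<dots> \<le> (\<Sum>q\<in>Q. N + real t powr (1/2+1/4))"
        proof (rule sum_mono)
          fix q assume q: "q \<in> Q"
          have "p0 * (\<Sum>i=1..<t. H q i \<omega>) \<le> p q * (\<Sum>i=1..<t. H q i \<omega>)"
            using p0(2)[OF q] by (intro mult_right_mono sum_nonneg) (auto simp: H_def)
          then show "p0 * (\<Sum>i=1..<t. H q i \<omega>) \<le> N + real t powr (1/2+1/4)" using each[OF q] by linarith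
        qed
        also have "\<dots> = n * (N + real t powr (1/2+1/4))" by (simp add: n_def)
        also have "\<dots> \<le> n * (N + p0 * c / (2 * n) * real t)"
          using elim(2) n by (intro mult_left_mono add_left_mono) auto
        also have "\<dots> = n * N + p0 * c * real t / 2" using n by (simp add: field_simps)
        finally have "p0 * c * real t / 2 \<le> n * N" by (simp add: mult_ac)
        then show ?case unfolding N_def[symmetric] using n by (simp add: field_simps)
      qed
      moreover have "p0 * c / (2 * n) > 0" using p0 c n by simp
      ultimately show "positive_frequency B" unfolding positive_frequency_def by blast
    qed
  qed
qed

end

section \<open>The set P' and identification by elimination\<close>

lemma sum_from_head:
  fixes F :: "nat \<Rightarrow> real" assumes "k \<le> n"
  shows "(\<Sum>j=Suc k..n. F j) = (\<Sum>j=k..n. F j) - F k"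
  using sum.atLeast_Suc_atMost[OF assms, of F] by simp

text \<open>
  The vector of the \<open>g k j\<close>, for \<open>j\<close> from \<open>k\<close> to \<open>n\<close>, is a row obtained from \<open>2 ^ (k - 1)\<close> gradients
  by eliminating the first \<open>k - 1\<close> coordinates, so it annihilates whatever all gradients annihilate.
\<close>

lemma g_fun_combination:
  assumes "1 \<le> k" "k \<le> n"
    and "\<And>b. b < 2 ^ (k - 1) \<Longrightarrow> (\<Sum>j=1..n. D j (X b) (Y b) * h j) = 0"
  shows "(\<Sum>j=k..n. g_fun D k j X Y * h j) = (0::real)"
  using assms
proof (induction k arbitrary: X Y)
  case 0
  then show ?case by simp
next
  case (Suc k)
  show ?case
  proof (cases k)
    case 0
    then show ?thesis using Suc.prems(3)[of 0] by simp
  next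
    case k: (Suc k')
    let ?X = "\<lambda>i. X (i + 2 ^ k')" and ?Y = "\<lambda>i. Y (i + 2 ^ k')"
    have pow: "2 ^ (Suc k - 1) = 2 ^ k' + (2 ^ k' :: nat)" using k by simp
    have 1: "(\<Sum>j=k..n. g_fun D k j X Y * h j) = 0"
      by (rule Suc.IH) (use Suc.prems k pow in auto)
    have 2: "(\<Sum>j=k..n. g_fun D k j ?X ?Y * h j) = 0"
      by (rule Suc.IH) (use Suc.prems k pow in auto)
    have "(\<Sum>j=Suc k..n. g_fun D (Suc k) j X Y * h j)
        = g_fun D k k X Y * (\<Sum>j=Suc k..n. g_fun D k j ?X ?Y * h j)
          - g_fun D k k ?X ?Y * (\<Sum>j=Suc k..n. g_fun D k j X Y * h j)"
      unfolding k sum_distrib_left sum_subtractf[symmetric]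
      by (rule sum.cong) (simp_all add: algebra_simps)
    also have "\<dots> = 0"
      unfolding sum_from_head[OF Suc_leD[OF Suc.prems(2)]] 1 2 by simp
    finally show ?thesis .
  qed
qed

text \<open>
  A nonzero pivot at level \<open>k\<close> determines coordinate \<open>k\<close>. It also forces a nonzero pivot at level
  \<open>k - 1\<close> in one of the two halves of the sample, since \<open>g\<close> at level \<open>k\<close> is linear in those two pivots; the
  induction continues in that half.
\<close>

lemma g_fun_back_substitution:
  assumes "1 \<le> k" "k \<le> n" and "g_fun D k k X Y \<noteq> 0"
    and "\<And>b. b < 2 ^ (k - 1) \<Longrightarrow> (\<Sum>j=1..n. D j (X b) (Y b) * h j) = (0::real)"
    and "\<And>j. k < j \<Longrightarrow> j \<le> n \<Longrightarrow> h j = 0"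
    and "1 \<le> j" "j \<le> n"
  shows "h j = 0"
  using assms
proof (induction k arbitrary: X Y)
  case 0
  then show ?case by simp
next
  case (Suc k)
  have "0 = (\<Sum>j=Suc k..n. g_fun D (Suc k) j X Y * h j)"
    by (rule g_fun_combination[symmetric]) (use Suc.prems in auto)
  also have "\<dots> = g_fun D (Suc k) (Suc k) X Y * h (Suc k)"
    using Suc.prems(2,5) by (subst sum.atLeast_Suc_atMost) (auto intro!: sum.neutral)
  finally have hk: "h (Suc k) = 0" using Suc.prems(3) by simp
  have hgt: "h j = 0" if "k < j" "j \<le> n" for j
    using hk Suc.prems(5)[of j] that by (cases "j = Suc k") auto
  show ?case
  proof (cases k)
    case 0
    then show ?thesis using hgt[of j] Suc.prems by simp
  next
    case k: (Suc k')
    let ?X = "\<lambda>i. X (i + 2 ^ k')" and ?Y = "\<lambda>i. Y (i + 2 ^ k')"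
    have pow: "2 ^ (Suc k - 1) = 2 ^ k' + (2 ^ k' :: nat)" using k by simp
    have "g_fun D k k X Y \<noteq> 0 \<or> g_fun D k k ?X ?Y \<noteq> 0"
      using Suc.prems(3) unfolding k by auto
    then show ?thesis
    proof
      assume "g_fun D k k X Y \<noteq> 0"
      then show ?thesis by (rule Suc.IH[rotated 2]) (use Suc.prems k pow hgt in auto)
    next
      assume "g_fun D k k ?X ?Y \<noteq> 0"
      then show ?thesis by (rule Suc.IH[rotated 2]) (use Suc.prems k pow hgt in auto)
    qed
  qed
qed

definition block :: "('m::finite \<Rightarrow> nat) \<Rightarrow> (nat \<Rightarrow> real) \<Rightarrow> nat \<Rightarrow> real ^ 'm" where
  "block lag \<beta> b = (\<chi> l. \<beta> (b * CARD('m) + lag l))"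

lemma inner_coord_sum:
  fixes v h :: "real ^ 'n::finite"
  assumes "bij_betw coord {1..CARD('n)} UNIV"
  shows "v \<bullet> h = (\<Sum>j=1..CARD('n). v $ coord j * h $ coord j)"
  unfolding inner_vec_def using sum.reindex_bij_betw[OF assms, of "\<lambda>k. v $ k * h $ k"] by simp

lemma P_set_spanning:
  fixes Df :: "real ^ 'n::finite \<Rightarrow> real ^ 'm::finite \<Rightarrow> real ^ 'n"
  assumes coord: "bij_betw coord {1..CARD('n)} UNIV"
    and \<beta>: "\<beta> \<in> P_set Df coord lag \<Theta>"
    and X: "\<And>b. b < 2 ^ (CARD('n) - 1) \<Longrightarrow> X b \<in> \<Theta>"
    and orth: "\<And>b. b < 2 ^ (CARD('n) - 1) \<Longrightarrow> Df (X b) (block lag \<beta> b) \<bullet> h = 0"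
  shows "h = 0"
proof -
  have "h $ coord j = 0" if j: "1 \<le> j" "j \<le> CARD('n)" for j
  proof (rule g_fun_back_substitution[where k="CARD('n)" and n="CARD('n)" and X=X
        and Y="block lag \<beta>" and D="\<lambda>j x z. Df x z $ coord j" and h="\<lambda>j. h $ coord j"])
    show "1 \<le> CARD('n)" by (simp add: Suc_leI)
    show "g_fun (\<lambda>j x z. Df x z $ coord j) CARD('n) CARD('n) X (block lag \<beta>) \<noteq> 0"
      using \<beta> X unfolding P_set_def block_def by auto
    show "(\<Sum>j=1..CARD('n). Df (X b) (block lag \<beta> b) $ coord j * h $ coord j) = 0"
      if "b < 2 ^ (CARD('n) - 1)" for b
      using orth[OF that] inner_coord_sum[OF coord] by metis
  qed (use j in auto)
  then have "\<forall>k\<in>coord ` {1..CARD('n)}. h $ k = 0" by simp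
  then have "\<forall>k. h $ k = 0" unfolding bij_betw_imp_surj_on[OF coord] by blast
  then show ?thesis by (simp add: vec_eq_iff)
qed

text \<open>
  The sum of the absolute inner products is continuous and, by \<open>P_set_spanning\<close>, positive on the
  compact set of all choices of parameters in \<open>\<Theta>\<close> and unit directions, hence bounded below.
\<close>

lemma P_set_lower_bound:
  fixes Df :: "real ^ 'n::finite \<Rightarrow> real ^ 'm::finite \<Rightarrow> real ^ 'n"
  assumes coord: "bij_betw coord {1..CARD('n)} UNIV"
    and Df: "continuous_on UNIV (\<lambda>(x, z). Df x z)"
    and \<Theta>: "compact \<Theta>" "\<Theta> \<noteq> {}"
    and \<beta>: "\<beta> \<in> P_set Df coord lag \<Theta>"
  shows "\<exists>c>0. \<forall>X h. (\<forall>b<2 ^ (CARD('n) - 1). X b \<in> \<Theta>) \<longrightarrow>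
     (\<exists>b<2 ^ (CARD('n) - 1). c * norm h \<le> \<bar>Df (X b) (block lag \<beta> b) \<bullet> h\<bar>)"
proof -
  define q :: nat where "q = 2 ^ (CARD('n) - 1)"
  have q0: "0 < q" by (simp add: q_def)
  define \<Phi> where "\<Phi> = (\<lambda>(X :: nat \<Rightarrow> real ^ 'n, h). \<Sum>b<q. \<bar>Df (X b) (block lag \<beta> b) \<bullet> h\<bar>)"
  define K where "K = (Pi\<^sub>E UNIV (\<lambda>_::nat. \<Theta>)) \<times> sphere (0 :: real ^ 'n) 1"
  have "compact K" unfolding K_def
  proof (rule compact_Times)
    have "compactin (product_topology (\<lambda>_. euclidean) UNIV) (Pi\<^sub>E UNIV (\<lambda>_::nat. \<Theta>))"
      unfolding compactin_PiE using \<Theta> by simp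
    then show "compact (Pi\<^sub>E UNIV (\<lambda>_::nat. \<Theta>))" by (simp add: euclidean_product_topology)
  qed simp
  moreover have "K \<noteq> {}"
  proof -
    obtain x where "x \<in> \<Theta>" using \<Theta> by blast
    moreover have "axis undefined 1 \<in> sphere (0 :: real ^ 'n) 1" by simp
    ultimately have "(\<lambda>_. x, axis undefined 1) \<in> K" unfolding K_def by auto
    then show ?thesis by blast
  qed
  moreover have "continuous_on K \<Phi>"
  proof -
    have "continuous_on K (\<lambda>p. Df (fst p b) (block lag \<beta> b))" for b
    proof -
      have c: "continuous_on K (\<lambda>p. (fst p b, block lag \<beta> b))"
        by (intro continuous_on_Pair continuous_on_const)
          (rule continuous_on_compose2[OF continuous_on_product_coordinates continuous_on_fst[OF continuous_on_id]], simp)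
      show ?thesis using continuous_on_compose2[OF Df c] by simp
    qed
    then show ?thesis unfolding \<Phi>_def case_prod_unfold by (intro continuous_intros)
  qed
  ultimately obtain p where p: "p \<in> K" "\<And>p'. p' \<in> K \<Longrightarrow> \<Phi> p \<le> \<Phi> p'"
    using continuous_attains_inf by metis
  obtain X0 h0 where p_eq: "p = (X0, h0)" by (cases p)
  have "\<Phi> p \<noteq> 0"
  proof
    assume "\<Phi> p = 0"
    then have "\<forall>b<q. Df (X0 b) (block lag \<beta> b) \<bullet> h0 = 0"
      unfolding \<Phi>_def p_eq by (simp add: sum_nonneg_eq_0_iff)
    then have "h0 = 0" using P_set_spanning[OF coord \<beta>, of X0 h0] p(1)
      unfolding K_def p_eq q_def by auto
    then show False using p(1) unfolding K_def p_eq by simp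
  qed
  moreover have "0 \<le> \<Phi> p" unfolding \<Phi>_def p_eq by (auto intro: sum_nonneg)
  ultimately have pos: "0 < \<Phi> p" by simp
  define c where "c = \<Phi> p / q"
  have c: "0 < c" using pos q0 by (simp add: c_def)
  have "\<exists>b<q. c * norm h \<le> \<bar>Df (X b) (block lag \<beta> b) \<bullet> h\<bar>" if X: "\<forall>b<q. X b \<in> \<Theta>" for X h
  proof (cases "h = 0")
    case True
    then show ?thesis using q0 by auto
  next
    case False
    obtain x where x: "x \<in> \<Theta>" using \<Theta> by blast
    \<comment> \<open>The compact set consists of sequences indexed by all of \<open>nat\<close>; the entries from \<open>q\<close> on do not enter the sum.\<close>
    define X' where "X' b = (if b < q then X b else x)" for b
    have "(X', h /\<^sub>R norm h) \<in> K" using X x False unfolding K_def X'_def by auto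
    from p(2)[OF this] have le: "\<Phi> p \<le> (\<Sum>b<q. \<bar>Df (X b) (block lag \<beta> b) \<bullet> h\<bar> / norm h)"
      unfolding \<Phi>_def by (simp add: X'_def abs_mult divide_inverse mult.commute)
    show ?thesis
    proof (rule ccontr)
      assume "\<not> ?thesis"
      then have "\<bar>Df (X b) (block lag \<beta> b) \<bullet> h\<bar> / norm h < c" if "b < q" for b
        using that False by (auto simp: not_le divide_less_eq)
      then have "(\<Sum>b<q. \<bar>Df (X b) (block lag \<beta> b) \<bullet> h\<bar> / norm h) < (\<Sum>b<q. c)"
        using q0 by (intro sum_strict_mono) auto
      also have "\<dots> = \<Phi> p" using q0 by (simp add: c_def)
      finally show False using le by simp
    qed
  qed
  with c show ?thesis unfolding q_def by blast
qed

text \<open>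
  If for every \<open>b\<close> the regressor \<open>Y b\<close> is within \<open>\<delta>\<close> of the targets of block \<open>b\<close>, then in every direction
  \<open>h\<close> some block has a directional derivative of size at least \<open>c * norm h\<close>, for any choice of
  base points \<open>X\<close>. The base points are free because they will be intermediate points of the mean value theorem.
\<close>

definition identifies ::
  "(real ^ 'n \<Rightarrow> real ^ 'm \<Rightarrow> real ^ 'n) \<Rightarrow> ('m::finite \<Rightarrow> nat) \<Rightarrow> (real ^ 'n::finite) set
    \<Rightarrow> (nat \<Rightarrow> real set) \<Rightarrow> real \<Rightarrow> real \<Rightarrow> bool" where
  "identifies Df lag \<Theta> E c \<delta> \<longleftrightarrow> (\<forall>X Y h. (\<forall>b<2 ^ (CARD('n) - 1). X b \<in> \<Theta>) \<longrightarrow>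
     (\<forall>b<2 ^ (CARD('n) - 1). \<forall>l. \<exists>e\<in>E (b * CARD('m) + lag l). \<bar>Y b $ l - e\<bar> < \<delta>) \<longrightarrow>
     (\<exists>b<2 ^ (CARD('n) - 1). c * norm h \<le> \<bar>Df (X b) (Y b) \<bullet> h\<bar>))"

text \<open>
  A finite number of targets yields finitely many points of \<open>P'\<close>, so the constant in \<open>P_set_lower_bound\<close>
  can be chosen for all of them. Uniform continuity of the gradient then absorbs a deviation of the
  regressors from the targets, at the expense of half the constant.
\<close>

lemma uniform_excitation:
  fixes Df :: "real ^ 'n::finite \<Rightarrow> real ^ 'm::finite \<Rightarrow> real ^ 'n"
  assumes coord: "bij_betw coord {1..CARD('n)} UNIV"
    and lag: "bij_betw lag UNIV {0..<CARD('m)}"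
    and Df: "continuous_on UNIV (\<lambda>(x, z). Df x z)"
    and \<Theta>: "compact \<Theta>" "\<Theta> \<noteq> {}"
    and E: "(\<Pi>\<^sub>E j\<in>{..<2 ^ (CARD('n) - 1) * CARD('m)}. E j) \<subseteq> P_set Df coord lag \<Theta>"
    and fin: "\<And>j. j < 2 ^ (CARD('n) - 1) * CARD('m) \<Longrightarrow> finite (E j)"
  shows "\<exists>c>0. \<exists>\<delta>>0. identifies Df lag \<Theta> E c \<delta>"
proof -
  define q :: nat where "q = 2 ^ (CARD('n) - 1)"
  define B where "B = (\<Pi>\<^sub>E j\<in>{..<q * CARD('m)}. E j)"
  have finB: "finite B" unfolding B_def using fin by (intro finite_PiE) (auto simp: q_def)
  have "\<forall>\<beta>\<in>B. \<exists>c>0. \<forall>X h. (\<forall>b<q. X b \<in> \<Theta>) \<longrightarrow> (\<exists>b<q. c * norm h \<le> \<bar>Df (X b) (block lag \<beta> b) \<bullet> h\<bar>)"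
    using P_set_lower_bound[OF coord Df \<Theta>] E unfolding q_def B_def by blast
  then obtain c where c: "\<And>\<beta>. \<beta> \<in> B \<Longrightarrow> 0 < c \<beta>"
     "\<And>\<beta> X h. \<beta> \<in> B \<Longrightarrow> (\<forall>b<q. X b \<in> \<Theta>) \<Longrightarrow> \<exists>b<q. c \<beta> * norm h \<le> \<bar>Df (X b) (block lag \<beta> b) \<bullet> h\<bar>"
    by metis
  define c0 where "c0 = Min (insert 1 (c ` B))"
  have c0: "0 < c0" "\<And>\<beta>. \<beta> \<in> B \<Longrightarrow> c0 \<le> c \<beta>" using finB c(1) by (auto simp: c0_def)
  define Z where "Z = (\<Union>\<beta>\<in>B. \<Union>b<q. cball (block lag \<beta> b) (real CARD('m)))"
  have Z: "compact Z" unfolding Z_def using finB by (intro compact_UN) auto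
  have "uniformly_continuous_on (\<Theta> \<times> Z) (\<lambda>(x, z). Df x z)"
    by (rule compact_uniformly_continuous[OF continuous_on_subset[OF Df] compact_Times[OF \<Theta>(1) Z]]) simp
  then obtain d where d: "d > 0" "\<And>x z z'. x \<in> \<Theta> \<Longrightarrow> z \<in> Z \<Longrightarrow> z' \<in> Z \<Longrightarrow> dist z' z < d \<Longrightarrow> dist (Df x z') (Df x z) < c0 / 2"
    unfolding uniformly_continuous_on_def using c0(1)
    by (force simp: dist_Pair_Pair dest: spec[of _ "c0/2"])
  define \<delta> where "\<delta> = min 1 (d / real CARD('m))"
  have m0: "0 < CARD('m)" by simp
  have \<delta>: "0 < \<delta>" "\<delta> \<le> 1" "real CARD('m) * \<delta> \<le> d" using d m0 by (auto simp: \<delta>_def min_def field_simps)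
  have main: "\<exists>b<q. c0 / 2 * norm h \<le> \<bar>Df (X b) (Y b) \<bullet> h\<bar>"
    if X: "\<forall>b<q. X b \<in> \<Theta>" and Y: "\<forall>b<q. \<forall>l. \<exists>e\<in>E (b * CARD('m) + lag l). \<bar>Y b $ l - e\<bar> < \<delta>" for X Y h
  proof -
    obtain e where e: "\<And>b l. b < q \<Longrightarrow> e b l \<in> E (b * CARD('m) + lag l) \<and> \<bar>Y b $ l - e b l\<bar> < \<delta>"
      using Y by metis
    \<comment> \<open>Position \<open>j\<close> of a point of \<open>P'\<close> belongs to block \<open>j div m\<close> and to lag \<open>j mod m\<close>.\<close>
    define \<beta> where "\<beta> = (\<lambda>j\<in>{..<q * CARD('m)}. e (j div CARD('m)) (inv lag (j mod CARD('m))))"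
    have lt: "lag l < CARD('m)" for l using lag unfolding bij_betw_def by auto
    have inj: "inj lag" using lag by (auto simp: bij_betw_def)
    have idx: "b * CARD('m) + lag l < q * CARD('m)" if "b < q" for b l
    proof -
      have "b * CARD('m) + lag l < Suc b * CARD('m)" using lt by simp
      also have "\<dots> \<le> q * CARD('m)" using that by (intro mult_le_mono1) auto
      finally show ?thesis .
    qed
    have \<beta>e: "\<beta> (b * CARD('m) + lag l) = e b l" if "b < q" for b l
      using idx[OF that] lt[of l] inj by (simp add: \<beta>_def)
    have "\<beta> \<in> B" unfolding B_def
    proof (rule PiE_I)
      fix j assume j: "j \<in> {..<q * CARD('m)}"
      have jd: "j div CARD('m) < q" using j by (simp add: less_mult_imp_div_less)
      have "lag (inv lag (j mod CARD('m))) = j mod CARD('m)"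
        using lag by (intro f_inv_into_f) (auto simp: bij_betw_def)
      then show "\<beta> j \<in> E j" using e[OF jd, of "inv lag (j mod CARD('m))"] j by (simp add: \<beta>_def)
    qed (simp add: \<beta>_def)
    have near: "dist (Y b) (block lag \<beta> b) < real CARD('m) * \<delta>" if "b < q" for b
    proof -
      have "dist (Y b) (block lag \<beta> b) \<le> (\<Sum>l\<in>UNIV. \<bar>Y b $ l - e b l\<bar>)"
        unfolding dist_norm using norm_le_l1_cart[of "Y b - block lag \<beta> b"] \<beta>e[OF that] by (simp add: block_def)
      also have "\<dots> < (\<Sum>l\<in>(UNIV::'m set). \<delta>)" using e[OF that] by (intro sum_strict_mono) auto
      finally show ?thesis by simp
    qed
    obtain b where b: "b < q" "c \<beta> * norm h \<le> \<bar>Df (X b) (block lag \<beta> b) \<bullet> h\<bar>"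
      using c(2)[OF \<open>\<beta> \<in> B\<close> X, of h] by blast
    have YZ: "Y b \<in> Z"
    proof -
      have "real CARD('m) * \<delta> \<le> real CARD('m) * 1" using \<delta>(2) by (intro mult_left_mono) auto
      then have "dist (Y b) (block lag \<beta> b) \<le> real CARD('m)" using near[OF b(1)] by linarith
      then have "Y b \<in> cball (block lag \<beta> b) (real CARD('m))" by (simp add: dist_commute)
      then show ?thesis using \<open>\<beta> \<in> B\<close> b(1) unfolding Z_def by blast
    qed
    have bZ: "block lag \<beta> b \<in> Z" using \<open>\<beta> \<in> B\<close> b(1) unfolding Z_def by force
    have dist: "dist (Df (X b) (Y b)) (Df (X b) (block lag \<beta> b)) < c0 / 2"
      using d(2)[OF _ bZ YZ, of "X b"] X b(1) near[OF b(1)] \<delta>(3) by auto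
    have "\<bar>Df (X b) (block lag \<beta> b) \<bullet> h\<bar> \<le> \<bar>Df (X b) (Y b) \<bullet> h\<bar> + \<bar>(Df (X b) (Y b) - Df (X b) (block lag \<beta> b)) \<bullet> h\<bar>"
      by (simp add: inner_diff_left)
    also have "\<bar>(Df (X b) (Y b) - Df (X b) (block lag \<beta> b)) \<bullet> h\<bar> \<le> c0 / 2 * norm h"
      using Cauchy_Schwarz_ineq2[of "Df (X b) (Y b) - Df (X b) (block lag \<beta> b)" h] dist
        mult_right_mono[of "norm (Df (X b) (Y b) - Df (X b) (block lag \<beta> b))" "c0/2" "norm h"]
      by (auto simp: dist_norm)
    finally have "c \<beta> * norm h \<le> \<bar>Df (X b) (Y b) \<bullet> h\<bar> + c0 / 2 * norm h" using b(2) by linarith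
    moreover have "c0 * norm h \<le> c \<beta> * norm h" using c0(2)[OF \<open>\<beta> \<in> B\<close>] by (rule mult_right_mono) simp
    ultimately have "c0 / 2 * norm h \<le> \<bar>Df (X b) (Y b) \<bullet> h\<bar>" by (simp add: algebra_simps)
    with b(1) show ?thesis by blast
  qed
  have "0 < c0 / 2" using c0 by simp
  with main \<delta>(1) show ?thesis unfolding identifies_def q_def by blast
qed

section \<open>The closed loop as a driven noise\<close>

locale closed_loop_system = prob_space M for M :: "'a measure" +
  fixes f :: "real ^ 'n::finite \<Rightarrow> real ^ 'm::finite \<Rightarrow> real"
    and Df :: "real ^ 'n \<Rightarrow> real ^ 'm \<Rightarrow> real ^ 'n"
    and coord :: "nat \<Rightarrow> 'n" and lag :: "'m \<Rightarrow> nat"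
    and a b \<theta> :: "real ^ 'n"
    and y u w :: "int \<Rightarrow> 'a \<Rightarrow> real" and \<chi>0 :: "'a \<Rightarrow> real ^ 'm"
    and Cw :: ennreal and Cu \<kappa> :: real and m :: int
  assumes m_def: "m = int CARD('m)"
    and coord: "bij_betw coord {1..CARD('n)} UNIV"
    and lag: "bij_betw lag UNIV {0..<CARD('m)}"
    and nondegenerate: "\<forall>k. a $ k < b $ k"
    and theta: "\<theta> \<in> cbox a b"
    and f_cont: "continuous_on UNIV (\<lambda>(x, z). f x z)"
    and f_deriv: "\<forall>x z. GDERIV (\<lambda>x'. f x' z) x :> Df x z"
    and Df_cont: "continuous_on UNIV (\<lambda>(x, z). Df x z)"
    and inputs: "admissible_experiment M m Cu \<chi>0 u"
    and B1: "assumption_B1 M m Cw \<kappa> \<chi>0 u w"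
    and init: "\<forall>\<omega>\<in>space M. regressor lag (\<lambda>s. y s \<omega>) (1 - m) = \<chi>0 \<omega>"
    and closed_loop: "\<forall>\<omega>\<in>space M. \<forall>t\<ge>1 - m.
          y (t + 1) \<omega> = f \<theta> (regressor lag (\<lambda>s. y s \<omega>) t) + u t \<omega> + w (t + 1) \<omega>"
begin

lemma m_ge_1: "1 \<le> m"
  using one_le_card_finite[where 'a='m] unfolding m_def by linarith

definition \<phi> :: "nat \<Rightarrow> 'a \<Rightarrow> real ^ 'm" where
  "\<phi> i \<omega> = regressor lag (\<lambda>s. y s \<omega>) (int i)"

text \<open>
  The part of the output at time \<open>i + 1\<close> that is determined before the noise of that time acts.
\<close>

definition predictor :: "nat \<Rightarrow> 'a \<Rightarrow> real" where
  "predictor i \<omega> = f \<theta> (\<phi> i \<omega>) + u (int i) \<omega>"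

lemma output_step: "\<omega> \<in> space M \<Longrightarrow> y (int (Suc i)) \<omega> = predictor i \<omega> + w (int (Suc i)) \<omega>"
  using closed_loop[rule_format, of \<omega> "int i"] m_ge_1 by (simp add: predictor_def \<phi>_def add.commute)

abbreviation history :: "nat \<Rightarrow> 'a \<Rightarrow> (real ^ 'm) \<times> (int \<Rightarrow> real) \<times> (int \<Rightarrow> real)" where
  "history i \<equiv> \<lambda>\<omega>. (\<chi>0 \<omega>, (\<lambda>j\<in>{1 - m..int i}. u j \<omega>), (\<lambda>j\<in>{2 - m..int i}. w j \<omega>))"

abbreviation history_space :: "nat \<Rightarrow> ((real ^ 'm) \<times> (int \<Rightarrow> real) \<times> (int \<Rightarrow> real)) measure" where
  "history_space i \<equiv> borel \<Otimes>\<^sub>M (Pi\<^sub>M {1 - m..int i} (\<lambda>_. borel) \<Otimes>\<^sub>M Pi\<^sub>M {2 - m..int i} (\<lambda>_. borel))"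

definition past :: "nat \<Rightarrow> 'a measure" where
  "past i = vimage_algebra (space M) (history i) (history_space i)"

lemma space_past [simp]: "space (past i) = space M"
  by (simp add: past_def)

lemma history_measurable: "history i \<in> measurable (past i) (history_space i)"
  unfolding past_def
  by (rule measurable_vimage_algebra1) (auto simp: space_pair_measure space_PiM)

lemma history_components:
  shows "\<chi>0 \<in> borel_measurable (past i)"
    and "1 - m \<le> j \<Longrightarrow> j \<le> int i \<Longrightarrow> u j \<in> borel_measurable (past i)"
    and "2 - m \<le> j \<Longrightarrow> j \<le> int i \<Longrightarrow> w j \<in> borel_measurable (past i)"
proof -
  note h = history_measurable[of i]
  have 1: "(\<lambda>\<omega>. fst (history i \<omega>)) \<in> borel_measurable (past i)"
    by (rule measurable_compose[OF h measurable_fst])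
  then show "\<chi>0 \<in> borel_measurable (past i)" by simp
  have 2: "(\<lambda>\<omega>. fst (snd (history i \<omega>))) \<in> measurable (past i) (Pi\<^sub>M {1 - m..int i} (\<lambda>_. borel))"
    by (rule measurable_compose[OF measurable_compose[OF h measurable_snd] measurable_fst])
  have 3: "(\<lambda>\<omega>. snd (snd (history i \<omega>))) \<in> measurable (past i) (Pi\<^sub>M {2 - m..int i} (\<lambda>_. borel))"
    by (rule measurable_compose[OF measurable_compose[OF h measurable_snd] measurable_snd])
  show "u j \<in> borel_measurable (past i)" if "1 - m \<le> j" "j \<le> int i"
    using measurable_compose[OF 2 measurable_component_singleton, of j] that by simp
  show "w j \<in> borel_measurable (past i)" if "2 - m \<le> j" "j \<le> int i"
    using measurable_compose[OF 3 measurable_component_singleton, of j] that by simp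
qed

lemma primitives_measurable:
  shows "\<chi>0 \<in> borel_measurable M"
    and "1 - m \<le> j \<Longrightarrow> u j \<in> borel_measurable M"
    and "2 - m \<le> j \<Longrightarrow> w j \<in> borel_measurable M"
proof -
  show "\<chi>0 \<in> borel_measurable M" and "1 - m \<le> j \<Longrightarrow> u j \<in> borel_measurable M"
    using inputs unfolding admissible_experiment_def by auto
  have "indep_vars (\<lambda>_. borel) w {2 - m..}"
    using B1 unfolding assumption_B1_def by (elim conjE)
  then show "2 - m \<le> j \<Longrightarrow> w j \<in> borel_measurable M" unfolding indep_vars_def by auto
qed

lemma history_measurable_from:
  assumes "\<chi>0 \<in> borel_measurable N" "\<And>j. 1 - m \<le> j \<Longrightarrow> j \<le> int i \<Longrightarrow> u j \<in> borel_measurable N"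
    "\<And>j. 2 - m \<le> j \<Longrightarrow> j \<le> int i \<Longrightarrow> w j \<in> borel_measurable N"
  shows "history i \<in> measurable N (history_space i)"
  by (intro measurable_Pair assms(1) measurable_restrict) (use assms(2,3) in auto)

lemma sets_past_subset:
  assumes "history i \<in> measurable N (history_space i)" "space N = space M"
  shows "sets (past i) \<subseteq> sets N"
  unfolding past_def using sets_image_in_sets[OF assms(2) assms(1)] .

text \<open>
  The history contains \<open>\<chi>0\<close> and the inputs besides the noise: inputs may be randomized, and the
  next noise is assumed independent of all of these jointly.
\<close>

sublocale driven_noise M past "\<lambda>i. w (int i)"
proof (unfold_locales)
  fix i j :: nat
  show "subalgebra M (past i)" unfolding subalgebra_def
    using sets_past_subset[OF history_measurable_from] primitives_measurable by simp
  show "sets (past i) \<subseteq> sets (past j)" if "i \<le> j"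
    by (intro sets_past_subset history_measurable_from history_components) (use that in auto)
  show "w (int (Suc i)) \<in> borel_measurable (past (Suc i))"
    by (rule history_components) (use m_ge_1 in auto)
  show "indep_set (sets (vimage_algebra (space M) (w (int (Suc i))) borel)) (sets (past i))"
  proof -
    have "\<forall>t\<ge>1. indep_set
        (sets (vimage_algebra (space M) (w t) borel))
        (sets (vimage_algebra (space M)
          (\<lambda>\<omega>. (\<chi>0 \<omega>, (\<lambda>i\<in>{1 - m..t - 1}. u i \<omega>), (\<lambda>i\<in>{2 - m..t - 1}. w i \<omega>)))
          (borel \<Otimes>\<^sub>M (Pi\<^sub>M {1 - m..t - 1} (\<lambda>_. borel) \<Otimes>\<^sub>M Pi\<^sub>M {2 - m..t - 1} (\<lambda>_. borel)))))"
      using B1 unfolding assumption_B1_def by (elim conjE)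
    from this[rule_format, of "int (Suc i)"] show ?thesis unfolding past_def by simp
  qed
  show "distr M borel (w (int (Suc i))) = distr M borel (w (int 1))"
  proof -
    have "\<forall>t\<ge>2 - m. distr M borel (w t) = distr M borel (w 1)"
      using B1 unfolding assumption_B1_def by (elim conjE)
    from this[rule_format, of "int (Suc i)"] show ?thesis using m_ge_1 by force
  qed
qed

lemma lag_less: "lag l < CARD('m)"
  using lag by (auto simp: bij_betw_def)

lemma lag_surj: "k < CARD('m) \<Longrightarrow> \<exists>l. lag l = k"
proof -
  assume "k < CARD('m)"
  then have "k \<in> lag ` UNIV" unfolding bij_betw_imp_surj_on[OF lag] by simp
  then show ?thesis by blast
qed

lemma continuous_f: "continuous_on UNIV (f x)"
proof -
  have "continuous_on UNIV (\<lambda>z. (\<lambda>(x, z). f x z) (x, z))"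
    by (rule continuous_on_compose2[OF f_cont]) (auto intro!: continuous_intros)
  then show ?thesis by simp
qed

lemma f_measurable: "f x \<in> borel_measurable borel"
  by (rule borel_measurable_continuous_onI[OF continuous_f])

text \<open>
  Outputs up to time \<open>1 - m\<close> are the components of \<open>\<chi>0\<close>; later ones follow by induction along the
  recursion. The lower end \<open>2 - 2 * m\<close> is the oldest output in the regressor at time \<open>1 - m\<close>.
\<close>

lemma output_measurable:
  assumes "2 - 2 * m \<le> s" "s \<le> int i"
  shows "y s \<in> borel_measurable (past i)"
proof -
  have "\<forall>s. 2 - 2 * m \<le> s \<and> s \<le> 1 - m + int k \<and> s \<le> int i \<longrightarrow> y s \<in> borel_measurable (past i)" for k
  proof (induction k)
    case 0
    show ?case
    proof (intro allI impI)
      fix s assume s: "2 - 2 * m \<le> s \<and> s \<le> 1 - m + int 0 \<and> s \<le> int i"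
      then have "nat (1 - m - s) < CARD('m)" unfolding m_def by linarith
      then obtain l where l: "lag l = nat (1 - m - s)" using lag_surj by blast
      have "(\<lambda>\<omega>. \<chi>0 \<omega> $ l) \<in> borel_measurable (past i)"
      proof -
        have "(\<lambda>\<omega>. \<chi>0 \<omega> \<bullet> axis l 1) \<in> borel_measurable (past i)"
          using history_components(1)[of i] by measurable
        then show ?thesis by (simp add: inner_axis)
      qed
      also have "?this \<longleftrightarrow> y s \<in> borel_measurable (past i)"
      proof (rule measurable_cong)
        fix \<omega> assume "\<omega> \<in> space (past i)"
        then have "\<chi>0 \<omega> = regressor lag (\<lambda>s. y s \<omega>) (1 - m)" using init by simp
        then show "\<chi>0 \<omega> $ l = y s \<omega>" using l s by (simp add: regressor_def)
      qed
      finally show "y s \<in> borel_measurable (past i)" .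
    qed
  next
    case (Suc k)
    show ?case
    proof (intro allI impI)
      fix s assume s: "2 - 2 * m \<le> s \<and> s \<le> 1 - m + int (Suc k) \<and> s \<le> int i"
      show "y s \<in> borel_measurable (past i)"
      proof (cases "s \<le> 1 - m + int k")
        case True
        then show ?thesis using Suc s by blast
      next
        case False
        then have s': "s = 1 - m + int (Suc k)" using s by linarith
        have "(\<lambda>\<omega>. regressor lag (\<lambda>s. y s \<omega>) (s - 1)) \<in> borel_measurable (past i)"
        proof (subst borel_measurable_euclidean_space, rule ballI)
          fix v :: "real ^ 'm" assume "v \<in> Basis"
          then obtain l where v: "v = axis l 1" by (auto simp: Basis_vec_def)
          have "y (s - 1 - int (lag l)) \<in> borel_measurable (past i)"
            using Suc[rule_format, of "s - 1 - int (lag l)"] s s' lag_less[of l] unfolding m_def by simp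
          then show "(\<lambda>\<omega>. regressor lag (\<lambda>s. y s \<omega>) (s - 1) \<bullet> v) \<in> borel_measurable (past i)"
            by (simp add: v inner_axis regressor_def)
        qed
        moreover have "u (s - 1) \<in> borel_measurable (past i)" "w s \<in> borel_measurable (past i)"
          using s s' by (auto intro!: history_components)
        ultimately have "(\<lambda>\<omega>. f \<theta> (regressor lag (\<lambda>s. y s \<omega>) (s - 1)) + u (s - 1) \<omega> + w s \<omega>)
             \<in> borel_measurable (past i)"
          using f_measurable[of \<theta>] by measurable
        also have "?this \<longleftrightarrow> y s \<in> borel_measurable (past i)"
          by (rule measurable_cong) (use closed_loop[rule_format, of _ "s - 1"] s' in auto)
        finally show ?thesis .
      qed
    qed
  qed
  from this[of "nat (s - (1 - m))"] show ?thesis using assms by auto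
qed

lemma regressor_measurable:
  assumes "1 - m \<le> t" "t \<le> int i"
  shows "(\<lambda>\<omega>. regressor lag (\<lambda>s. y s \<omega>) t) \<in> borel_measurable (past i)"
proof (subst borel_measurable_euclidean_space, rule ballI)
  fix v :: "real ^ 'm" assume "v \<in> Basis"
  then obtain l where v: "v = axis l 1" by (auto simp: Basis_vec_def)
  have "y (t - int (lag l)) \<in> borel_measurable (past i)"
    by (rule output_measurable) (use assms lag_less[of l] in \<open>auto simp: m_def\<close>)
  then show "(\<lambda>\<omega>. regressor lag (\<lambda>s. y s \<omega>) t \<bullet> v) \<in> borel_measurable (past i)"
    by (simp add: v inner_axis regressor_def)
qed

lemma \<phi>_measurable: "\<phi> i \<in> borel_measurable (past i)"
  unfolding \<phi>_def by (rule regressor_measurable) (use m_ge_1 in auto)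

lemma predictor_measurable: "predictor i \<in> borel_measurable (past i)"
proof -
  note [measurable] = f_measurable \<phi>_measurable
  have [measurable]: "u (int i) \<in> borel_measurable (past i)"
    by (rule history_components) (use m_ge_1 in auto)
  show ?thesis unfolding predictor_def by measurable
qed

lemma noise_law:
  shows "Cw < \<infinity> \<Longrightarrow> AE \<omega> in M. ennreal \<bar>w 1 \<omega>\<bar> \<le> Cw"
    and "Cw < \<infinity> \<Longrightarrow> 0 < \<delta> \<Longrightarrow> 0 < (INF z\<in>{z. ennreal \<bar>z\<bar> \<le> Cw}. prob {\<omega>\<in>space M. w 1 \<omega> \<in> ball z \<delta>})"
    and "Cw = \<infinity> \<Longrightarrow> 0 < \<delta> \<Longrightarrow> 0 < c \<Longrightarrow> 0 < (INF z\<in>{- c..c}. prob {\<omega>\<in>space M. w 1 \<omega> \<in> ball z \<delta>})"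
  by (use B1 in \<open>unfold assumption_B1_def, elim conjE, simp\<close>)+

lemma noise_charges:
  assumes z: "ennreal \<bar>z\<bar> \<le> Cw" and \<delta>: "0 < \<delta>"
  shows "0 < prob {\<omega>\<in>space M. w (int 1) \<omega> \<in> ball z \<delta>}"
proof -
  have lower: "(INF z\<in>Z. prob {\<omega>\<in>space M. w 1 \<omega> \<in> ball z \<delta>}) \<le> prob {\<omega>\<in>space M. w 1 \<omega> \<in> ball z \<delta>}"
    if "z \<in> Z" for Z
    by (rule cINF_lower) (use that in \<open>auto intro!: bdd_belowI[of _ 0]\<close>)
  have "0 < prob {\<omega>\<in>space M. w 1 \<omega> \<in> ball z \<delta>}"
  proof (cases "Cw < \<infinity>")
    case True
    show ?thesis by (rule less_le_trans[OF noise_law(2)[OF True \<delta>] lower]) (use z in simp)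
  next
    case False
    then have Cw: "Cw = \<infinity>" by (simp add: less_top[symmetric])
    show ?thesis by (rule less_le_trans[OF noise_law(3)[OF Cw \<delta>, of "\<bar>z\<bar> + 1"] lower]) auto
  qed
  then show ?thesis by simp
qed

text \<open>
  \<open>A\<close> held \<open>j\<close> steps ago, and since then each output has come within \<open>\<delta>\<close> of its target set, \<open>E 0\<close> being
  the target of the first step. At times \<open>i < j\<close> the truncated subtraction makes this
  meaningless; it is used with an \<open>A\<close> that fails at time 0, which excludes them.
\<close>

primrec steered :: "(nat \<Rightarrow> real set) \<Rightarrow> real \<Rightarrow> (nat \<Rightarrow> 'a \<Rightarrow> bool) \<Rightarrow> nat \<Rightarrow> nat \<Rightarrow> 'a \<Rightarrow> bool" where
  "steered E \<delta> A 0 i \<omega> = A i \<omega>"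
| "steered E \<delta> A (Suc j) i \<omega> = (steered E \<delta> A j (i - 1) \<omega> \<and> (\<exists>e\<in>E j. \<bar>y (int i) \<omega> - e\<bar> < \<delta>))"

lemma steered_iff:
  "steered E \<delta> A J i \<omega> \<longleftrightarrow>
     A (i - J) \<omega> \<and> (\<forall>j<J. \<exists>e\<in>E j. \<bar>y (int (i - (J - 1 - j))) \<omega> - e\<bar> < \<delta>)"
proof (induction J arbitrary: i)
  case (Suc J)
  have "i - 1 - (J - 1 - j) = i - (Suc J - 1 - j)" if "j < J" for j using that by auto
  then show ?case using Suc[of "i - 1"] by (auto simp: less_Suc_eq)
qed simp

lemma steered_measurable:
  assumes "\<And>i. Measurable.pred (past i) (A i)"
  shows "Measurable.pred (past i) (steered E \<delta> A j i)"
proof (induction j arbitrary: i)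
  case 0
  then show ?case using assms by simp
next
  case (Suc j)
  have [measurable]: "Measurable.pred (past i) (steered E \<delta> A j (i - 1))"
    using measurable_later[OF _ Suc[of "i - 1"]] by simp
  have [measurable]: "y (int i) \<in> borel_measurable (past i)"
    by (rule output_measurable) (use m_ge_1 in auto)
  have [measurable]: "(\<Union>e\<in>E j. ball e \<delta>) \<in> sets borel" by (intro borel_open open_UN) auto
  have "Measurable.pred (past i) (\<lambda>\<omega>. steered E \<delta> A j (i - 1) \<omega> \<and> y (int i) \<omega> \<in> (\<Union>e\<in>E j. ball e \<delta>))"
    by measurable
  also have "(\<lambda>\<omega>. steered E \<delta> A j (i - 1) \<omega> \<and> y (int i) \<omega> \<in> (\<Union>e\<in>E j. ball e \<delta>)) = steered E \<delta> A (Suc j) i"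
    by (auto simp: fun_eq_iff dist_real_def abs_minus_commute)
  finally show ?case .
qed

text \<open>
  Iteration of \<open>steering_step\<close>. The bound \<open>S\<close> may depend on the step, as it does when the regressor is
  known to be bounded only through the earlier targets.
\<close>

theorem steered_frequency:
  assumes A: "\<And>i. Measurable.pred (past i) (A i)" and \<delta>: "0 < \<delta>"
    and reach: "\<And>j. j < J \<Longrightarrow> \<exists>S. (AE \<omega> in M. \<forall>i\<ge>1. steered E \<delta> A j i \<omega> \<longrightarrow> \<bar>predictor i \<omega>\<bar> \<le> S)
        \<and> (\<forall>z. \<bar>z\<bar> \<le> S \<longrightarrow> (\<exists>e\<in>E j. ennreal \<bar>e - z\<bar> \<le> Cw))"
  shows "AE \<omega> in M. positive_frequency (\<lambda>i. A i \<omega>) \<longrightarrow> positive_frequency (\<lambda>i. steered E \<delta> A J i \<omega>)"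
  using reach
proof (induction J)
  case 0
  then show ?case by simp
next
  case (Suc J)
  obtain S where S: "AE \<omega> in M. \<forall>i\<ge>1. steered E \<delta> A J i \<omega> \<longrightarrow> \<bar>predictor i \<omega>\<bar> \<le> S"
    "\<And>z. \<bar>z\<bar> \<le> S \<Longrightarrow> \<exists>e\<in>E J. ennreal \<bar>e - z\<bar> \<le> Cw"
    using Suc.prems[of J] by auto
  have "AE \<omega> in M. positive_frequency (\<lambda>i. A i \<omega>) \<longrightarrow> positive_frequency (\<lambda>i. steered E \<delta> A J i \<omega>)"
    using Suc by simp
  moreover have "AE \<omega> in M. positive_frequency (\<lambda>i. steered E \<delta> A J i \<omega>) \<longrightarrow>
     positive_frequency (\<lambda>i. steered E \<delta> A J i \<omega> \<and> (\<exists>e\<in>E J. \<bar>predictor i \<omega> + w (int (Suc i)) \<omega> - e\<bar> < \<delta>))"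
  proof (rule steering_step[OF predictor_measurable steered_measurable[OF A] S(1) _ \<delta>])
    fix z assume "\<bar>z\<bar> \<le> S"
    then show "\<exists>e\<in>E J. \<forall>\<delta>>0. 0 < prob {\<omega> \<in> space M. w (int 1) \<omega> \<in> ball (e - z) \<delta>}"
      using S(2) noise_charges by blast
  qed
  moreover have "AE \<omega> in M. \<omega> \<in> space M" by simp
  ultimately show ?case
  proof eventually_elim
    case (elim \<omega>)
    show ?case
    proof
      assume "positive_frequency (\<lambda>i. A i \<omega>)"
      then have "positive_frequency (\<lambda>i. steered E \<delta> A J i \<omega> \<and> (\<exists>e\<in>E J. \<bar>predictor i \<omega> + w (int (Suc i)) \<omega> - e\<bar> < \<delta>))"
        using elim by blast
      from positive_frequency_shift[OF this]
      show "positive_frequency (\<lambda>i. steered E \<delta> A (Suc J) i \<omega>)"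
      proof (rule positive_frequency_mono)
        fix i :: nat
        assume "1 \<le> i" and *: "steered E \<delta> A J (i - 1) \<omega> \<and>
          (\<exists>e\<in>E J. \<bar>predictor (i - 1) \<omega> + w (int (Suc (i - 1))) \<omega> - e\<bar> < \<delta>)"
        then have "y (int i) \<omega> = predictor (i - 1) \<omega> + w (int (Suc (i - 1))) \<omega>"
          using output_step[OF elim(3), of "i - 1"] by simp
        then show "steered E \<delta> A (Suc J) i \<omega>" using * by simp
      qed
    qed
  qed
qed

end

section \<open>Targets within reach of the noise, and recurrence\<close>

text \<open>
  A density above \<open>1 / Cw\<close> says that the distances from the points of \<open>Z\<close> to \<open>E\<close> have a supremum
  below \<open>Cw\<close>.
\<close>

lemma lower_density_reach:
  assumes "1 / Cw < lower_density E Z" and "z \<in> Z"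
  shows "\<exists>e\<in>E. ennreal \<bar>e - z\<bar> < Cw"
proof -
  define S where "S = (SUP z\<in>Z. Inf (ennreal ` {d. 0 < d \<and> ball z d \<inter> E \<noteq> {}}))"
  have "S < Cw"
  proof (rule ccontr)
    assume "\<not> S < Cw"
    then have le: "Cw \<le> S" by simp
    have "1 / S \<le> 1 / Cw"
    proof (cases "S = top \<or> Cw = 0")
      case False
      then obtain s c where "S = ennreal s" "Cw = ennreal c" "0 \<le> s" "0 < c"
        using le by (cases S; cases Cw) (auto simp: less_eq_real_def top_unique)
      moreover from this have "c \<le> s" using le by (simp add: ennreal_le_iff)
      ultimately show ?thesis
        using divide_ennreal[of 1 s] divide_ennreal[of 1 c] by (simp add: ennreal_leI frac_le)
    qed auto
    then show False using assms(1) unfolding lower_density_def S_def[symmetric] by simp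
  qed
  moreover have "Inf (ennreal ` {d. 0 < d \<and> ball z d \<inter> E \<noteq> {}}) \<le> S"
    unfolding S_def using assms(2) by (rule SUP_upper)
  ultimately have "Inf (ennreal ` {d. 0 < d \<and> ball z d \<inter> E \<noteq> {}}) < Cw" by simp
  then obtain d e where d: "0 < d" "ennreal d < Cw" "e \<in> ball z d" "e \<in> E"
    unfolding Inf_less_iff by blast
  then have "ennreal \<bar>e - z\<bar> \<le> ennreal d" by (intro ennreal_leI) (simp add: dist_real_def abs_minus_commute)
  also note d(2)
  finally show ?thesis using d(4) by blast
qed

text \<open>
  The strict inequality in \<open>lower_density_reach\<close> turns the points of \<open>E\<close> into an open cover of a compact interval.
\<close>

lemma lower_density_finite_reach:
  assumes d: "1 / Cw < lower_density E {-S..S}" and Cw: "Cw < \<infinity>"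
  shows "\<exists>E'\<subseteq>E. finite E' \<and> (\<forall>z. \<bar>z\<bar> \<le> S \<longrightarrow> (\<exists>e\<in>E'. ennreal \<bar>e - z\<bar> \<le> Cw))"
proof -
  define c where "c = enn2real Cw"
  have c: "Cw = ennreal c" "0 \<le> c" using Cw by (auto simp: c_def)
  have near: "ennreal \<bar>e - z\<bar> < Cw \<longleftrightarrow> z \<in> ball e c" for e z
    using c by (auto simp: ennreal_less_iff dist_real_def)
  have "{-S..S} \<subseteq> (\<Union>e\<in>E. ball e c)"
    using lower_density_reach[OF d] near by auto
  then obtain E' where E': "E' \<subseteq> E" "finite E'" "{-S..S} \<subseteq> (\<Union>e\<in>E'. ball e c)"
    using compactE_image[of "{-S..S}" E "\<lambda>e. ball e c"] by auto
  have "\<exists>e\<in>E'. ennreal \<bar>e - z\<bar> \<le> Cw" if "\<bar>z\<bar> \<le> S" for z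
  proof -
    have "z \<in> {-S..S}" using that by auto
    then obtain e where "e \<in> E'" "z \<in> ball e c" using E'(3) by blast
    then show ?thesis using near[of e z] by (auto intro: less_imp_le)
  qed
  with E' show ?thesis by blast
qed

lemma lower_density_prod_finite_reach:
  assumes d: "1 / Cw < lower_density_prod N P (\<lambda>_. {-S..S})" and Cw: "Cw < \<infinity>" and N: "0 < N"
  shows "\<exists>E. (\<Pi>\<^sub>E j\<in>{..<N}. E j) \<subseteq> P \<and> (\<forall>j<N. finite (E j) \<and>
     (\<forall>z. \<bar>z\<bar> \<le> S \<longrightarrow> (\<exists>e\<in>E j. ennreal \<bar>e - z\<bar> \<le> Cw)))"
proof -
  obtain E where E: "(\<Pi>\<^sub>E j\<in>{..<N}. E j) \<subseteq> P"
    "1 / Cw < Min ((\<lambda>j. lower_density (E j) {-S..S}) ` {..<N})"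
    using d unfolding lower_density_prod_def less_Sup_iff by blast
  have "1 / Cw < lower_density (E j) {-S..S}" if "j < N" for j
    using E(2) that N by (subst (asm) Min_gr_iff) auto
  then have "\<forall>j<N. \<exists>E'\<subseteq>E j. finite E' \<and> (\<forall>z. \<bar>z\<bar> \<le> S \<longrightarrow> (\<exists>e\<in>E'. ennreal \<bar>e - z\<bar> \<le> Cw))"
    using lower_density_finite_reach[OF _ Cw] by blast
  then obtain E' where E': "\<forall>j<N. E' j \<subseteq> E j \<and> finite (E' j) \<and>
      (\<forall>z. \<bar>z\<bar> \<le> S \<longrightarrow> (\<exists>e\<in>E' j. ennreal \<bar>e - z\<bar> \<le> Cw))"
    by metis
  have "(\<Pi>\<^sub>E j\<in>{..<N}. E' j) \<subseteq> (\<Pi>\<^sub>E j\<in>{..<N}. E j)" by (rule PiE_mono) (use E' in auto)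
  with E(1) E' show ?thesis by (intro exI[of _ E']) auto
qed

lemma visits_ball_positive_frequency:
  assumes "visits_ball lag C y"
  shows "positive_frequency (\<lambda>i. ennreal (norm (regressor lag y (int i))) \<le> C)"
proof -
  define P where "P i \<longleftrightarrow> ennreal (norm (regressor lag y (int i))) \<le> C" for i
  obtain c where c: "0 < ereal c" "ereal c < liminf (\<lambda>t. ereal (real (card {i\<in>{1..t}. P i}) / real t))"
    using assms ereal_dense2 unfolding visits_ball_def P_def by blast
  obtain T :: nat where T: "2 / c \<le> real T" using real_arch_simple by blast
  from less_LiminfD[OF c(2)] eventually_ge_at_top[of T] eventually_gt_at_top[of 0]
  have "\<forall>\<^sub>F t in sequentially. c / 2 * real t \<le> (\<Sum>i=1..<t. of_bool (P i))"
  proof eventually_elim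
    case (elim t)
    have "2 / c \<le> real t" using elim T by linarith
    then have 1: "1 \<le> c / 2 * real t" using c by (simp add: field_simps)
    have "card {i\<in>{1..t}. P i} \<le> card (insert t {i\<in>{1..<t}. P i})" by (rule card_mono) auto
    also have "\<dots> \<le> card {i\<in>{1..<t}. P i} + 1" by (simp add: card_insert_if)
    finally have "real (card {i\<in>{1..t}. P i}) \<le> real (card {i\<in>{1..<t}. P i}) + 1" by linarith
    moreover have "c * real t < real (card {i\<in>{1..t}. P i})" using elim by (simp add: field_simps)
    moreover have "(\<Sum>i=1..<t. of_bool (P i)) = real (card {i\<in>{1..<t}. P i})"
      by (simp add: of_bool_def sum.If_cases Int_def)
    ultimately show ?case using 1 by linarith
  qed
  moreover have "0 < c / 2" using c by simp
  ultimately show ?thesis unfolding positive_frequency_def P_def by blast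
qed

lemma norm_regressor_squared:
  fixes lag :: "'m::finite \<Rightarrow> nat"
  assumes "bij_betw lag UNIV {0..<CARD('m)}"
  shows "(norm (regressor lag y t))\<^sup>2 = (\<Sum>k<CARD('m). (y (t - int k))\<^sup>2)"
proof -
  have "(norm (regressor lag y t))\<^sup>2 = (\<Sum>l\<in>UNIV. (y (t - int (lag l)))\<^sup>2)"
    unfolding norm_vec_def L2_set_def by (simp add: sum_nonneg regressor_def)
  also have "\<dots> = (\<Sum>k\<in>{0..<CARD('m)}. (y (t - int k))\<^sup>2)"
    by (rule sum.reindex_bij_betw[OF assms, of "\<lambda>k. (y (t - int k))\<^sup>2"])
  finally show ?thesis by (simp add: atLeast0LessThan)
qed

text \<open>
  The squared norm of the regressor is a sum of \<open>m\<close> squared outputs, so its time average is bounded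
  on a stable path. By Markov's inequality for the time average, it exceeds a large \<open>R\<^sup>2\<close> during at
  most a quarter of the time.
\<close>

lemma stable_path_recurrent:
  fixes lag :: "'m::finite \<Rightarrow> nat"
  assumes lag: "bij_betw lag UNIV {0..<CARD('m)}" and st: "stable_path y"
  shows "\<exists>R::nat. positive_frequency (\<lambda>i. norm (regressor lag y (int i)) \<le> real R)"
proof -
  define m where "m = CARD('m)"
  have m0: "0 < m" by (simp add: m_def)
  obtain K0 where K0: "\<And>t. 1 \<le> t \<Longrightarrow> (\<Sum>i=1..t. (y (int i))\<^sup>2) / real t \<le> K0"
    using st unfolding stable_path_def bdd_above_def by auto
  define K where "K = max K0 0"
  have K: "(\<Sum>i=1..t. (y (int i))\<^sup>2) \<le> K * real t" if "1 \<le> t" for t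
  proof -
    have "(\<Sum>i=1..t. (y (int i))\<^sup>2) \<le> K0 * real t" using K0[OF that] that by (simp add: divide_le_eq)
    also have "\<dots> \<le> K * real t" by (rule mult_right_mono) (auto simp: K_def)
    finally show ?thesis .
  qed
  define Q where "Q = (\<Sum>j\<in>{-int m..0}. (y j)\<^sup>2)"
  have shifted: "(\<Sum>i=1..<t. (y (int i - int k))\<^sup>2) \<le> Q + K * real t" if k: "k < m" and t: "1 \<le> t" for k t
  proof -
    have "(\<Sum>i=1..<t. (y (int i - int k))\<^sup>2) = (\<Sum>j\<in>(\<lambda>i. int i - int k) ` {1..<t}. (y j)\<^sup>2)"
      by (subst sum.reindex) (auto simp: inj_on_def)
    also have "\<dots> \<le> (\<Sum>j\<in>{-int m..0} \<union> int ` {1..t}. (y j)\<^sup>2)"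
    proof (rule sum_mono2)
      show "(\<lambda>i. int i - int k) ` {1..<t} \<subseteq> {-int m..0} \<union> int ` {1..t}"
      proof
        fix j assume "j \<in> (\<lambda>i. int i - int k) ` {1..<t}"
        then obtain i where i: "j = int i - int k" "1 \<le> i" "i < t" by auto
        show "j \<in> {-int m..0} \<union> int ` {1..t}"
        proof (cases "j \<le> 0")
          case False
          then have "j = int (i - k)" "i - k \<in> {1..t}" using i by auto
          then show ?thesis by blast
        qed (use i k in auto)
      qed
    qed auto
    also have "\<dots> = Q + (\<Sum>i=1..t. (y (int i))\<^sup>2)"
      unfolding Q_def by (subst sum.union_disjoint) (auto simp: sum.reindex)
    finally show ?thesis using K[OF t] by linarith
  qed
  obtain R :: nat where R: "4 * real m * (1 + K) + 1 \<le> real R" using real_arch_simple by blast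
  have R1: "1 \<le> real R" using R m0 by (smt (verit) K_def max_def mult_nonneg_nonneg of_nat_0_le_iff)
  have R2: "4 * real m * (1 + K) \<le> (real R)\<^sup>2"
  proof -
    have "real R \<le> (real R)\<^sup>2" using R1 by (simp add: power2_eq_square)
    then show ?thesis using R by linarith
  qed
  define P where "P i \<longleftrightarrow> norm (regressor lag y (int i)) \<le> real R" for i
  obtain T :: nat where T: "Q \<le> real T" using real_arch_simple by blast
  have "\<forall>\<^sub>F t in sequentially. 1/2 * real t \<le> (\<Sum>i=1..<t. of_bool (P i))"
    using eventually_ge_at_top[of T] eventually_ge_at_top[of 4]
  proof eventually_elim
    case (elim t)
    have bad: "(real R)\<^sup>2 * of_bool (\<not> P i) \<le> (norm (regressor lag y (int i)))\<^sup>2" for i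
      by (cases "P i") (auto simp: P_def intro: power_mono)
    have "(real R)\<^sup>2 * (\<Sum>i=1..<t. of_bool (\<not> P i)) \<le> (\<Sum>i=1..<t. (norm (regressor lag y (int i)))\<^sup>2)"
      unfolding sum_distrib_left by (rule sum_mono) (rule bad)
    also have "\<dots> = (\<Sum>k<m. \<Sum>i=1..<t. (y (int i - int k))\<^sup>2)"
      unfolding norm_regressor_squared[OF lag] m_def by (rule sum.swap)
    also have "\<dots> \<le> (\<Sum>k<m. Q + K * real t)"
      by (rule sum_mono) (use shifted elim in auto)
    also have "\<dots> = real m * (Q + K * real t)" by simp
    also have "\<dots> \<le> real m * (real t + K * real t)"
      using T elim by (intro mult_left_mono) auto
    also have "\<dots> = (4 * real m * (1 + K)) * (real t / 4)" by (simp add: algebra_simps)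
    also have "\<dots> \<le> (real R)\<^sup>2 * (real t / 4)" using R2 by (rule mult_right_mono) simp
    finally have "(\<Sum>i=1..<t. of_bool (\<not> P i)) \<le> real t / 4"
      using R1 by (subst (asm) mult_le_cancel_left_pos) auto
    moreover have "(\<Sum>i=1..<t. of_bool (\<not> P i)) + (\<Sum>i=1..<t. of_bool (P i)) = (\<Sum>i=1..<t. 1::real)"
      unfolding sum.distrib[symmetric] by (rule sum.cong) auto
    moreover have "(\<Sum>i=1..<t. 1::real) = real t - 1" using elim by simp
    ultimately show ?case using elim(2) by linarith
  qed
  then have "positive_frequency P" unfolding positive_frequency_def by (intro exI[of _ "1/2"]) simp
  then show ?thesis unfolding P_def by blast
qed

context closed_loop_system begin

section \<open>Persistent excitation\<close>

definition \<Delta> :: "real ^ 'n \<Rightarrow> nat \<Rightarrow> 'a \<Rightarrow> real" where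
  "\<Delta> x i \<omega> = f x (\<phi> i \<omega>) - f \<theta> (\<phi> i \<omega>)"

abbreviation act :: "ennreal \<Rightarrow> real \<Rightarrow> nat \<Rightarrow> 'a \<Rightarrow> bool" where
  "act C \<gamma> i \<omega> \<equiv> active lag Cw C \<gamma> (\<lambda>s. y s \<omega>) (int i)"

text \<open>
  For unbounded noise the bound on the regressor is part of \<open>active\<close>. For bounded noise it holds
  automatically from time \<open>m + 1\<close> on; including it makes the weights of the noise sums bounded from the
  start.
\<close>

definition used :: "ennreal \<Rightarrow> real \<Rightarrow> nat \<Rightarrow> 'a \<Rightarrow> bool" where
  "used C \<gamma> i \<omega> \<longleftrightarrow> act C \<gamma> i \<omega> \<and> norm (\<phi> i \<omega>) \<le> \<gamma>"

definition exciting :: "ennreal \<Rightarrow> real \<Rightarrow> 'a \<Rightarrow> bool" where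
  "exciting C \<gamma> \<omega> \<longleftrightarrow> (\<exists>c>0. \<forall>\<^sub>F t in sequentially. \<forall>x\<in>cbox a b.
     c * real t * (norm (x - \<theta>))\<^sup>2 \<le> (\<Sum>i=1..<t. (\<Delta> x i \<omega>)\<^sup>2 * of_bool (used C \<gamma> i \<omega>)))"

lemma mean_value:
  assumes "x \<in> cbox a b" "x' \<in> cbox a b"
  shows "\<exists>\<xi>\<in>cbox a b. f x z - f x' z = Df \<xi> z \<bullet> (x - x')"
proof -
  define g where "g s = f (x' + s *\<^sub>R (x - x')) z" for s
  have "\<exists>s\<in>{0..1}. g 1 - g 0 = (\<lambda>h. (h *\<^sub>R (x - x')) \<bullet> Df (x' + s *\<^sub>R (x - x')) z) (1 - 0)"
  proof (rule mvt_very_simple)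
    fix s :: real
    have 1: "((\<lambda>s. x' + s *\<^sub>R (x - x')) has_derivative (\<lambda>h. h *\<^sub>R (x - x'))) (at s within {0..1})"
      by (auto intro!: derivative_eq_intros)
    have 2: "((\<lambda>x. f x z) has_derivative (\<lambda>h. h \<bullet> Df (x' + s *\<^sub>R (x - x')) z)) (at (x' + s *\<^sub>R (x - x')))"
      using f_deriv unfolding gderiv_def by blast
    show "(g has_derivative (\<lambda>h. (h *\<^sub>R (x - x')) \<bullet> Df (x' + s *\<^sub>R (x - x')) z)) (at s within {0..1})"
      unfolding g_def using has_derivative_compose[OF 1 2] by simp
  qed simp
  then obtain s where s: "s \<in> {0..1}" "g 1 - g 0 = (x - x') \<bullet> Df (x' + s *\<^sub>R (x - x')) z" by auto
  have "x' + s *\<^sub>R (x - x') = (1 - s) *\<^sub>R x' + s *\<^sub>R x" by (simp add: algebra_simps)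
  also have "\<dots> \<in> cbox a b" using s assms by (intro convexD[OF convex_box(1)]) auto
  finally show ?thesis using s(2) by (intro bexI[of _ "x' + s *\<^sub>R (x - x')"]) (auto simp: g_def inner_commute)
qed

text \<open>
  Let \<open>h = x - \<theta>\<close>. If for every block there were a visit with \<open>\<bar>\<Delta> x i\<bar> < c * norm h\<close>, then one such
  visit per block, together with the intermediate points of the mean value theorem, would contradict
  \<open>identifies\<close>. So there is a block all of whose visits contribute at least \<open>(c * norm h)\<^sup>2\<close>, and
  these visits have positive frequency. Which block it is may depend on \<open>x\<close> and \<open>t\<close>.
\<close>

lemma exciting_if_blocks_visited:
  fixes E :: "nat \<Rightarrow> real set"
  defines "q \<equiv> 2 ^ (CARD('n) - 1) :: nat"
  assumes c: "0 < c" and unif: "identifies Df lag (cbox a b) E c \<delta>"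
    and visits: "\<And>b'. b' < q \<Longrightarrow> positive_frequency
       (\<lambda>i. used C \<gamma> i \<omega> \<and> (\<forall>l. \<exists>e\<in>E (b' * CARD('m) + lag l). \<bar>\<phi> i \<omega> $ l - e\<bar> < \<delta>))"
  shows "exciting C \<gamma> \<omega>"
proof -
  define U where "U b' i \<longleftrightarrow> used C \<gamma> i \<omega> \<and> (\<forall>l. \<exists>e\<in>E (b' * CARD('m) + lag l). \<bar>\<phi> i \<omega> $ l - e\<bar> < \<delta>)" for b' i
  have q0: "0 < q" by (simp add: q_def)
  have "\<forall>b'<q. \<exists>r>0. \<forall>\<^sub>F t in sequentially. r * real t \<le> (\<Sum>i=1..<t. of_bool (U b' i))"
    using visits unfolding positive_frequency_def U_def by blast
  then obtain r where r: "\<And>b'. b' < q \<Longrightarrow> 0 < r b'"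
     "\<And>b'. b' < q \<Longrightarrow> \<forall>\<^sub>F t in sequentially. r b' * real t \<le> (\<Sum>i=1..<t. of_bool (U b' i))"
    by metis
  define r0 where "r0 = Min (r ` {..<q})"
  have r0: "0 < r0" "\<And>b'. b' < q \<Longrightarrow> r0 \<le> r b'" using q0 r(1) by (auto simp: r0_def lessThan_empty_iff)
  have "\<forall>\<^sub>F t in sequentially. \<forall>b'\<in>{..<q}. r b' * real t \<le> (\<Sum>i=1..<t. of_bool (U b' i))"
    using r(2) by (simp add: eventually_ball_finite)
  then have "\<forall>\<^sub>F t in sequentially. \<forall>x\<in>cbox a b.
     (c\<^sup>2 * r0) * real t * (norm (x - \<theta>))\<^sup>2 \<le> (\<Sum>i=1..<t. (\<Delta> x i \<omega>)\<^sup>2 * of_bool (used C \<gamma> i \<omega>))"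
  proof eventually_elim
    case (elim t)
    show ?case
    proof
      fix x assume x: "x \<in> cbox a b"
      have "\<exists>b'<q. \<forall>i\<in>{1..<t}. U b' i \<longrightarrow> c * norm (x - \<theta>) \<le> \<bar>\<Delta> x i \<omega>\<bar>"
      proof (rule ccontr)
        assume "\<not> ?thesis"
        then have "\<forall>b'<q. \<exists>i. U b' i \<and> \<bar>\<Delta> x i \<omega>\<bar> < c * norm (x - \<theta>)" by (auto simp: not_le)
        then obtain i where i: "\<And>b'. b' < q \<Longrightarrow> U b' (i b') \<and> \<bar>\<Delta> x (i b') \<omega>\<bar> < c * norm (x - \<theta>)" by metis
        obtain X where X: "\<And>b'. X b' \<in> cbox a b"
            "\<And>b'. f x (\<phi> (i b') \<omega>) - f \<theta> (\<phi> (i b') \<omega>) = Df (X b') (\<phi> (i b') \<omega>) \<bullet> (x - \<theta>)"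
        proof -
          have "\<forall>b'. \<exists>\<xi>. \<xi> \<in> cbox a b \<and> f x (\<phi> (i b') \<omega>) - f \<theta> (\<phi> (i b') \<omega>) = Df \<xi> (\<phi> (i b') \<omega>) \<bullet> (x - \<theta>)"
            using mean_value[OF x theta] by blast
          then show ?thesis using that by (auto dest!: choice)
        qed
        obtain b' where "b' < q" "c * norm (x - \<theta>) \<le> \<bar>Df (X b') (\<phi> (i b') \<omega>) \<bullet> (x - \<theta>)\<bar>"
          using unif[unfolded identifies_def, rule_format, of X "\<lambda>b'. \<phi> (i b') \<omega>" "x - \<theta>"] X(1) i
          unfolding U_def q_def by auto
        then show False using i[of b'] X(2)[of b'] unfolding \<Delta>_def by simp
      qed
      then obtain b' where b': "b' < q" "\<And>i. i \<in> {1..<t} \<Longrightarrow> U b' i \<Longrightarrow> c * norm (x - \<theta>) \<le> \<bar>\<Delta> x i \<omega>\<bar>"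
        by blast
      have "(c\<^sup>2 * r0) * real t * (norm (x - \<theta>))\<^sup>2 = (c * norm (x - \<theta>))\<^sup>2 * (r0 * real t)"
        by (simp add: power_mult_distrib mult_ac)
      also have "\<dots> \<le> (c * norm (x - \<theta>))\<^sup>2 * (\<Sum>i=1..<t. of_bool (U b' i))"
      proof (rule mult_left_mono)
        have "r0 * real t \<le> r b' * real t" using r0(2)[OF b'(1)] by (rule mult_right_mono) simp
        then show "r0 * real t \<le> (\<Sum>i=1..<t. of_bool (U b' i))" using elim b'(1) by force
      qed simp
      also have "\<dots> = (\<Sum>i=1..<t. (c * norm (x - \<theta>))\<^sup>2 * of_bool (U b' i))" by (rule sum_distrib_left)
      also have "\<dots> \<le> (\<Sum>i=1..<t. (\<Delta> x i \<omega>)\<^sup>2 * of_bool (used C \<gamma> i \<omega>))"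
      proof (rule sum_mono)
        fix i assume i: "i \<in> {1..<t}"
        show "(c * norm (x - \<theta>))\<^sup>2 * of_bool (U b' i) \<le> (\<Delta> x i \<omega>)\<^sup>2 * of_bool (used C \<gamma> i \<omega>)"
        proof (cases "U b' i")
          case True
          have "(c * norm (x - \<theta>))\<^sup>2 \<le> \<bar>\<Delta> x i \<omega>\<bar>\<^sup>2"
            by (rule power_mono[OF b'(2)[OF i True]]) (use c in simp)
          then show ?thesis using True by (simp add: U_def)
        qed auto
      qed
      finally show "(c\<^sup>2 * r0) * real t * (norm (x - \<theta>))\<^sup>2 \<le> (\<Sum>i=1..<t. (\<Delta> x i \<omega>)\<^sup>2 * of_bool (used C \<gamma> i \<omega>))" .
    qed
  qed
  moreover have "0 < c\<^sup>2 * r0" using c r0 by simp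
  ultimately show ?thesis unfolding exciting_def by blast
qed

lemma norm_\<phi>_le:
  assumes "\<And>k. k < CARD('m) \<Longrightarrow> \<bar>y (int i - int k) \<omega>\<bar> \<le> B"
  shows "norm (\<phi> i \<omega>) \<le> real CARD('m) * B"
proof -
  have "norm (\<phi> i \<omega>) \<le> (\<Sum>l\<in>UNIV. \<bar>\<phi> i \<omega> $ l\<bar>)" by (rule norm_le_l1_cart)
  also have "\<dots> \<le> (\<Sum>l\<in>(UNIV::'m set). B)"
    using assms lag_less by (intro sum_mono) (simp add: \<phi>_def regressor_def)
  finally show ?thesis by simp
qed

lemma active_iff:
  assumes "CARD('m) < i"
  shows "act C \<gamma> i \<omega> \<longleftrightarrow>
    ennreal (norm (\<phi> (i - CARD('m)) \<omega>)) \<le> C \<and> (Cw = \<infinity> \<longrightarrow> norm (\<phi> i \<omega>) \<le> \<gamma>)"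
  using assms unfolding active_def \<phi>_def by (simp add: of_nat_diff)

lemma noise_bounded:
  assumes "Cw < \<infinity>"
  shows "AE \<omega> in M. \<forall>i. \<bar>w (int (Suc i)) \<omega>\<bar> \<le> enn2real Cw"
proof -
  have c: "ennreal \<bar>z\<bar> \<le> Cw \<longleftrightarrow> \<bar>z\<bar> \<le> enn2real Cw" for z
    using assms by (cases Cw) auto
  have 1: "AE \<omega> in M. \<bar>w (int 1) \<omega>\<bar> \<le> enn2real Cw" using noise_law(1)[OF assms] c by simp
  have "AE \<omega> in M. \<bar>w (int (Suc i)) \<omega>\<bar> \<le> enn2real Cw" for i
  proof -
    have "(AE z in distr M borel (w (int 1)). \<bar>z\<bar> \<le> enn2real Cw)"
      using 1 measurable_w1 by (subst AE_distr_iff) auto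
    then have "(AE z in distr M borel (w (int (Suc i))). \<bar>z\<bar> \<le> enn2real Cw)"
      by (simp only: ident)
    then show ?thesis by (subst (asm) AE_distr_iff) (use measurable_w[of i] in auto)
  qed
  then show ?thesis by (simp add: AE_all_countable)
qed

lemma box_compact: "compact (cbox a b)" and box_nonempty: "cbox a b \<noteq> {}"
  using theta by auto

lemma norm_\<phi>_measurable: "Measurable.pred (past i) (\<lambda>\<omega>. P (norm (\<phi> i \<omega>)))"
  if "{r. P r} \<in> sets borel"
proof -
  note [measurable] = \<phi>_measurable that
  have "Measurable.pred (past i) (\<lambda>\<omega>. norm (\<phi> i \<omega>) \<in> {r. P r})" by measurable
  then show ?thesis by simp
qed

text \<open>
  Starting from a regressor of norm at most \<open>C\<close>, the next \<open>m\<close> predictable parts lie in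
  \<open>[-C0, C0]\<close>, from where some target is in range of the noise at each step. After \<open>m\<close> steps
  the whole regressor consists of targeted outputs. The same interval and the bound on the noise
  determine how large \<open>\<gamma>\<close> must be.
\<close>

theorem excitation_bounded_noise:
  assumes Cw: "Cw < \<infinity>" and C0: "0 < C0"
    and bnd: "AE \<omega> in M. \<forall>t\<ge>1. ennreal (norm (regressor lag (\<lambda>s. y s \<omega>) t)) \<le> C \<longrightarrow>
           (\<forall>i\<in>{t..t + m - 1}. \<bar>f \<theta> (regressor lag (\<lambda>s. y s \<omega>) i) + u i \<omega>\<bar> \<le> C0)"
    and visits: "C < \<infinity> \<Longrightarrow> AE \<omega> in M. visits_ball lag C (\<lambda>s. y s \<omega>)"
    and dens: "1 / Cw < lower_density_prod (2 ^ (CARD('n) - 1) * CARD('m)) (P_set Df coord lag (cbox a b)) (\<lambda>_. {- C0..C0})"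
  shows "\<exists>\<gamma>0>0. \<forall>\<gamma>\<ge>\<gamma>0.
    (AE \<omega> in M. \<forall>i>CARD('m). act C \<gamma> i \<omega> \<longrightarrow> norm (\<phi> i \<omega>) \<le> \<gamma>) \<and>
    (AE \<omega> in M. exciting C \<gamma> \<omega>)"
proof -
  define q where "q = (2 ^ (CARD('n) - 1) :: nat)"
  define d where "d = CARD('m)"
  have d0: "0 < d" by (simp add: d_def)
  have dm: "m = int d" by (simp add: m_def d_def)
  have N0: "0 < q * d" using d0 by (simp add: q_def)
  obtain E where E: "(\<Pi>\<^sub>E j\<in>{..<q * d}. E j) \<subseteq> P_set Df coord lag (cbox a b)"
    "\<And>j. j < q * d \<Longrightarrow> finite (E j)"
    "\<And>j z. j < q * d \<Longrightarrow> \<bar>z\<bar> \<le> C0 \<Longrightarrow> \<exists>e\<in>E j. ennreal \<bar>e - z\<bar> \<le> Cw"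
    using lower_density_prod_finite_reach[OF dens Cw] N0 unfolding q_def d_def by metis
  obtain c \<delta> where c: "0 < c" "0 < \<delta>" and unif: "identifies Df lag (cbox a b) E c \<delta>"
    using uniform_excitation[OF coord lag Df_cont box_compact box_nonempty E(1,2)[unfolded q_def d_def]] by blast
  have predictor_bnd: "AE \<omega> in M. \<forall>t\<ge>1. ennreal (norm (\<phi> t \<omega>)) \<le> C \<longrightarrow>
      (\<forall>j<d. \<bar>predictor (t + j) \<omega>\<bar> \<le> C0)"
    using bnd
  proof eventually_elim
    case (elim \<omega>)
    show ?case
    proof (intro allI impI)
      fix t j :: nat assume t: "1 \<le> t" "ennreal (norm (\<phi> t \<omega>)) \<le> C" and j: "j < d"
      show "\<bar>predictor (t + j) \<omega>\<bar> \<le> C0"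
        using elim[rule_format, of "int t" "int (t + j)"] t j
        by (simp add: predictor_def \<phi>_def dm)
    qed
  qed
  define A where "A i \<omega> \<longleftrightarrow> 1 \<le> i \<and> ennreal (norm (\<phi> i \<omega>)) \<le> C" for i \<omega>
  have A_meas: "Measurable.pred (past i) (A i)" for i
  proof -
    have "Measurable.pred (past i) (\<lambda>\<omega>. ennreal (norm (\<phi> i \<omega>)) \<le> C)"
      by (rule norm_\<phi>_measurable) measurable
    then show ?thesis unfolding A_def by measurable
  qed
  have A_freq: "AE \<omega> in M. positive_frequency (\<lambda>i. A i \<omega>)"
  proof (cases "C < \<infinity>")
    case True
    from visits[OF True] show ?thesis
    proof eventually_elim
      case (elim \<omega>)
      show ?case by (rule positive_frequency_mono[OF visits_ball_positive_frequency[OF elim]])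
          (auto simp: A_def \<phi>_def)
    qed
  next
    case False
    then have "C = \<infinity>" by (simp add: less_top[symmetric])
    then have "positive_frequency (\<lambda>i. A i \<omega>)" for \<omega>
      by (intro positive_frequency_mono[OF positive_frequency_always]) (auto simp: A_def)
    then show ?thesis by simp
  qed
  define \<gamma>0 where "\<gamma>0 = real d * (C0 + enn2real Cw) + 1"
  have \<gamma>0: "0 < \<gamma>0" using C0 by (auto simp: \<gamma>0_def intro!: add_nonneg_pos mult_nonneg_nonneg)
  have act_bnd: "AE \<omega> in M. \<forall>\<gamma>\<ge>\<gamma>0. \<forall>i>CARD('m). act C \<gamma> i \<omega> \<longrightarrow> norm (\<phi> i \<omega>) \<le> \<gamma>"
    using predictor_bnd noise_bounded[OF Cw] AE_space
  proof eventually_elim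
    case (elim \<omega>)
    show ?case
    proof (intro allI impI)
      fix \<gamma> i assume \<gamma>: "\<gamma>0 \<le> \<gamma>" and i: "CARD('m) < i" and act: "act C \<gamma> i \<omega>"
      have di: "d < i" using i by (simp add: d_def)
      have C: "ennreal (norm (\<phi> (i - d) \<omega>)) \<le> C" using act active_iff[OF i] by (simp add: d_def)
      have "norm (\<phi> i \<omega>) \<le> real d * (C0 + enn2real Cw)" unfolding d_def
      proof (rule norm_\<phi>_le)
        fix k assume "k < CARD('m)"
        then have k: "k < d" by (simp add: d_def)
        define p where "p = i - k - 1"
        have p: "i - k = Suc p" "p = (i - d) + (d - 1 - k)" using k di by (auto simp: p_def)
        have "int i - int k = int (Suc p)" using p(1) k di by linarith
        then have "y (int i - int k) \<omega> = predictor p \<omega> + w (int (Suc p)) \<omega>"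
          using output_step[OF elim(3), of p] by simp
        moreover have "\<bar>predictor p \<omega>\<bar> \<le> C0"
          unfolding p(2) using elim(1)[rule_format, OF _ C, of "d - 1 - k"] di k by auto
        moreover have "\<bar>w (int (Suc p)) \<omega>\<bar> \<le> enn2real Cw" using elim(2) by blast
        ultimately show "\<bar>y (int i - int k) \<omega>\<bar> \<le> C0 + enn2real Cw" by linarith
      qed
      then show "norm (\<phi> i \<omega>) \<le> \<gamma>" using \<gamma> by (simp add: \<gamma>0_def)
    qed
  qed
  \<comment> \<open>Step \<open>j\<close> of \<open>d\<close> produces the output that has lag \<open>d - 1 - j\<close> in the final regressor.\<close>
  have freq: "AE \<omega> in M. positive_frequency (\<lambda>i. A i \<omega>) \<longrightarrow>
       positive_frequency (\<lambda>i. steered (\<lambda>j. E (b' * d + (d - 1 - j))) \<delta> A d i \<omega>)" if b': "b' < q" for b'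
  proof (rule steered_frequency[OF A_meas c(2)])
    fix j assume j: "j < d"
    have "b' * d + (d - 1 - j) < Suc b' * d" using j by simp
    also have "\<dots> \<le> q * d" using b' by (intro mult_le_mono1) auto
    finally have idx: "b' * d + (d - 1 - j) < q * d" .
    show "\<exists>S. (AE \<omega> in M. \<forall>i\<ge>1. steered (\<lambda>j. E (b' * d + (d - 1 - j))) \<delta> A j i \<omega> \<longrightarrow> \<bar>predictor i \<omega>\<bar> \<le> S)
        \<and> (\<forall>z. \<bar>z\<bar> \<le> S \<longrightarrow> (\<exists>e\<in>E (b' * d + (d - 1 - j)). ennreal \<bar>e - z\<bar> \<le> Cw))"
    proof (intro exI[of _ C0] conjI)
      show "\<forall>z. \<bar>z\<bar> \<le> C0 \<longrightarrow> (\<exists>e\<in>E (b' * d + (d - 1 - j)). ennreal \<bar>e - z\<bar> \<le> Cw)"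
        using E(3)[OF idx] by blast
      show "AE \<omega> in M. \<forall>i\<ge>1. steered (\<lambda>j. E (b' * d + (d - 1 - j))) \<delta> A j i \<omega> \<longrightarrow> \<bar>predictor i \<omega>\<bar> \<le> C0"
        using predictor_bnd
      proof eventually_elim
        case (elim \<omega>)
        show ?case
        proof (intro allI impI)
          fix i assume "steered (\<lambda>j. E (b' * d + (d - 1 - j))) \<delta> A j i \<omega>"
          then have "A (i - j) \<omega>" by (simp add: steered_iff)
          then have ij: "1 \<le> i - j" "ennreal (norm (\<phi> (i - j) \<omega>)) \<le> C" by (auto simp: A_def)
          from elim[rule_format, OF ij j] show "\<bar>predictor i \<omega>\<bar> \<le> C0" using ij(1) by simp
        qed
      qed
    qed
  qed
  then have freq_all: "AE \<omega> in M. \<forall>b'\<in>{..<q}. positive_frequency (\<lambda>i. A i \<omega>) \<longrightarrow>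
       positive_frequency (\<lambda>i. steered (\<lambda>j. E (b' * d + (d - 1 - j))) \<delta> A d i \<omega>)"
    by (subst AE_finite_all) auto
  have exc: "AE \<omega> in M. \<forall>\<gamma>\<ge>\<gamma>0. exciting C \<gamma> \<omega>"
    using freq_all A_freq act_bnd
  proof eventually_elim
    case (elim \<omega>)
    show ?case
    proof (intro allI impI)
      fix \<gamma> assume \<gamma>: "\<gamma>0 \<le> \<gamma>"
      show "exciting C \<gamma> \<omega>"
      proof (rule exciting_if_blocks_visited[OF c(1) unif, folded q_def d_def])
        fix b' assume b': "b' < q"
        then have "positive_frequency (\<lambda>i. steered (\<lambda>j. E (b' * d + (d - 1 - j))) \<delta> A d i \<omega>)"
          using elim by blast
        then show "positive_frequency (\<lambda>i. used C \<gamma> i \<omega> \<and> (\<forall>l. \<exists>e\<in>E (b' * d + lag l). \<bar>\<phi> i \<omega> $ l - e\<bar> < \<delta>))"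
        proof (rule positive_frequency_mono)
          fix i assume st: "steered (\<lambda>j. E (b' * d + (d - 1 - j))) \<delta> A d i \<omega>"
          then have A: "A (i - d) \<omega>" by (simp add: steered_iff)
          then have "1 \<le> i - d" unfolding A_def by blast
          then have di: "CARD('m) < i" unfolding d_def by linarith
          then have "act C \<gamma> i \<omega>"
            using A active_iff[OF di, of C \<gamma> \<omega>] Cw by (auto simp: A_def d_def)
          moreover from this have "norm (\<phi> i \<omega>) \<le> \<gamma>" using elim(3) \<gamma> di by blast
          moreover have "\<exists>e\<in>E (b' * d + lag l). \<bar>\<phi> i \<omega> $ l - e\<bar> < \<delta>" for l
          proof -
            have l: "lag l < d" using lag_less by (simp add: d_def)
            then have "d - 1 - lag l < d" "d - 1 - (d - 1 - lag l) = lag l" by auto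
            then have "\<exists>e\<in>E (b' * d + lag l). \<bar>y (int (i - lag l)) \<omega> - e\<bar> < \<delta>"
              using st unfolding steered_iff by metis
            moreover have "int (i - lag l) = int i - int (lag l)" using l di d_def by linarith
            ultimately show ?thesis by (simp add: \<phi>_def regressor_def)
          qed
          ultimately show "used C \<gamma> i \<omega> \<and> (\<forall>l. \<exists>e\<in>E (b' * d + lag l). \<bar>\<phi> i \<omega> $ l - e\<bar> < \<delta>)"
            by (simp add: used_def)
        qed
      qed
    qed
  qed
  show ?thesis
  proof (intro exI[of _ \<gamma>0] conjI allI impI \<gamma>0)
    fix \<gamma> assume \<gamma>: "\<gamma>0 \<le> \<gamma>"
    show "AE \<omega> in M. \<forall>i>CARD('m). act C \<gamma> i \<omega> \<longrightarrow> norm (\<phi> i \<omega>) \<le> \<gamma>"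
      using act_bnd by eventually_elim (use \<gamma> in blast)
    show "AE \<omega> in M. exciting C \<gamma> \<omega>"
      using exc by eventually_elim (use \<gamma> in blast)
  qed
qed

text \<open>
  For unbounded noise the predictable part is bounded only as long as the regressor is. Each step
  replaces the oldest output by one near a target, so the bound \<open>R\<close> at the start and the bound \<open>B\<close> on
  the targets control all regressors on the way.
\<close>

lemma steered_output_bound:
  assumes A: "\<And>i. A i \<omega> \<Longrightarrow> 1 \<le> i \<and> norm (\<phi> i \<omega>) \<le> R"
    and E: "\<And>j e. e \<in> E j \<Longrightarrow> \<bar>e\<bar> \<le> B" and \<delta>: "\<delta> \<le> 1"
    and st: "steered E \<delta> A j i \<omega>" and k: "k < CARD('m)" and B: "0 \<le> B" and R: "0 \<le> R"
  shows "\<bar>y (int i - int k) \<omega>\<bar> \<le> R + real j * (B + 1)"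
  using st k
proof (induction j arbitrary: i k)
  case 0
  obtain l where l: "lag l = k" using lag_surj[OF 0(2)] by blast
  have "\<bar>y (int i - int k) \<omega>\<bar> = \<bar>\<phi> i \<omega> $ l\<bar>" using l by (simp add: \<phi>_def regressor_def)
  also have "\<dots> \<le> norm (\<phi> i \<omega>)" by (rule component_le_norm_cart)
  finally show ?case using A[of i] 0 by simp
next
  case (Suc j)
  from Suc.prems obtain e where st: "steered E \<delta> A j (i - 1) \<omega>" "e \<in> E j" "\<bar>y (int i) \<omega> - e\<bar> < \<delta>" by auto
  have "1 \<le> i - 1 - j" using st(1) A unfolding steered_iff by blast
  then have i: "1 \<le> i" by linarith
  show ?case
  proof (cases k)
    case 0
    have "\<bar>y (int i) \<omega>\<bar> \<le> B + 1" using st(3) E[OF st(2)] \<delta> by linarith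
    also have "\<dots> \<le> R + real (Suc j) * (B + 1)"
      using R B mult_nonneg_nonneg[of "real j" "B + 1"] by (simp add: distrib_right)
    finally show ?thesis using 0 by simp
  next
    case k: (Suc k')
    have eq: "int i - int k = int (i - 1) - int k'" using i k by linarith
    have "\<bar>y (int (i - 1) - int k') \<omega>\<bar> \<le> R + real j * (B + 1)"
      by (rule Suc.IH[OF st(1)]) (use Suc.prems(2) k in simp)
    also have "\<dots> \<le> R + real (Suc j) * (B + 1)"
      using B by (intro add_left_mono mult_right_mono) auto
    finally show ?thesis unfolding eq .
  qed
qed

text \<open>
  The criterion uses time \<open>i\<close> only if the regressor at time \<open>i - m\<close> has norm at most \<open>C\<close>, where \<open>C\<close> may
  be small. Stability gives positive frequency to a ball whose radius depends on the path. From there the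
  outputs are steered towards 0 for \<open>m\<close> steps, which brings the regressor into the
  ball of radius \<open>C\<close>, and then towards a block of a point of \<open>P'\<close> for another \<open>m\<close> steps. The threshold for
  \<open>\<gamma>\<close> comes from that point alone and so does not depend on the path.
\<close>

theorem excitation_unbounded_noise:
  assumes Cw: "Cw = \<infinity>" and C: "0 < C"
    and stable: "AE \<omega> in M. stable_path (\<lambda>s. y s \<omega>)"
    and P: "P_set Df coord lag (cbox a b) \<noteq> {}"
  shows "\<exists>\<gamma>0>0. \<forall>\<gamma>\<ge>\<gamma>0. AE \<omega> in M. exciting C \<gamma> \<omega>"
proof -
  define q where "q = (2 ^ (CARD('n) - 1) :: nat)"
  define d where "d = CARD('m)"
  have d0: "0 < d" by (simp add: d_def)
  obtain \<beta> where \<beta>: "\<beta> \<in> P_set Df coord lag (cbox a b)" using P by blast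
  have "(\<Pi>\<^sub>E j\<in>{..<q * d}. {\<beta> j}) = {\<beta>}"
    using \<beta> unfolding P_set_def q_def d_def by (subst PiE_singleton) (auto simp: PiE_def)
  then have PE: "(\<Pi>\<^sub>E j\<in>{..<q * d}. {\<beta> j}) \<subseteq> P_set Df coord lag (cbox a b)" using \<beta> by simp
  obtain c \<delta>0 where c: "0 < c" "0 < \<delta>0" and unif: "identifies Df lag (cbox a b) (\<lambda>j. {\<beta> j}) c \<delta>0"
    using uniform_excitation[OF coord lag Df_cont box_compact box_nonempty PE[unfolded q_def d_def]] by blast
  define r where "r = (if C = \<infinity> then 1 else enn2real C)"
  have r: "0 < r" "ennreal r \<le> C" using C by (cases C; auto simp: r_def)+
  define \<delta> where "\<delta> = min \<delta>0 (min 1 (r / real d))"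
  have \<delta>: "0 < \<delta>" "\<delta> \<le> \<delta>0" "\<delta> \<le> 1" "\<delta> \<le> r / real d"
    unfolding \<delta>_def using c r d0 by simp_all
  have d\<delta>: "real d * \<delta> \<le> r" using \<delta>(4) d0 by (simp add: field_simps)
  define B where "B = (\<Sum>j<q * d. \<bar>\<beta> j\<bar>)"
  have B0: "0 \<le> B" by (simp add: B_def sum_nonneg)
  have B: "\<bar>\<beta> (b' * d + k)\<bar> \<le> B" if "b' < q" "k < d" for b' k
  proof -
    have "b' * d + k < Suc b' * d" using that by simp
    also have "\<dots> \<le> q * d" using that by (intro mult_le_mono1) auto
    finally show ?thesis unfolding B_def by (intro member_le_sum) auto
  qed
  \<comment> \<open>The value beyond \<open>2 * d\<close> only serves to make all target sets nonempty and bounded.\<close>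
  define E where "E b' j = (if j < d then {0} else if j < 2 * d then {\<beta> (b' * d + (2 * d - 1 - j))} else {0})" for b' j
  have E: "\<bar>e\<bar> \<le> B" if "b' < q" "e \<in> E b' j" for b' j e
  proof (cases "j < d \<or> 2 * d \<le> j")
    case False
    then have "e = \<beta> (b' * d + (2 * d - 1 - j))" "2 * d - 1 - j < d" using that by (auto simp: E_def)
    then show ?thesis using B[OF that(1)] by blast
  qed (use that B0 in \<open>auto simp: E_def\<close>)
  define A where "A R i \<omega> \<longleftrightarrow> 1 \<le> i \<and> norm (\<phi> i \<omega>) \<le> real R" for R i \<omega>
  have A_meas: "Measurable.pred (past i) (A R i)" for R i
  proof -
    have "Measurable.pred (past i) (\<lambda>\<omega>. norm (\<phi> i \<omega>) \<le> real R)"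
      by (rule norm_\<phi>_measurable) measurable
    then show ?thesis unfolding A_def by measurable
  qed
  have inputs_bnd: "AE \<omega> in M. \<forall>t\<ge>1. \<bar>u t \<omega>\<bar> \<le> Cu" using inputs unfolding admissible_experiment_def by simp
  \<comment> \<open>Radii are natural numbers, so that one null set serves for all of them.\<close>
  have freq: "AE \<omega> in M. positive_frequency (\<lambda>i. A R i \<omega>) \<longrightarrow>
      positive_frequency (\<lambda>i. steered (E b') \<delta> (A R) (2 * d) i \<omega>)" if b': "b' < q" for b' R
  proof (rule steered_frequency[OF A_meas \<delta>(1)])
    fix j
    define \<rho> where "\<rho> = real d * (real R + real j * (B + 1))"
    have "bounded (f \<theta> ` cball 0 \<rho>)"
      by (intro compact_imp_bounded compact_continuous_image continuous_on_subset[OF continuous_f]) auto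
    then obtain K where K: "\<forall>z\<in>cball 0 \<rho>. \<bar>f \<theta> z\<bar> \<le> K" unfolding bounded_iff by auto
    have reach: "AE \<omega> in M. \<forall>i\<ge>1. steered (E b') \<delta> (A R) j i \<omega> \<longrightarrow> \<bar>predictor i \<omega>\<bar> \<le> K + Cu"
      using inputs_bnd
    proof eventually_elim
      case (elim \<omega>)
      show ?case
      proof (intro allI impI)
        fix i assume i: "1 \<le> i" and st: "steered (E b') \<delta> (A R) j i \<omega>"
        have "norm (\<phi> i \<omega>) \<le> \<rho>" unfolding \<rho>_def d_def
          by (rule norm_\<phi>_le, rule steered_output_bound[OF _ E[OF b'] \<delta>(3) st _ B0]) (auto simp: A_def)
        then have "\<bar>f \<theta> (\<phi> i \<omega>)\<bar> \<le> K" using K by simp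
        moreover have "\<bar>u (int i) \<omega>\<bar> \<le> Cu" using elim i by simp
        ultimately show "\<bar>predictor i \<omega>\<bar> \<le> K + Cu" unfolding predictor_def by linarith
      qed
    qed
    have "E b' j \<noteq> {}" by (simp add: E_def)
    then show "\<exists>S. (AE \<omega> in M. \<forall>i\<ge>1. steered (E b') \<delta> (A R) j i \<omega> \<longrightarrow> \<bar>predictor i \<omega>\<bar> \<le> S)
        \<and> (\<forall>z. \<bar>z\<bar> \<le> S \<longrightarrow> (\<exists>e\<in>E b' j. ennreal \<bar>e - z\<bar> \<le> Cw))"
      using reach Cw by (intro exI[of _ "K + Cu"]) auto
  qed
  then have freq_all: "AE \<omega> in M. \<forall>R. \<forall>b'\<in>{..<q}. positive_frequency (\<lambda>i. A R i \<omega>) \<longrightarrow>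
      positive_frequency (\<lambda>i. steered (E b') \<delta> (A R) (2 * d) i \<omega>)"
    unfolding AE_all_countable by (intro allI, subst AE_finite_all) auto
  define \<gamma>0 where "\<gamma>0 = real d * (B + 1) + 1"
  have \<gamma>0: "0 < \<gamma>0" using B0 by (auto simp: \<gamma>0_def intro!: add_nonneg_pos mult_nonneg_nonneg)
  have "AE \<omega> in M. exciting C \<gamma> \<omega>" if \<gamma>: "\<gamma>0 \<le> \<gamma>" for \<gamma>
    using freq_all stable
  proof eventually_elim
    case (elim \<omega>)
    obtain R where "positive_frequency (\<lambda>i. norm (regressor lag (\<lambda>s. y s \<omega>) (int i)) \<le> real R)"
      using stable_path_recurrent[OF lag elim(2)] by blast
    then have R: "positive_frequency (\<lambda>i. A R i \<omega>)"
      by (rule positive_frequency_mono) (auto simp: A_def \<phi>_def)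
    show ?case
    proof (rule exciting_if_blocks_visited[OF c(1) unif, folded q_def d_def])
      fix b' assume b': "b' < q"
      then have "positive_frequency (\<lambda>i. steered (E b') \<delta> (A R) (2 * d) i \<omega>)" using elim(1) R by blast
      then show "positive_frequency (\<lambda>i. used C \<gamma> i \<omega> \<and> (\<forall>l. \<exists>e\<in>{\<beta> (b' * d + lag l)}. \<bar>\<phi> i \<omega> $ l - e\<bar> < \<delta>0))"
      proof (rule positive_frequency_mono)
        fix i assume st: "steered (E b') \<delta> (A R) (2 * d) i \<omega>"
        have "1 \<le> i - 2 * d" using st unfolding steered_iff A_def by blast
        then have i: "2 * d < i" by linarith
        have hit: "\<exists>e\<in>E b' (2 * d - 1 - k). \<bar>y (int i - int k) \<omega> - e\<bar> < \<delta>" if "k < 2 * d" for k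
        proof -
          have "2 * d - 1 - k < 2 * d" "2 * d - 1 - (2 * d - 1 - k) = k" using that by auto
          then have "\<exists>e\<in>E b' (2 * d - 1 - k). \<bar>y (int (i - k)) \<omega> - e\<bar> < \<delta>"
            using st unfolding steered_iff by metis
          moreover have "int (i - k) = int i - int k" using that i by linarith
          ultimately show ?thesis by simp
        qed
        have near: "\<bar>y (int i - int k) \<omega> - \<beta> (b' * d + k)\<bar> < \<delta>" if "k < d" for k
        proof -
          have "2 * d - 1 - (2 * d - 1 - k) = k" "\<not> 2 * d - 1 - k < d" "2 * d - 1 - k < 2 * d"
            using that by auto
          then have "E b' (2 * d - 1 - k) = {\<beta> (b' * d + k)}" by (simp add: E_def)
          then show ?thesis using hit[of k] that by auto
        qed
        have "norm (\<phi> (i - d) \<omega>) \<le> real d * \<delta>" unfolding d_def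
        proof (rule norm_\<phi>_le, unfold d_def[symmetric])
          fix k assume k: "k < d"
          have eq: "int (i - d) - int k = int i - int (d + k)" using i by linarith
          have "2 * d - 1 - (d + k) < d" using k by linarith
          then have "E b' (2 * d - 1 - (d + k)) = {0}" unfolding E_def by (rule if_P)
          then have "\<bar>y (int i - int (d + k)) \<omega> - 0\<bar> < \<delta>" using hit[of "d + k"] k by simp
          then show "\<bar>y (int (i - d) - int k) \<omega>\<bar> \<le> \<delta>" unfolding eq by simp
        qed
        then have "ennreal (norm (\<phi> (i - d) \<omega>)) \<le> ennreal r" using d\<delta> by (intro ennreal_leI) linarith
        then have 1: "ennreal (norm (\<phi> (i - d) \<omega>)) \<le> C" using r(2) by (rule order.trans)
        have "norm (\<phi> i \<omega>) \<le> real d * (B + 1)" unfolding d_def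
        proof (rule norm_\<phi>_le, unfold d_def[symmetric])
          fix k assume k: "k < d"
          show "\<bar>y (int i - int k) \<omega>\<bar> \<le> B + 1" using near[OF k] B[OF b' k] \<delta>(3) by linarith
        qed
        then have 2: "norm (\<phi> i \<omega>) \<le> \<gamma>" using \<gamma> by (simp add: \<gamma>0_def)
        have "CARD('m) < i" using i by (simp add: d_def)
        then have "used C \<gamma> i \<omega>" unfolding used_def using active_iff 1 2 by (simp add: d_def)
        moreover have "\<bar>\<phi> i \<omega> $ l - \<beta> (b' * d + lag l)\<bar> < \<delta>0" for l
          using near[of "lag l"] lag_less[of l] \<delta>(2) by (simp add: \<phi>_def regressor_def d_def)
        ultimately show "used C \<gamma> i \<omega> \<and> (\<forall>l. \<exists>e\<in>{\<beta> (b' * d + lag l)}. \<bar>\<phi> i \<omega> $ l - e\<bar> < \<delta>0)" by simp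
      qed
    qed
  qed
  with \<gamma>0 show ?thesis by blast
qed

end

section \<open>Centers of grid boxes\<close>

lemma near_interval_center:
  assumes "lo \<le> x" "x \<le> hi" "0 < q"
  shows "\<exists>j<q. \<bar>x - interval_center lo hi q j\<bar> \<le> (hi - lo) / real q / 2"
proof (cases "lo = hi")
  case True
  then show ?thesis using assms by (intro exI[of _ 0]) (auto simp: interval_center_def)
next
  case False
  define h where "h = (hi - lo) / real q"
  have h: "0 < h" "real q * h = hi - lo" using assms False by (auto simp: h_def)
  define k where "k = nat \<lfloor>(x - lo) / h\<rfloor>"
  have r0: "0 \<le> (x - lo) / h" using assms h by simp
  have k: "real k \<le> (x - lo) / h" "(x - lo) / h < real k + 1"
    using r0 unfolding k_def by linarith+
  show ?thesis
  proof (cases "k < q")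
    case True
    have "real k * h \<le> x - lo" "x - lo \<le> (real k + 1) * h"
      using k h by (auto simp: field_simps)
    then have "\<bar>x - (lo + (real k + 1 / 2) * h)\<bar> \<le> h / 2" unfolding distrib_right by linarith
    then show ?thesis using True by (auto simp: interval_center_def h_def)
  next
    case False
    \<comment> \<open>The right end point of the interval is the only point in no half-open cell; the last cell serves it.\<close>
    then have "real q * h \<le> x - lo" using k(1) h(1)
      by (smt (verit, best) mult_right_mono of_nat_mono not_less pos_le_divide_eq)
    then have "x = lo + real q * h" using h assms by linarith
    then show ?thesis using assms(3)
      by (intro exI[of _ "q - 1"]) (auto simp: interval_center_def h_def[symmetric] of_nat_diff algebra_simps h(1) less_imp_le)
  qed
qed

lemma interval_center_bounds:
  assumes "lo \<le> hi" "j < q"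
  shows "lo \<le> interval_center lo hi q j" "interval_center lo hi q j \<le> hi"
proof -
  have "0 < real q" using assms by simp
  have "real j + 1/2 \<le> real q" using assms by linarith
  then have r: "0 \<le> (real j + 1/2) / real q" "(real j + 1/2) / real q \<le> 1" using assms by auto
  have "0 \<le> (real j + 1/2) / real q * (hi - lo)" "(real j + 1/2) / real q * (hi - lo) \<le> hi - lo"
    using mult_left_le_one_le[OF _ r] mult_nonneg_nonneg[OF r(1)] assms by auto
  then show "lo \<le> interval_center lo hi q j" "interval_center lo hi q j \<le> hi"
    by (auto simp: interval_center_def)
qed

lemma box_center_nth: "box_center a b p i $ k = interval_center (a $ k) (b $ k) (p k) (i k)"
  by (simp add: box_center_def interval_center_def)

lemma box_center_in_box:
  assumes "\<And>k. a $ k \<le> b $ k" "\<And>k. i k < p k"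
  shows "box_center a b p i \<in> cbox a b"
  using interval_center_bounds[OF assms] by (auto simp: mem_box_cart box_center_nth)

lemma near_box_center:
  assumes "x \<in> cbox a b" "\<And>k. 0 < p k"
  shows "\<exists>i. (\<forall>k. i k < p k) \<and> (\<forall>k. \<bar>x $ k - box_center a b p i $ k\<bar> \<le> (b $ k - a $ k) / real (p k) / 2)"
proof -
  have "\<forall>k. \<exists>j<p k. \<bar>x $ k - interval_center (a $ k) (b $ k) (p k) j\<bar> \<le> (b $ k - a $ k) / real (p k) / 2"
    using near_interval_center assms by (auto simp: mem_box_cart)
  then obtain i where "\<forall>k. i k < p k \<and> \<bar>x $ k - interval_center (a $ k) (b $ k) (p k) (i k)\<bar> \<le> (b $ k - a $ k) / real (p k) / 2"
    by metis
  then show ?thesis by (intro exI[of _ i]) (auto simp: box_center_nth)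
qed

lemma finite_indices: "finite {i :: 'n::finite \<Rightarrow> nat. \<forall>k. i k < p k}"
  and card_indices: "card {i :: 'n::finite \<Rightarrow> nat. \<forall>k. i k < t} = t ^ CARD('n)"
proof -
  have "{i. \<forall>k. i k < p k} = (\<Pi>\<^sub>E k\<in>(UNIV :: 'n set). {..<p k})" for p :: "'n \<Rightarrow> nat"
    by (auto simp: PiE_def Pi_def)
  then show "finite {i :: 'n::finite \<Rightarrow> nat. \<forall>k. i k < p k}"
    "card {i :: 'n::finite \<Rightarrow> nat. \<forall>k. i k < t} = t ^ CARD('n)"
    by (auto simp: card_PiE intro!: finite_PiE)
qed

text \<open>
  This is the source of the factor \<open>n / 4\<close> in \<open>C_phi\<close>.
\<close>

lemma near_center_norm:
  assumes "\<And>k. \<bar>x $ k - x' $ k\<bar> \<le> s k / 2" "\<And>k. s k \<le> (h :: real)"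
  shows "(norm (x - x' :: real ^ 'n))\<^sup>2 \<le> real CARD('n) / 4 * h\<^sup>2"
proof -
  have "(norm (x - x'))\<^sup>2 = (\<Sum>k\<in>UNIV. (x $ k - x' $ k)\<^sup>2)"
    unfolding norm_vec_def L2_set_def by (simp add: sum_nonneg)
  also have "\<dots> \<le> (\<Sum>k\<in>(UNIV::'n set). (h / 2)\<^sup>2)"
  proof (rule sum_mono)
    fix k
    have "\<bar>x $ k - x' $ k\<bar> \<le> h / 2" using assms(1)[of k] assms(2)[of k] by linarith
    from power_mono[OF this, of 2] show "(x $ k - x' $ k)\<^sup>2 \<le> (h / 2)\<^sup>2" by simp
  qed
  also have "\<dots> = real CARD('n) / 4 * h\<^sup>2" by (simp add: power_divide)
  finally show ?thesis .
qed

context closed_loop_system begin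

section \<open>Noise sums of the criterion, uniformly over the parameter box\<close>

definition \<sigma>2 :: real where "\<sigma>2 = expectation (\<lambda>\<omega>. (w 1 \<omega>)\<^sup>2)"

lemma box_le: "a $ k \<le> b $ k"
  using nondegenerate by (simp add: less_imp_le)

lemma noise_moments:
  shows "4 < \<kappa>" "expectation (w 1) = 0" "integrable M (\<lambda>\<omega>. (w 1 \<omega>)\<^sup>2)" "integrable M (\<lambda>\<omega>. ((w 1 \<omega>)\<^sup>2 - \<sigma>2)\<^sup>2)"
    "0 \<le> \<sigma>2"
proof -
  have [measurable]: "w 1 \<in> borel_measurable M" using measurable_w1 by simp
  show \<kappa>: "4 < \<kappa>" using B1 unfolding assumption_B1_def by (elim conjE)
  show "expectation (w 1) = 0" using B1 unfolding assumption_B1_def by (elim conjE)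
  have i\<kappa>: "integrable M (\<lambda>\<omega>. \<bar>w 1 \<omega>\<bar> powr \<kappa>)" using B1 unfolding assumption_B1_def by (elim conjE)
  have pow: "\<bar>z\<bar> ^ k \<le> 1 + \<bar>z\<bar> powr \<kappa>" if "k \<le> 4" for z :: real and k :: nat
  proof (cases "\<bar>z\<bar> \<le> 1")
    case True
    then have "\<bar>z\<bar> ^ k \<le> 1" by (simp add: power_le_one)
    then show ?thesis by (simp add: add_increasing2)
  next
    case False
    then have "\<bar>z\<bar> ^ k = \<bar>z\<bar> powr real k" by (simp add: powr_realpow)
    also have "\<dots> \<le> \<bar>z\<bar> powr \<kappa>" using False that \<kappa> by (intro powr_mono) auto
    finally show ?thesis by simp
  qed
  have ipow: "integrable M (\<lambda>\<omega>. (w 1 \<omega>) ^ k)" if "k \<le> 4" for k :: nat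
  proof (rule Bochner_Integration.integrable_bound)
    show "integrable M (\<lambda>\<omega>. 1 + \<bar>w 1 \<omega>\<bar> powr \<kappa>)" using i\<kappa> by simp
    show "AE \<omega> in M. norm ((w 1 \<omega>) ^ k) \<le> norm (1 + \<bar>w 1 \<omega>\<bar> powr \<kappa>)"
      using pow[OF that] by (intro AE_I2) (simp add: power_abs)
  qed measurable
  show i2: "integrable M (\<lambda>\<omega>. (w 1 \<omega>)\<^sup>2)" using ipow[of 2] by simp
  have "integrable M (\<lambda>\<omega>. (w 1 \<omega>) ^ 4 - 2 * \<sigma>2 * (w 1 \<omega>)\<^sup>2 + \<sigma>2\<^sup>2)"
    using ipow[of 4] i2 by (intro Bochner_Integration.integrable_add Bochner_Integration.integrable_diff) auto
  also have "(\<lambda>\<omega>. (w 1 \<omega>) ^ 4 - 2 * \<sigma>2 * (w 1 \<omega>)\<^sup>2 + \<sigma>2\<^sup>2) = (\<lambda>\<omega>. ((w 1 \<omega>)\<^sup>2 - \<sigma>2)\<^sup>2)"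
    by (simp add: fun_eq_iff power2_eq_square power4_eq_xxxx algebra_simps)
  finally show "integrable M (\<lambda>\<omega>. ((w 1 \<omega>)\<^sup>2 - \<sigma>2)\<^sup>2)" .
  show "0 \<le> \<sigma>2" unfolding \<sigma>2_def by simp
qed

text \<open>
  The supremum that enters \<open>C_phi\<close>.
\<close>

definition gradient_bound :: "real \<Rightarrow> real" where
  "gradient_bound \<gamma> = (SUP (x, z)\<in>cbox a b \<times> cball 0 \<gamma>. (norm (Df x z))\<^sup>2)"

lemma gradient_le:
  assumes "x \<in> cbox a b" "norm z \<le> \<gamma>"
  shows "(norm (Df x z))\<^sup>2 \<le> gradient_bound \<gamma>"
proof -
  have "continuous_on (cbox a b \<times> cball 0 \<gamma>) (\<lambda>p. (norm ((\<lambda>(x, z). Df x z) p))\<^sup>2)"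
    by (intro continuous_intros continuous_on_subset[OF Df_cont]) auto
  then have "compact ((\<lambda>p. (norm ((\<lambda>(x, z). Df x z) p))\<^sup>2) ` (cbox a b \<times> cball 0 \<gamma>))"
    by (rule compact_continuous_image) (auto intro: compact_Times)
  then have "bdd_above ((\<lambda>p. (norm ((\<lambda>(x, z). Df x z) p))\<^sup>2) ` (cbox a b \<times> cball 0 \<gamma>))"
    by (intro bounded_imp_bdd_above compact_imp_bounded)
  then have "bdd_above ((\<lambda>(x, z). (norm (Df x z))\<^sup>2) ` (cbox a b \<times> cball 0 \<gamma>))"
    by (simp add: case_prod_unfold)
  then have "(\<lambda>(x, z). (norm (Df x z))\<^sup>2) (x, z) \<le> gradient_bound \<gamma>"
    unfolding gradient_bound_def by (intro cSUP_upper) (use assms in auto)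
  then show ?thesis by simp
qed

lemma gradient_bound_nonneg:
  assumes "0 \<le> \<gamma>" shows "0 \<le> gradient_bound \<gamma>"
proof -
  have "0 \<le> (norm (Df \<theta> 0))\<^sup>2" by simp
  also have "\<dots> \<le> gradient_bound \<gamma>" by (rule gradient_le[OF theta]) (use assms in simp)
  finally show ?thesis .
qed

lemma f_increment:
  assumes "x \<in> cbox a b" "x' \<in> cbox a b" "norm z \<le> \<gamma>"
  shows "(f x z - f x' z)\<^sup>2 \<le> gradient_bound \<gamma> * (norm (x - x'))\<^sup>2"
proof -
  obtain \<xi> where \<xi>: "\<xi> \<in> cbox a b" "f x z - f x' z = Df \<xi> z \<bullet> (x - x')"
    using mean_value[OF assms(1,2)] by blast
  have "\<bar>Df \<xi> z \<bullet> (x - x')\<bar>\<^sup>2 \<le> (norm (Df \<xi> z) * norm (x - x'))\<^sup>2"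
    by (rule power_mono[OF Cauchy_Schwarz_ineq2]) simp
  also have "\<dots> \<le> gradient_bound \<gamma> * (norm (x - x'))\<^sup>2"
    unfolding power_mult_distrib by (rule mult_right_mono[OF gradient_le[OF \<xi>(1) assms(3)]]) simp
  finally show ?thesis using \<xi>(2) by simp
qed

lemma f_lipschitz:
  assumes "x \<in> cbox a b" "x' \<in> cbox a b" "norm z \<le> \<gamma>"
  shows "\<bar>f x z - f x' z\<bar> \<le> sqrt (gradient_bound \<gamma>) * norm (x - x')"
  using real_sqrt_le_mono[OF f_increment[OF assms]] by (simp add: real_sqrt_mult)

lemma used_measurable:
  assumes "1 \<le> i"
  shows "Measurable.pred (past i) (used C \<gamma> i)"
proof -
  have [measurable]: "(\<lambda>\<omega>. regressor lag (\<lambda>s. y s \<omega>) (int i - m)) \<in> borel_measurable (past i)"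
    by (rule regressor_measurable) (use assms m_ge_1 in auto)
  have [measurable]: "(\<lambda>\<omega>. regressor lag (\<lambda>s. y s \<omega>) (int i)) \<in> borel_measurable (past i)"
    by (rule regressor_measurable) (use assms m_ge_1 in auto)
  show ?thesis unfolding used_def active_def \<phi>_def m_def[symmetric] by measurable
qed

definition cross_sum :: "ennreal \<Rightarrow> real \<Rightarrow> 'a \<Rightarrow> nat \<Rightarrow> real ^ 'n \<Rightarrow> real" where
  "cross_sum C \<gamma> \<omega> t x = (\<Sum>i=1..<t. \<Delta> x i \<omega> * of_bool (used C \<gamma> i \<omega>) * w (int (Suc i)) \<omega>)"

text \<open>
  Uniformity in \<open>x\<close> over a compact box: \<open>uniform_noise_bound\<close> applies to the \<open>t ^ n\<close> centers of the
  partition of the box into \<open>t\<close> parts per side. Moving from \<open>x\<close> to the nearest center changes each of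
  the \<open>t\<close> weights by \<open>O(1 / t)\<close>, and each noise term is at most \<open>sqrt t\<close> by \<open>noise_growth\<close>, so the
  sum changes by \<open>O(sqrt t)\<close>. This net is unrelated to the grid of the estimator, which may be arbitrarily
  fine.
\<close>

theorem cross_sum_bound:
  assumes \<gamma>: "0 < \<gamma>" and \<epsilon>: "0 < \<epsilon>"
  shows "AE \<omega> in M. \<exists>K. \<forall>\<^sub>F t in sequentially. \<forall>x\<in>cbox a b. \<bar>cross_sum C \<gamma> \<omega> t x\<bar> \<le> K * real t powr (1/2 + \<epsilon>)"
proof -
  define L where "L = sqrt (gradient_bound \<gamma>)"
  have L0: "0 \<le> L" unfolding L_def using gradient_bound_nonneg[of \<gamma>] \<gamma> by simp
  define \<nu> where "\<nu> = norm (b - a)"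
  \<comment> \<open>The summand 1 makes the bound positive even if \<open>f\<close> is constant in \<open>x\<close>.\<close>
  define D where "D = L * \<nu> + 1"
  have D: "0 < D" using L0 by (auto simp: D_def \<nu>_def intro!: add_nonneg_pos)
  define I where "I t = {k :: 'n \<Rightarrow> nat. \<forall>j. k j < t}" for t
  define o' where "o' t k = box_center a b (\<lambda>_. t) k" for t k
  have o_in: "o' t k \<in> cbox a b" if "k \<in> I t" for t k
    unfolding o'_def by (rule box_center_in_box) (use box_le that in \<open>auto simp: I_def\<close>)
  define H where "H t k i \<omega> = \<Delta> (o' t k) i \<omega> * of_bool (1 \<le> i \<and> used C \<gamma> i \<omega>)" for t k i \<omega>
  have diff: "\<bar>\<Delta> x i \<omega> - \<Delta> x' i \<omega>\<bar> \<le> L * norm (x - x')"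
    if "x \<in> cbox a b" "x' \<in> cbox a b" "used C \<gamma> i \<omega>" for x x' i \<omega>
    using f_lipschitz[OF that(1,2), of "\<phi> i \<omega>" \<gamma>] that(3) by (simp add: \<Delta>_def used_def L_def)
  have diam: "norm (x - x') \<le> \<nu>" if "x \<in> cbox a b" "x' \<in> cbox a b" for x x'
    unfolding \<nu>_def
  proof (rule norm_le_componentwise_cart)
    fix k
    have "a $ k \<le> x $ k" "x $ k \<le> b $ k" "a $ k \<le> x' $ k" "x' $ k \<le> b $ k"
      using that by (auto simp: mem_box_cart)
    then show "norm ((x - x') $ k) \<le> norm ((b - a) $ k)" by simp
  qed
  have net: "AE \<omega> in M. \<forall>\<^sub>F t in sequentially. \<forall>k\<in>I t.
     \<bar>\<Sum>i=1..<t. H t k i \<omega> * w (int (Suc i)) \<omega>\<bar> \<le> D * real t powr (1/2 + \<epsilon>)"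
  proof (rule uniform_noise_bound[where \<psi>="\<lambda>z. z"])
    show "H t k i \<in> borel_measurable (past i)" if "k \<in> I t" for t k i
    proof (cases "1 \<le> i")
      case True
      note [measurable] = f_measurable \<phi>_measurable used_measurable[OF True]
      show ?thesis unfolding H_def \<Delta>_def by measurable
    next
      case False
      then have "H t k i = (\<lambda>_. 0)" by (auto simp: H_def)
      then show ?thesis by simp
    qed
    show "\<bar>H t k i \<omega>\<bar> \<le> D" if "k \<in> I t" "\<omega> \<in> space M" for t k i \<omega>
    proof (cases "1 \<le> i \<and> used C \<gamma> i \<omega>")
      case True
      have "\<bar>\<Delta> (o' t k) i \<omega>\<bar> \<le> L * norm (o' t k - \<theta>)"
        using diff[OF o_in[OF that(1)] theta, of i \<omega>] True by (simp add: \<Delta>_def)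
      also have "\<dots> \<le> L * \<nu>" by (rule mult_left_mono[OF diam[OF o_in[OF that(1)] theta] L0])
      finally show ?thesis using True by (simp add: H_def D_def)
    qed (use D in \<open>auto simp: H_def\<close>)
    show "finite (I t)" for t unfolding I_def by (rule finite_indices)
    show "summable (\<lambda>t. real (card (I t)) * exp (- (real t powr \<epsilon>)))"
      unfolding I_def card_indices of_nat_power by (rule summable_power_times_exp[OF \<epsilon>])
  qed (use D noise_moments in auto)
  have growth: "AE \<omega> in M. \<forall>\<^sub>F t in sequentially. \<forall>i\<in>{1..<t}. \<bar>w (int (Suc i)) \<omega>\<bar> \<le> sqrt (real t)"
    by (rule noise_growth[where \<psi>="\<lambda>z. z"]) (use noise_moments in auto)
  from net growth show ?thesis
  proof eventually_elim
    case (elim \<omega>)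
    have "\<forall>\<^sub>F t in sequentially. \<forall>x\<in>cbox a b. \<bar>cross_sum C \<gamma> \<omega> t x\<bar> \<le> (D + L * \<nu>) * real t powr (1/2 + \<epsilon>)"
      using elim(1) elim(2) eventually_gt_at_top[of 0]
    proof eventually_elim
      case (elim t)
      show ?case
      proof
        fix x assume x: "x \<in> cbox a b"
        obtain k where k: "\<forall>j. k j < t" "\<forall>j. \<bar>x $ j - o' t k $ j\<bar> \<le> (b $ j - a $ j) / real t / 2"
          using near_box_center[OF x, of "\<lambda>_. t"] elim(3) unfolding o'_def by auto
        have kI: "k \<in> I t" using k(1) by (simp add: I_def)
        have "norm (x - o' t k) \<le> norm ((1 / (2 * real t)) *\<^sub>R (b - a))"
        proof (rule norm_le_componentwise_cart)
          fix j
          have "norm ((x - o' t k) $ j) \<le> (b $ j - a $ j) / real t / 2" using k(2) by simp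
          also have "\<dots> = norm (((1 / (2 * real t)) *\<^sub>R (b - a)) $ j)"
            using box_le[of j] by (simp add: abs_mult)
          finally show "norm ((x - o' t k) $ j) \<le> norm (((1 / (2 * real t)) *\<^sub>R (b - a)) $ j)" .
        qed
        also have "\<dots> = 1 / (2 * real t) * \<nu>" using elim(3) unfolding norm_scaleR by (simp add: \<nu>_def)
        also have "\<dots> \<le> \<nu> / real t" using elim(3) by (simp add: \<nu>_def field_simps)
        finally have close: "norm (x - o' t k) \<le> \<nu> / real t" .
        have split: "cross_sum C \<gamma> \<omega> t x = (\<Sum>i=1..<t. H t k i \<omega> * w (int (Suc i)) \<omega>)
            + (\<Sum>i=1..<t. (\<Delta> x i \<omega> - \<Delta> (o' t k) i \<omega>) * of_bool (used C \<gamma> i \<omega>) * w (int (Suc i)) \<omega>)"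
          unfolding cross_sum_def sum.distrib[symmetric]
          by (rule sum.cong) (auto simp: H_def algebra_simps)
        have "\<bar>\<Sum>i=1..<t. (\<Delta> x i \<omega> - \<Delta> (o' t k) i \<omega>) * of_bool (used C \<gamma> i \<omega>) * w (int (Suc i)) \<omega>\<bar>
            \<le> (\<Sum>i=1..<t. L * (\<nu> / real t) * sqrt (real t))"
        proof (rule order.trans[OF sum_abs], rule sum_mono)
          fix i assume i: "i \<in> {1..<t}"
          show "\<bar>(\<Delta> x i \<omega> - \<Delta> (o' t k) i \<omega>) * of_bool (used C \<gamma> i \<omega>) * w (int (Suc i)) \<omega>\<bar>
             \<le> L * (\<nu> / real t) * sqrt (real t)"
          proof (cases "used C \<gamma> i \<omega>")
            case True
            have "\<bar>\<Delta> x i \<omega> - \<Delta> (o' t k) i \<omega>\<bar> \<le> L * (\<nu> / real t)"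
              using diff[OF x o_in[OF kI] True] mult_left_mono[OF close L0] by linarith
            then have "\<bar>\<Delta> x i \<omega> - \<Delta> (o' t k) i \<omega>\<bar> * \<bar>w (int (Suc i)) \<omega>\<bar> \<le> L * (\<nu> / real t) * sqrt (real t)"
              using elim(2) i L0 by (intro mult_mono) (auto simp: \<nu>_def)
            then show ?thesis using True by (simp only: abs_mult of_bool_eq mult_1_right abs_one)
          qed (use L0 in \<open>simp add: \<nu>_def\<close>)
        qed
        also have "\<dots> = real (t - 1) * (L * (\<nu> / real t) * sqrt (real t))" by simp
        also have "\<dots> \<le> real t * (L * (\<nu> / real t) * sqrt (real t))"
          using L0 by (intro mult_right_mono) (auto simp: \<nu>_def)
        also have "\<dots> = L * \<nu> * sqrt (real t)" using elim(3) by simp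
        also have "\<dots> \<le> L * \<nu> * real t powr (1/2 + \<epsilon>)"
        proof (rule mult_left_mono)
          show "sqrt (real t) \<le> real t powr (1/2 + \<epsilon>)"
            unfolding powr_half_sqrt[OF of_nat_0_le_iff, symmetric]
            using elim(3) \<epsilon> by (intro powr_mono) auto
        qed (use L0 in \<open>simp add: \<nu>_def\<close>)
        finally show "\<bar>cross_sum C \<gamma> \<omega> t x\<bar> \<le> (D + L * \<nu>) * real t powr (1/2 + \<epsilon>)"
          using split elim(1) kI by (auto simp: distrib_right)
      qed
    qed
    then show ?case by blast
  qed
qed

definition variance_sum :: "ennreal \<Rightarrow> real \<Rightarrow> 'a \<Rightarrow> nat \<Rightarrow> real" where
  "variance_sum C \<gamma> \<omega> t = (\<Sum>i=1..<t. of_bool (used C \<gamma> i \<omega>) * ((w (int (Suc i)) \<omega>)\<^sup>2 - \<sigma>2))"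

lemma variance_sum_bound:
  assumes \<epsilon>: "0 < \<epsilon>"
  shows "AE \<omega> in M. \<forall>\<^sub>F t in sequentially. \<bar>variance_sum C \<gamma> \<omega> t\<bar> \<le> real t powr (1/2 + \<epsilon>)"
proof -
  have "AE \<omega> in M. \<forall>\<^sub>F t in sequentially. \<forall>k\<in>{()}.
     \<bar>\<Sum>i=1..<t. of_bool (1 \<le> i \<and> used C \<gamma> i \<omega>) * ((w (int (Suc i)) \<omega>)\<^sup>2 - \<sigma>2)\<bar> \<le> 1 * real t powr (1/2 + \<epsilon>)"
  proof (rule uniform_noise_bound[where \<psi>="\<lambda>z. z\<^sup>2 - \<sigma>2" and K="\<lambda>_. {()}"
        and H="\<lambda>_ _ i \<omega>. of_bool (1 \<le> i \<and> used C \<gamma> i \<omega>)"])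
    show "(\<lambda>\<omega>. of_bool (1 \<le> i \<and> used C \<gamma> i \<omega>) :: real) \<in> borel_measurable (past i)" for i
    proof (cases "1 \<le> i")
      case True
      note [measurable] = used_measurable[OF True]
      show ?thesis by measurable
    qed simp
    show "summable (\<lambda>t. real (card {()}) * exp (- (real t powr \<epsilon>)))"
      using summable_power_times_exp[OF \<epsilon>, of 0] by simp
    show "expectation (\<lambda>\<omega>. (w (int 1) \<omega>)\<^sup>2 - \<sigma>2) = 0"
      using noise_moments(3) by (simp add: \<sigma>2_def prob_space)
  qed (use noise_moments in auto)
  moreover have "(\<Sum>i=1..<t. of_bool (1 \<le> i \<and> used C \<gamma> i \<omega>) * ((w (int (Suc i)) \<omega>)\<^sup>2 - \<sigma>2)) = variance_sum C \<gamma> \<omega> t" for t \<omega>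
    unfolding variance_sum_def by (rule sum.cong) auto
  ultimately show ?thesis by simp
qed

section \<open>The rate on a single path\<close>

lemma \<Delta>_bounded: "\<exists>B. \<forall>x\<in>cbox a b. \<bar>(\<Delta> x i \<omega> - v)\<^sup>2 - s\<bar> \<le> B"
proof -
  have "continuous_on (cbox a b) (\<lambda>x. (\<lambda>(x, z). f x z) (x, \<phi> i \<omega>))"
    by (rule continuous_on_compose2[OF f_cont]) (auto intro!: continuous_intros)
  then have "continuous_on (cbox a b) (\<lambda>x. (\<Delta> x i \<omega> - v)\<^sup>2 - s)"
    unfolding \<Delta>_def by (auto intro!: continuous_intros)
  then have "bounded ((\<lambda>x. (\<Delta> x i \<omega> - v)\<^sup>2 - s) ` cbox a b)"
    by (intro compact_imp_bounded compact_continuous_image box_compact)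
  then show ?thesis unfolding bounded_iff by auto
qed

text \<open>
  The two indicators can differ at times up to \<open>m\<close> only, and on a compact box a continuous summand is
  bounded at each of these times.
\<close>

lemma active_used_difference:
  fixes r :: "real ^ 'n \<Rightarrow> nat \<Rightarrow> real"
  assumes act: "\<And>i. CARD('m) < i \<Longrightarrow> act C \<gamma> i \<omega> \<Longrightarrow> norm (\<phi> i \<omega>) \<le> \<gamma>"
    and r: "\<And>i. \<exists>B. \<forall>x\<in>cbox a b. \<bar>r x i\<bar> \<le> B"
  shows "\<exists>B. \<forall>t. \<forall>x\<in>cbox a b. \<bar>(\<Sum>i=1..<t. r x i * of_bool (act C \<gamma> i \<omega>))
     - (\<Sum>i=1..<t. r x i * of_bool (used C \<gamma> i \<omega>))\<bar> \<le> B"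
proof -
  obtain B where B: "\<And>i x. x \<in> cbox a b \<Longrightarrow> \<bar>r x i\<bar> \<le> B i" using r by metis
  have B0: "0 \<le> B i" for i using B[OF theta, of i] by linarith
  have "\<bar>(\<Sum>i=1..<t. r x i * of_bool (act C \<gamma> i \<omega>))
     - (\<Sum>i=1..<t. r x i * of_bool (used C \<gamma> i \<omega>))\<bar> \<le> (\<Sum>i\<le>CARD('m). B i)" if x: "x \<in> cbox a b" for t x
  proof -
    define e where "e i = r x i * of_bool (act C \<gamma> i \<omega>) - r x i * of_bool (used C \<gamma> i \<omega>)" for i
    have e: "\<bar>e i\<bar> \<le> (if i \<le> CARD('m) then B i else 0)" for i
    proof (cases "i \<le> CARD('m)")
      case True
      then show ?thesis using B[OF x, of i] B0[of i] by (auto simp: e_def used_def)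
    next
      case False
      then have "act C \<gamma> i \<omega> = used C \<gamma> i \<omega>"
        using act[of i] by (auto simp: used_def)
      then show ?thesis using B0[of i] by (simp add: e_def)
    qed
    have "\<bar>\<Sum>i=1..<t. e i\<bar> \<le> (\<Sum>i=1..<t. if i \<le> CARD('m) then B i else 0)"
      by (rule order.trans[OF sum_abs]) (rule sum_mono, rule e)
    also have "\<dots> = (\<Sum>i\<in>{1..<t} \<inter> {i. i \<le> CARD('m)}. B i)" by (simp add: sum.If_cases)
    also have "\<dots> \<le> (\<Sum>i\<le>CARD('m). B i)" by (rule sum_mono2) (use B0 in auto)
    finally show ?thesis unfolding e_def by (simp add: sum_subtractf)
  qed
  then show ?thesis by blast
qed

lemma criterion_expansion:
  assumes \<omega>: "\<omega> \<in> space M" and e1: "0 \<le> e1"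
    and act: "\<And>i. CARD('m) < i \<Longrightarrow> act C \<gamma> i \<omega> \<Longrightarrow> norm (\<phi> i \<omega>) \<le> \<gamma>"
    and cross: "\<exists>K. \<forall>\<^sub>F t in sequentially. \<forall>x\<in>cbox a b. \<bar>cross_sum C \<gamma> \<omega> t x\<bar> \<le> K * real t powr e1"
    and var: "\<forall>\<^sub>F t in sequentially. \<bar>variance_sum C \<gamma> \<omega> t\<bar> \<le> real t powr e1"
  shows "\<exists>K. \<forall>\<^sub>F t in sequentially. \<forall>x\<in>cbox a b. \<forall>x'.
    \<bar>G_hat f lag Cw C \<gamma> (\<lambda>s. u s \<omega>) (\<lambda>s. y s \<omega>) t x x'
      - (\<Sum>i=1..<t. (\<Delta> x i \<omega>)\<^sup>2 * of_bool (used C \<gamma> i \<omega>))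
      + eta lag Cw C \<gamma> (\<lambda>s. y s \<omega>) t * (x' - \<sigma>2)\<bar> \<le> K * real t powr e1"
proof -
  obtain K where K: "\<forall>\<^sub>F t in sequentially. \<forall>x\<in>cbox a b. \<bar>cross_sum C \<gamma> \<omega> t x\<bar> \<le> K * real t powr e1"
    using cross by blast
  define r where "r x i = (\<Delta> x i \<omega> - w (int (Suc i)) \<omega>)\<^sup>2 - \<sigma>2" for x i
  define act' where "act' i = (of_bool (act C \<gamma> i \<omega>) :: real)" for i :: nat
  define use' where "use' i = (of_bool (used C \<gamma> i \<omega>) :: real)" for i
  obtain B where B: "\<And>t x. x \<in> cbox a b \<Longrightarrow> \<bar>(\<Sum>i=1..<t. r x i * act' i) - (\<Sum>i=1..<t. r x i * use' i)\<bar> \<le> B"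
    using active_used_difference[where r=r, OF act] \<Delta>_bounded unfolding r_def act'_def use'_def by blast
  have B0: "0 \<le> B" using B[OF theta, of 0] by simp
  have \<sigma>: "0 \<le> \<sigma>2" by (rule noise_moments)
  have "\<forall>\<^sub>F t in sequentially. \<forall>x\<in>cbox a b. \<forall>x'.
    \<bar>G_hat f lag Cw C \<gamma> (\<lambda>s. u s \<omega>) (\<lambda>s. y s \<omega>) t x x'
      - (\<Sum>i=1..<t. (\<Delta> x i \<omega>)\<^sup>2 * use' i)
      + eta lag Cw C \<gamma> (\<lambda>s. y s \<omega>) t * (x' - \<sigma>2)\<bar> \<le> (2 * K + 1 + B + \<sigma>2) * real t powr e1"
    using K var eventually_gt_at_top[of 0]
  proof eventually_elim
    case (elim t)
    show ?case
    proof (intro ballI allI)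
      fix x x' assume x: "x \<in> cbox a b"
      define G where "G = G_hat f lag Cw C \<gamma> (\<lambda>s. u s \<omega>) (\<lambda>s. y s \<omega>) t x x'"
      define \<eta> where "\<eta> = eta lag Cw C \<gamma> (\<lambda>s. y s \<omega>) t"
      have res: "f x (regressor lag (\<lambda>s. y s \<omega>) (int i)) + u (int i) \<omega> - y (int i + 1) \<omega> = \<Delta> x i \<omega> - w (int (Suc i)) \<omega>" for i
        using output_step[OF \<omega>, of i] by (simp add: \<Delta>_def predictor_def \<phi>_def add.commute)
      have \<eta>_eq: "\<eta> = (\<Sum>i=1..<t. act' i) + act' t"
        using elim(3) by (cases t) (simp_all add: \<eta>_def eta_def act'_def atLeastLessThanSuc_atLeastAtMost)
      have "G = (\<Sum>i=1..<t. (\<Delta> x i \<omega> - w (int (Suc i)) \<omega>)\<^sup>2 * act' i) - \<eta> * x'"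
        unfolding G_def G_hat_def res \<eta>_def act'_def ..
      also have "(\<Sum>i=1..<t. (\<Delta> x i \<omega> - w (int (Suc i)) \<omega>)\<^sup>2 * act' i)
         = (\<Sum>i=1..<t. r x i * act' i) + \<sigma>2 * (\<Sum>i=1..<t. act' i)"
        unfolding r_def sum_distrib_left sum.distrib[symmetric] by (rule sum.cong) (auto simp: algebra_simps)
      also have "(\<Sum>i=1..<t. act' i) = \<eta> - act' t" using \<eta>_eq by simp
      finally have G: "G + \<eta> * (x' - \<sigma>2) = (\<Sum>i=1..<t. r x i * act' i) - \<sigma>2 * act' t"
        by (simp add: algebra_simps)
      have U: "(\<Sum>i=1..<t. r x i * use' i) = (\<Sum>i=1..<t. (\<Delta> x i \<omega>)\<^sup>2 * use' i)
          - 2 * cross_sum C \<gamma> \<omega> t x + variance_sum C \<gamma> \<omega> t"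
        unfolding r_def cross_sum_def variance_sum_def use'_def sum_distrib_left sum_subtractf[symmetric] sum.distrib[symmetric]
        by (rule sum.cong) (auto simp: power2_eq_square algebra_simps)
      have one: "1 \<le> real t powr e1" using elim(3) e1 by (simp add: ge_one_powr_ge_zero)
      have act: "0 \<le> \<sigma>2 * act' t" "\<sigma>2 * act' t \<le> \<sigma>2" using \<sigma> by (auto simp: act'_def of_bool_def)
      have BS: "B + \<sigma>2 \<le> (B + \<sigma>2) * real t powr e1"
        using mult_left_mono[OF one, of "B + \<sigma>2"] B0 \<sigma> by simp
      have "\<bar>cross_sum C \<gamma> \<omega> t x\<bar> \<le> K * real t powr e1" using elim(1) x by blast
      then have "\<bar>(G + \<eta> * (x' - \<sigma>2)) - (\<Sum>i=1..<t. (\<Delta> x i \<omega>)\<^sup>2 * use' i)\<bar>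
         \<le> B + \<sigma>2 + 2 * (K * real t powr e1) + real t powr e1"
        using G U B[OF x, of t] elim(2) act unfolding abs_le_iff by linarith
      also have "\<dots> \<le> (2 * K + 1 + B + \<sigma>2) * real t powr e1" using BS by (simp add: algebra_simps)
      finally show "\<bar>G - (\<Sum>i=1..<t. (\<Delta> x i \<omega>)\<^sup>2 * use' i) + \<eta> * (x' - \<sigma>2)\<bar> \<le> (2 * K + 1 + B + \<sigma>2) * real t powr e1"
        by (simp add: algebra_simps)
    qed
  qed
  then show ?thesis unfolding use'_def by blast
qed

lemma prior_contains_variance:
  assumes "valid_prior V \<sigma>2"
  shows "\<forall>\<^sub>F t in sequentially. prior_lo V \<sigma>2 t \<le> \<sigma>2 \<and> \<sigma>2 \<le> prior_hi V \<sigma>2 t"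
proof -
  obtain T :: nat where T: "\<sigma>2 \<le> real T" using real_arch_simple by blast
  have \<sigma>: "0 \<le> \<sigma>2" by (rule noise_moments)
  show ?thesis using eventually_ge_at_top[of T]
  proof eventually_elim
    case (elim t)
    have "\<sigma>2 \<le> real t" using T elim by linarith
    then show ?case using \<sigma> assms by (cases V) (auto simp: valid_prior_def)
  qed
qed

text \<open>
  All probability is over: on a path with excitation and with the two noise bounds, the rate follows
  from comparing the selected grid point with the one nearest to \<open>(\<theta>, \<sigma>2)\<close>. The exponents fit
  together because \<open>t\<close> times the square of the mesh bound \<open>h\<close> of the parameter grid is exactly \<open>t powr e2\<close>, and
  \<open>t\<close> times the mesh bound \<open>h'\<close> of the variance grid is exactly \<open>t powr e1\<close>, of lower order.
\<close>

theorem estimation_error_rate: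
  fixes V :: variance_prior and p :: "nat \<Rightarrow> 'n \<Rightarrow> nat" and q :: "nat \<Rightarrow> nat" and \<theta>h :: "nat \<Rightarrow> real ^ 'n" and sh :: "nat \<Rightarrow> real"
  defines "lo \<equiv> prior_lo V \<sigma>2" and "hi \<equiv> prior_hi V \<sigma>2"
  assumes \<omega>: "\<omega> \<in> space M" and \<gamma>: "0 < \<gamma>"
    and lam: "0 < lam" "lam < 1 / 4 - 1 / (2 * \<kappa>)"
    and V: "valid_prior V \<sigma>2"
    and act: "\<And>i. CARD('m) < i \<Longrightarrow> act C \<gamma> i \<omega> \<Longrightarrow> norm (\<phi> i \<omega>) \<le> \<gamma>"
    and exc: "exciting C \<gamma> \<omega>"
    and cross: "\<exists>K. \<forall>\<^sub>F t in sequentially. \<forall>x\<in>cbox a b. \<bar>cross_sum C \<gamma> \<omega> t x\<bar> \<le> K * real t powr (1/2 + (1/\<kappa> + lam))"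
    and var: "\<forall>\<^sub>F t in sequentially. \<bar>variance_sum C \<gamma> \<omega> t\<bar> \<le> real t powr (1/2 + (1/\<kappa> + lam))"
    and grid: "fine_grid a b lo hi \<kappa> lam p q"
    and est: "grid_searching_estimates f Df a b lo hi lag Cw C \<gamma> \<kappa> lam p q (\<lambda>s. u s \<omega>) (\<lambda>s. y s \<omega>) \<theta>h sh"
  shows "(\<lambda>t. norm (\<theta>h t - \<theta>)) \<in> O(\<lambda>t. 1 / real t powr (1 / 4 - 1 / (2 * \<kappa>) - lam))"
proof -
  have \<kappa>: "4 < \<kappa>" by (rule noise_moments)
  define e1 where "e1 = 1/2 + (1/\<kappa> + lam)"
  define e2 where "e2 = 1/2 + 1/\<kappa> + 2 * lam"
  define \<rho> where "\<rho> = 1/4 - 1/(2*\<kappa>) - lam"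
  have e1: "0 \<le> e1" using \<kappa> lam by (simp add: e1_def)
  have e2_eq: "e2 = e1 + lam" by (simp add: e1_def e2_def)
  have \<rho>_eq: "1 - 2 * \<rho> = e2" unfolding \<rho>_def e2_def using \<kappa> by (simp add: field_simps)
  define S where "S = gradient_bound \<gamma>"
  have S0: "0 \<le> S" unfolding S_def using gradient_bound_nonneg \<gamma> by simp
  define CP where "CP = C_phi Df (cbox a b) \<gamma>"
  have CP: "CP = real CARD('n) / 4 * S + 1" by (simp add: CP_def C_phi_def S_def gradient_bound_def)
  have CP1: "1 \<le> CP" using CP S0 by simp
  define G where "G t = G_hat f lag Cw C \<gamma> (\<lambda>s. u s \<omega>) (\<lambda>s. y s \<omega>) t" for t
  define D where "D t x = (\<Sum>i=1..<t. (\<Delta> x i \<omega>)\<^sup>2 * of_bool (used C \<gamma> i \<omega>))" for t x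
  define \<eta> where "\<eta> t = eta lag Cw C \<gamma> (\<lambda>s. y s \<omega>) t" for t
  have \<eta>: "0 \<le> \<eta> t" "\<eta> t \<le> real t" for t
  proof -
    show "0 \<le> \<eta> t" unfolding \<eta>_def eta_def by (rule sum_nonneg) simp
    have "\<eta> t \<le> (\<Sum>i=1..t. 1)" unfolding \<eta>_def eta_def by (rule sum_mono) simp
    then show "\<eta> t \<le> real t" by simp
  qed
  obtain K where K: "\<forall>\<^sub>F t in sequentially. \<forall>x\<in>cbox a b. \<forall>x'. \<bar>G t x x' - D t x + \<eta> t * (x' - \<sigma>2)\<bar> \<le> K * real t powr e1"
    using criterion_expansion[OF \<omega> e1 act cross[folded e1_def] var[folded e1_def]]
    unfolding G_def D_def \<eta>_def by blast
  obtain c where c: "0 < c" "\<forall>\<^sub>F t in sequentially. \<forall>x\<in>cbox a b. c * real t * (norm (x - \<theta>))\<^sup>2 \<le> D t x"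
    using exc unfolding exciting_def D_def by blast
  have small: "\<forall>\<^sub>F t in sequentially. K * real t powr e1 + real t powr e1 \<le> real t powr e2"
  proof -
    have "filterlim (\<lambda>t. real t powr lam) at_top sequentially" using lam(1) by real_asymp
    then have "\<forall>\<^sub>F t in sequentially. K + 1 \<le> real t powr lam" by (simp add: filterlim_at_top)
    then show ?thesis
    proof eventually_elim
      case (elim t)
      have "(K + 1) * real t powr e1 \<le> real t powr lam * real t powr e1" using elim by (rule mult_right_mono) simp
      then show ?case by (simp add: e2_eq powr_add algebra_simps)
    qed
  qed
  define A where "A = (CP + 1) / c"
  have "\<forall>\<^sub>F t in sequentially. norm (\<theta>h t - \<theta>) \<le> sqrt A * (1 / real t powr \<rho>)"
    using K c(2) small prior_contains_variance[OF V] eventually_gt_at_top[of 0]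
  proof eventually_elim
    case (elim t)
    define h where "h = 1 / real t powr \<rho>"
    define h' where "h' = 1 / real t powr (1/2 - 1/\<kappa> - lam)"
    have h0: "0 < h" "0 < h'" using elim(5) by (simp_all add: h_def h'_def)
    have tpow: "real t powr 1 = real t" using elim(5) by simp
    have h2: "real t * h\<^sup>2 = real t powr e2"
    proof -
      have "h\<^sup>2 = 1 / real t powr (2 * \<rho>)"
        unfolding h_def mult_2 powr_add by (simp add: power2_eq_square)
      then have "real t * h\<^sup>2 = real t powr 1 / real t powr (2 * \<rho>)" using tpow by simp
      then show ?thesis unfolding powr_diff[symmetric] \<rho>_eq .
    qed
    have h'1: "real t * h' = real t powr e1"
    proof -
      have "real t * h' = real t powr 1 / real t powr (1/2 - 1/\<kappa> - lam)" using tpow by (simp add: h'_def)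
      also have "\<dots> = real t powr (1 - (1/2 - 1/\<kappa> - lam))" by (rule powr_diff[symmetric])
      also have "1 - (1/2 - 1/\<kappa> - lam) = e1" by (simp add: e1_def)
      finally show ?thesis .
    qed
    have grid_t: "0 < p t k" "(b $ k - a $ k) / real (p t k) \<le> h"
        "0 < q t" "(hi t - lo t) / real (q t) \<le> h'" for k
    proof -
      have g: "(\<forall>k. 0 < p t k \<and> (b $ k - a $ k) / real (p t k) < h) \<and> 0 < q t \<and> (hi t - lo t) / real (q t) < h'"
        unfolding h_def h'_def \<rho>_def
        by (rule grid[unfolded fine_grid_def, THEN spec, THEN mp]) (use elim(5) in simp)
      show "0 < p t k" "(b $ k - a $ k) / real (p t k) \<le> h" using g less_imp_le by blast+
      show "0 < q t" "(hi t - lo t) / real (q t) \<le> h'" using g less_imp_le by blast+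
    qed
    define J where "J = J_set f Df a b lo hi lag Cw C \<gamma> \<kappa> lam p q (\<lambda>s. u s \<omega>) (\<lambda>s. y s \<omega>) t"
    define ctr where "ctr = interval_center (lo t) (hi t) (q t)"
    have J_iff: "(i, j) \<in> J \<longleftrightarrow> (\<forall>k. i k < p t k) \<and> j < q t \<and>
        \<bar>G t (box_center a b (p t) i) (ctr j)\<bar> \<le> CP * real t powr e2" for i j
      by (simp add: J_def J_set_def G_def ctr_def CP_def e2_def)
    have "finite J"
    proof (rule finite_subset)
      show "J \<subseteq> {i. \<forall>k. i k < p t k} \<times> {..<q t}" using J_iff by auto
      show "finite ({i. \<forall>k. i k < p t k} \<times> {..<q t})" by (intro finite_cartesian_product finite_indices) simp
    qed
    \<comment> \<open>The grid point nearest to the true values is accepted.\<close>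
    obtain i0 where i0: "\<forall>k. i0 k < p t k"
        "\<And>k. \<bar>\<theta> $ k - box_center a b (p t) i0 $ k\<bar> \<le> (b $ k - a $ k) / real (p t k) / 2"
      using near_box_center[OF theta, of "p t"] grid_t(1) by blast
    obtain j0 where j0: "j0 < q t" "\<bar>\<sigma>2 - ctr j0\<bar> \<le> (hi t - lo t) / real (q t) / 2"
      using near_interval_center[of "lo t" \<sigma>2 "hi t" "q t"] elim(4) grid_t(3) unfolding ctr_def lo_def hi_def by blast
    define x0 where "x0 = box_center a b (p t) i0"
    have x0: "x0 \<in> cbox a b" unfolding x0_def using i0(1) by (intro box_center_in_box box_le) auto
    have near: "(norm (x0 - \<theta>))\<^sup>2 \<le> real CARD('n) / 4 * h\<^sup>2"
      unfolding norm_minus_commute[of x0]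
      by (rule near_center_norm[OF i0(2)[folded x0_def] grid_t(2)])
    have D0: "D t x0 \<le> (CP - 1) * real t powr e2"
    proof -
      have "D t x0 \<le> (\<Sum>i=1..<t. S * (real CARD('n) / 4 * h\<^sup>2))" unfolding D_def
      proof (rule sum_mono)
        fix i
        show "(\<Delta> x0 i \<omega>)\<^sup>2 * of_bool (used C \<gamma> i \<omega>) \<le> S * (real CARD('n) / 4 * h\<^sup>2)"
        proof (cases "used C \<gamma> i \<omega>")
          case True
          then have "(\<Delta> x0 i \<omega>)\<^sup>2 \<le> S * (norm (x0 - \<theta>))\<^sup>2"
            using f_increment[OF x0 theta, of "\<phi> i \<omega>" \<gamma>] by (simp add: used_def \<Delta>_def S_def)
          also have "\<dots> \<le> S * (real CARD('n) / 4 * h\<^sup>2)" by (rule mult_left_mono[OF near S0])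
          finally show ?thesis using True by simp
        qed (use S0 in simp)
      qed
      also have "\<dots> = real (t - 1) * (S * (real CARD('n) / 4 * h\<^sup>2))" by simp
      also have "\<dots> \<le> real t * (S * (real CARD('n) / 4 * h\<^sup>2))" using S0 by (intro mult_right_mono) auto
      also have "\<dots> = (CP - 1) * (real t * h\<^sup>2)" by (simp add: CP)
      finally show ?thesis unfolding h2 .
    qed
    have Dpos: "0 \<le> D t x0" unfolding D_def by (rule sum_nonneg) simp
    have ctr0: "\<bar>ctr j0 - \<sigma>2\<bar> \<le> h'"
      using j0(2) divide_right_mono[OF grid_t(4), of 2] h0 by linarith
    have "\<bar>\<eta> t * (ctr j0 - \<sigma>2)\<bar> \<le> real t * h'"
      unfolding abs_mult using \<eta>[of t] ctr0 by (intro mult_mono) auto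
    then have "\<bar>\<eta> t * (ctr j0 - \<sigma>2)\<bar> \<le> real t powr e1" by (simp add: h'1)
    moreover have "\<bar>G t x0 (ctr j0) - D t x0 + \<eta> t * (ctr j0 - \<sigma>2)\<bar> \<le> K * real t powr e1" using elim(1) x0 by blast
    ultimately have "\<bar>G t x0 (ctr j0)\<bar> \<le> (CP - 1) * real t powr e2 + (K * real t powr e1 + real t powr e1)"
      using D0 Dpos by linarith
    also have "\<dots> \<le> CP * real t powr e2" using elim(3) by (simp add: algebra_simps)
    finally have "(i0, j0) \<in> J" using J_iff i0(1) j0(1) by (simp add: x0_def)
    then have "J \<noteq> {}" by blast
    moreover have "let J = J_set f Df a b lo hi lag Cw C \<gamma> \<kappa> lam p q (\<lambda>s. u s \<omega>) (\<lambda>s. y s \<omega>) t;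
                ctr = interval_center (lo t) (hi t) (q t) in
        if J = {} then \<theta>h t = \<theta>h (t - 1) \<and> sh t = sh (t - 1)
        else \<exists>(i, j)\<in>J. ctr j = Min ((\<lambda>(i', j'). ctr j') ` J) \<and>
               \<theta>h t = box_center a b (p t) i \<and> sh t = ctr j"
      using est elim(5) unfolding grid_searching_estimates_def by simp
    ultimately obtain i j where ij: "(i, j) \<in> J" "ctr j = Min ((\<lambda>(i', j'). ctr j') ` J)" "\<theta>h t = box_center a b (p t) i"
      unfolding Let_def J_def[symmetric] ctr_def[symmetric] by auto
    \<comment> \<open>The term \<open>\<eta> t * (ctr j - \<sigma>2)\<close> has to be bounded from above only, and minimality of the
      selected variance does that.\<close>
    have "ctr j \<le> ctr j0" unfolding ij(2)
      using \<open>(i0, j0) \<in> J\<close> \<open>finite J\<close> by (intro Min_le finite_imageI) (auto intro: rev_image_eqI)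
    then have ctr: "ctr j - \<sigma>2 \<le> h'" using ctr0 by linarith
    have x: "\<theta>h t \<in> cbox a b" unfolding ij(3) using ij(1) J_iff by (intro box_center_in_box box_le) auto
    have "\<eta> t * (ctr j - \<sigma>2) \<le> \<eta> t * h'" using ctr \<eta>(1) by (rule mult_left_mono)
    also have "\<dots> \<le> real t * h'" using \<eta>(2) h0 by (intro mult_right_mono) auto
    finally have "\<eta> t * (ctr j - \<sigma>2) \<le> real t powr e1" by (simp add: h'1)
    moreover have "\<bar>G t (\<theta>h t) (ctr j) - D t (\<theta>h t) + \<eta> t * (ctr j - \<sigma>2)\<bar> \<le> K * real t powr e1" using elim(1) x by blast
    moreover have "\<bar>G t (\<theta>h t) (ctr j)\<bar> \<le> CP * real t powr e2" using ij J_iff by simp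
    ultimately have "D t (\<theta>h t) \<le> CP * real t powr e2 + (K * real t powr e1 + real t powr e1)" by linarith
    also have "\<dots> \<le> (CP + 1) * real t powr e2" using elim(3) by (simp add: algebra_simps)
    finally have "D t (\<theta>h t) \<le> (CP + 1) * (real t * h\<^sup>2)" unfolding h2 .
    moreover have "c * real t * (norm (\<theta>h t - \<theta>))\<^sup>2 \<le> D t (\<theta>h t)" using elim(2) x by blast
    ultimately have "real t * (c * (norm (\<theta>h t - \<theta>))\<^sup>2) \<le> real t * ((CP + 1) * h\<^sup>2)"
      by (simp add: mult_ac)
    then have "c * (norm (\<theta>h t - \<theta>))\<^sup>2 \<le> (CP + 1) * h\<^sup>2" using elim(5) by simp
    then have "(norm (\<theta>h t - \<theta>))\<^sup>2 \<le> A * h\<^sup>2" using c(1) by (simp add: A_def field_simps)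
    then have "sqrt ((norm (\<theta>h t - \<theta>))\<^sup>2) \<le> sqrt (A * h\<^sup>2)" by (rule real_sqrt_le_mono)
    then show "norm (\<theta>h t - \<theta>) \<le> sqrt A * (1 / real t powr \<rho>)"
      using h0 by (simp add: real_sqrt_mult h_def)
  qed
  then show ?thesis unfolding \<rho>_def
    by (intro bigoI[of _ "sqrt A"]) simp
qed

end

section \<open>Consistency of the grid searching estimator\<close>

lemma rate_vanishes:
  assumes "0 < \<rho>" "g \<in> O(\<lambda>t. 1 / real t powr \<rho>)"
  shows "(g :: nat \<Rightarrow> real) \<longlonglongrightarrow> 0"
proof -
  have "((\<lambda>t::nat. 1 / real t powr \<rho>) \<longlongrightarrow> 0) sequentially" using assms(1) by real_asymp
  then have "(\<lambda>t::nat. 1 / real t powr \<rho>) \<in> o(\<lambda>_. 1)" by (intro smalloI_tendsto) auto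
  with assms(2) have "g \<in> o(\<lambda>_. 1)" by (rule landau_o.big_small_trans)
  then show ?thesis using smalloD_tendsto by fastforce
qed
theorem theorem3p1:
  fixes M :: "'a measure"
    and f :: "real ^ 'n::finite \<Rightarrow> real ^ 'm::finite \<Rightarrow> real"
    and Df :: "real ^ 'n \<Rightarrow> real ^ 'm \<Rightarrow> real ^ 'n"
    and coord :: "nat \<Rightarrow> 'n" and lag :: "'m \<Rightarrow> nat"
    and a b \<theta> :: "real ^ 'n"
    and y u w :: "int \<Rightarrow> 'a \<Rightarrow> real" and \<chi>0 :: "'a \<Rightarrow> real ^ 'm"
    and Cw C :: ennreal and Cu C0 \<kappa> sw2 :: real
    and V :: variance_prior
  defines "m \<equiv> int CARD('m)"
    and "N \<equiv> 2 ^ (CARD('n) - 1) * CARD('m)"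
    and "\<Theta> \<equiv> cbox a b"
    and "sw2 \<equiv> integral\<^sup>L M (\<lambda>\<omega>. (w 1 \<omega>)\<^sup>2)"
  assumes prob: "prob_space M"
    and coord: "bij_betw coord {1..CARD('n)} UNIV"
    and lag: "bij_betw lag UNIV {0..<CARD('m)}"
    and nondegenerate: "\<forall>k. a $ k < b $ k"
    and theta: "\<theta> \<in> \<Theta>"
    and f_cont: "continuous_on UNIV (\<lambda>(x, z). f x z)"
    and f_deriv: "\<forall>x z. GDERIV (\<lambda>x'. f x' z) x :> Df x z"
    and Df_cont: "continuous_on UNIV (\<lambda>(x, z). Df x z)"
    and Cu: "0 < Cu"
    and inputs: "admissible_experiment M m Cu \<chi>0 u"
    and B1: "assumption_B1 M m Cw \<kappa> \<chi>0 u w"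
    and init: "\<forall>\<omega>\<in>space M. regressor lag (\<lambda>s. y s \<omega>) (1 - m) = \<chi>0 \<omega>"
    and closed_loop: "\<forall>\<omega>\<in>space M. \<forall>t\<ge>1 - m.
          y (t + 1) \<omega> = f \<theta> (regressor lag (\<lambda>s. y s \<omega>) t) + u t \<omega> + w (t + 1) \<omega>"
    and stable: "AE \<omega> in M. stable_path (\<lambda>s. y s \<omega>)"
    and C: "0 < C"
    and excitation:
      "(Cw < \<infinity> \<and>
        0 < C0 \<and>
        (AE \<omega> in M. \<forall>t\<ge>1. ennreal (norm (regressor lag (\<lambda>s. y s \<omega>) t)) \<le> C \<longrightarrow>
           (\<forall>i\<in>{t..t + m - 1}. \<bar>f \<theta> (regressor lag (\<lambda>s. y s \<omega>) i) + u i \<omega>\<bar> \<le> C0)) \<and>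
        (C < \<infinity> \<longrightarrow> (AE \<omega> in M. visits_ball lag C (\<lambda>s. y s \<omega>))) \<and>
        1 / Cw < lower_density_prod N (P_set Df coord lag \<Theta>) (\<lambda>_. {- C0..C0}))
       \<or> (Cw = \<infinity> \<and> P_set Df coord lag \<Theta> \<noteq> {})"
    and prior: "valid_prior V sw2"
  shows "\<exists>\<gamma>0>0. \<forall>\<gamma>\<ge>\<gamma>0. \<forall>lam. 0 < lam \<and> lam < 1 / 4 - 1 / (2 * \<kappa>) \<longrightarrow>
     (\<forall>p q \<theta>h sh.
        fine_grid a b (prior_lo V sw2) (prior_hi V sw2) \<kappa> lam p q \<longrightarrow>
        (\<forall>\<omega>\<in>space M.
           grid_searching_estimates f Df a b (prior_lo V sw2) (prior_hi V sw2) lag Cw C \<gamma> \<kappa> lam p q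
             (\<lambda>s. u s \<omega>) (\<lambda>s. y s \<omega>) (\<lambda>t. \<theta>h t \<omega>) (\<lambda>t. sh t \<omega>)) \<longrightarrow>
        (AE \<omega> in M.
           (\<lambda>t. norm (\<theta>h t \<omega> - \<theta>)) \<in> O(\<lambda>t. 1 / real t powr (1 / 4 - 1 / (2 * \<kappa>) - lam)) \<and>
           (\<lambda>t. norm (\<theta>h t \<omega> - \<theta>)) \<longlonglongrightarrow> 0))"
proof -
  interpret closed_loop_system M f Df coord lag a b \<theta> y u w \<chi>0 Cw Cu \<kappa> m
  proof (rule closed_loop_system.intro[OF prob], rule closed_loop_system_axioms.intro)
    show "m = int CARD('m)" by (simp add: m_def)
    show "\<theta> \<in> cbox a b" using theta by (simp add: \<Theta>_def)
  qed (fact coord lag nondegenerate f_cont f_deriv Df_cont inputs B1 init closed_loop)+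
  have sw2: "sw2 = \<sigma>2" by (simp add: sw2_def \<sigma>2_def)
  have \<kappa>: "4 < \<kappa>" by (rule noise_moments)
  have "\<exists>\<gamma>0>0. \<forall>\<gamma>\<ge>\<gamma>0.
    (AE \<omega> in M. \<forall>i>CARD('m). active lag Cw C \<gamma> (\<lambda>s. y s \<omega>) (int i) \<longrightarrow> norm (\<phi> i \<omega>) \<le> \<gamma>) \<and>
    (AE \<omega> in M. exciting C \<gamma> \<omega>)"
    using excitation
  proof (elim disjE conjE)
    assume "Cw < \<infinity>" "0 < C0"
      "AE \<omega> in M. \<forall>t\<ge>1. ennreal (norm (regressor lag (\<lambda>s. y s \<omega>) t)) \<le> C \<longrightarrow>
           (\<forall>i\<in>{t..t + m - 1}. \<bar>f \<theta> (regressor lag (\<lambda>s. y s \<omega>) i) + u i \<omega>\<bar> \<le> C0)"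
      "C < \<infinity> \<longrightarrow> (AE \<omega> in M. visits_ball lag C (\<lambda>s. y s \<omega>))"
      "1 / Cw < lower_density_prod N (P_set Df coord lag \<Theta>) (\<lambda>_. {- C0..C0})"
    then show ?thesis
      unfolding N_def \<Theta>_def by (intro excitation_bounded_noise) (assumption | erule mp)+
  next
    assume Cw: "Cw = \<infinity>" and "P_set Df coord lag \<Theta> \<noteq> {}"
    then obtain \<gamma>0 where "0 < \<gamma>0" "\<forall>\<gamma>\<ge>\<gamma>0. AE \<omega> in M. exciting C \<gamma> \<omega>"
      using excitation_unbounded_noise[OF Cw C stable] unfolding \<Theta>_def by blast
    moreover have "norm (\<phi> i \<omega>) \<le> \<gamma>" if "active lag Cw C \<gamma> (\<lambda>s. y s \<omega>) (int i)" for \<gamma> i \<omega>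
      using that Cw by (simp add: active_def \<phi>_def)
    ultimately show ?thesis by (intro exI[of _ \<gamma>0]) simp
  qed
  then obtain \<gamma>0 where \<gamma>0: "0 < \<gamma>0"
    and act: "\<And>\<gamma>. \<gamma>0 \<le> \<gamma> \<Longrightarrow> AE \<omega> in M. \<forall>i>CARD('m). active lag Cw C \<gamma> (\<lambda>s. y s \<omega>) (int i) \<longrightarrow> norm (\<phi> i \<omega>) \<le> \<gamma>"
    and exc: "\<And>\<gamma>. \<gamma>0 \<le> \<gamma> \<Longrightarrow> AE \<omega> in M. exciting C \<gamma> \<omega>"
    by blast
  show ?thesis
  proof (intro exI[of _ \<gamma>0] conjI allI impI \<gamma>0)
    fix \<gamma> lam p q \<theta>h sh
    assume \<gamma>: "\<gamma>0 \<le> \<gamma>" and lam: "0 < lam \<and> lam < 1 / 4 - 1 / (2 * \<kappa>)"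
      and grid: "fine_grid a b (prior_lo V sw2) (prior_hi V sw2) \<kappa> lam p q"
      and est: "\<forall>\<omega>\<in>space M.
           grid_searching_estimates f Df a b (prior_lo V sw2) (prior_hi V sw2) lag Cw C \<gamma> \<kappa> lam p q
             (\<lambda>s. u s \<omega>) (\<lambda>s. y s \<omega>) (\<lambda>t. \<theta>h t \<omega>) (\<lambda>t. sh t \<omega>)"
    have \<gamma>_pos: "0 < \<gamma>" using \<gamma> \<gamma>0 by linarith
    have \<epsilon>: "0 < 1 / \<kappa> + lam" using \<kappa> lam by (simp add: add_pos_pos)
    show "AE \<omega> in M.
           (\<lambda>t. norm (\<theta>h t \<omega> - \<theta>)) \<in> O(\<lambda>t. 1 / real t powr (1 / 4 - 1 / (2 * \<kappa>) - lam)) \<and>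
           (\<lambda>t. norm (\<theta>h t \<omega> - \<theta>)) \<longlonglongrightarrow> 0"
      using act[OF \<gamma>] exc[OF \<gamma>] cross_sum_bound[OF \<gamma>_pos \<epsilon>, of C] variance_sum_bound[OF \<epsilon>, of C \<gamma>] AE_space
    proof eventually_elim
      case (elim \<omega>)
      have "(\<lambda>t. norm (\<theta>h t \<omega> - \<theta>)) \<in> O(\<lambda>t. 1 / real t powr (1 / 4 - 1 / (2 * \<kappa>) - lam))"
      proof (rule estimation_error_rate[where V=V and \<theta>h="\<lambda>t. \<theta>h t \<omega>" and sh="\<lambda>t. sh t \<omega>"])
        show "grid_searching_estimates f Df a b (prior_lo V \<sigma>2) (prior_hi V \<sigma>2) lag Cw C \<gamma> \<kappa> lam p q
             (\<lambda>s. u s \<omega>) (\<lambda>s. y s \<omega>) (\<lambda>t. \<theta>h t \<omega>) (\<lambda>t. sh t \<omega>)"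
          using est elim(5) by (simp add: sw2)
        show "fine_grid a b (prior_lo V \<sigma>2) (prior_hi V \<sigma>2) \<kappa> lam p q" using grid by (simp only: sw2)
        show "valid_prior V \<sigma>2" using prior by (simp only: sw2)
        show "norm (\<phi> i \<omega>) \<le> \<gamma>"
          if "CARD('m) < i" "active lag Cw C \<gamma> (\<lambda>s. y s \<omega>) (int i)" for i
          using elim(1) that by blast
      qed (use elim lam \<gamma>_pos in blast)+
      moreover from this have "(\<lambda>t. norm (\<theta>h t \<omega> - \<theta>)) \<longlonglongrightarrow> 0"
        by (rule rate_vanishes[rotated]) (use lam in simp)
      ultimately show ?case by blast
    qed
  qed
qed

end
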